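(* The following hold. (i) For every fractional ideal $I\in\mathcal F(\mathfrak O)$ the function $\tilde f_I$ belongs to $\mathcal S^u_{0,b}(\mathfrak O;\widetilde V)$, and the map $$\widetilde F\colon \mathcal F(\mathfrak O)\longrightarrow \mathcal S^u_{0,b}(\mathfrak O;\widetilde V),\qquad I\longmapsto \tilde f_I$$ is an isomorphism of monoids. (ii) The image of $\mathrm{Reg}\,\mathcal F(\mathfrak O)$ under $\widetilde F$ is $\mathcal S^u_{0,\mathrm{ref}}(\mathfrak O;\widetilde V)$. (iii) The image of $\mathcal I(\mathfrak O)$ under $\widetilde F$ is $\mathcal S^u_{0,\mathrm{ref}}(\mathfrak O;\mathrm{val})$.
   Context: Setting: $\mathfrak o$ is a Dedekind domain which is not a field, $K$ its fraction field, $L/K$ an algebraic extension of fields (possibly of infinite degree), and $\mathfrak O$ the integral closure of $\mathfrak o$ in $L$. Ideals: a fractional ideal of $\mathfrak O$ is a non-zero $\mathfrak O$-submodule $I\subseteq L$ with $dI\subseteq\mathfrak O$ for some $d\in L^\times$; it is invertible if $IJ=\mathfrak O$ for some fractional ideal $J$. $\mathcal F(\mathfrak O)$ is the commutative monoid of fractional ideals under multiplication of ideals and $\mathcal I(\mathfrak O)$ the group of invertible ones. For a monoid $A$, $\mathrm{Reg}\,A$ is the set of (von Neumann) regular elements, i.e. $a\in A$ such that $a=aba$ for some $b\in A$. Topology: $\mathrm{mSpec}\,\mathfrak O$ is the set of maximal ideals of $\mathfrak O$ with the Krull-like topology, whose open base consists of the sets $\mathcal U(A)=\{\mathfrak P\in\mathrm{mSpec}\,\mathfrak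 O : A\subseteq\mathfrak P\}$ for $A$ a finite subset of $\mathfrak O$. The monoid $\widetilde{\mathbb R}$: $\widetilde{\mathbb R}=\mathbb R\times\{0,1\}$ with the lexicographic total order and addition $(\alpha,s)+(\beta,t)=(\alpha+\beta,\max\{s,t\})$; put $\iota(\alpha,s)=(-\alpha,s)$. Functions: a function $\tilde f\colon X\to\widetilde{\mathbb R}$ on a topological space $X$ is upper $\widetilde{\mathbb R}$-semicontinuous if $\{x\in X:\tilde f(x)<a\}$ is open for every $a\in\widetilde{\mathbb R}$; it is compactly supported if there is a compact $Y\subseteq X$ with $\tilde f=(0,0)$ on $X\setminus Y$; it is bounded if there are $a,b\in\widetilde{\mathbb R}$ with $a\le\tilde f(x)\le b$ for all $x$. $\mathcal S^u_{0,b}(X;\widetilde{\mathbb R})$ is the commutative monoid (under pointwise addition) of bounded, compactly supported, upper $\widetilde{\mathbb R}$-semicontinuous functions $X\to\widetilde{\mathbb R}$, and $\mathcal S^u_{0,\mathrm{ref}}(X;\widetilde{\mathbb R})$ is the submonoid of those $\tilde f$ with $\iota\circ\tilde f\in\mathcal S^u_{0,b}(X;\widetilde{\mathbb R})$. Valuations: for $\mathfrak P\in\mathrm{mSpec}\,\mathfrak O$, $v_{\mathfrak P}\colon L^\times\to\mathbb Q$ is the unique additive valuation corresponding to $\mathfrak P$ normalized by $v_{\mathfrak P}(K^\times)=\mathbb Z$; put $v_{\mathfrak P}(0)=+\infty$. $V_{\mathfrak P}$ is the closure of $v_{\mathfrak P}(L^\times)$ in $\mathbb R$. Put $\mathrm{val}_{\mathfrak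 P}=\{(\alpha,0):\alpha\in v_{\mathfrak P}(L^\times)\}$, and $\widetilde V_{\mathfrak P}=\mathrm{val}_{\mathfrak P}\sqcup\{(\beta,1):\beta\in\mathbb R\}$ if $V_{\mathfrak P}=\mathbb R$, $\widetilde V_{\mathfrak P}=\mathrm{val}_{\mathfrak P}$ if $V_{\mathfrak P}=v_{\mathfrak P}(L^\times)$ (exactly one of these cases occurs). $\mathcal S^u_{0,b}(\mathfrak O;\widetilde V)$ (resp. $\mathcal S^u_{0,\mathrm{ref}}(\mathfrak O;\widetilde V)$, resp. $\mathcal S^u_{0,\mathrm{ref}}(\mathfrak O;\mathrm{val})$) is the set of $\tilde f$ in $\mathcal S^u_{0,b}(\mathrm{mSpec}\,\mathfrak O;\widetilde{\mathbb R})$ (resp. in $\mathcal S^u_{0,\mathrm{ref}}(\mathrm{mSpec}\,\mathfrak O;\widetilde{\mathbb R})$ in the last two cases) with $\tilde f(\mathfrak P)\in\widetilde V_{\mathfrak P}$ (resp. $\widetilde V_{\mathfrak P}$, resp. $\mathrm{val}_{\mathfrak P}$) for all $\mathfrak P$; these are monoids under pointwise addition. For $I\in\mathcal F(\mathfrak O)$ put $f_I(\mathfrak P)=\inf\{v_{\mathfrak P}(x):x\in I\}$, let $\mathrm{Max}(I)$ be the set of $\mathfrak P$ for which this infimum is attained by some $x\in I$, and define $\tilde f_I\colon\mathrm{mSpec}\,\mathfrak O\to\widetilde{\mathbb R}$ by $\tilde f_I(\mathfrak P)=(f_I(\mathfrak P),0)$ if $\mathfrak P\in\mathrm{Max}(I)$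 and $\tilde f_I(\mathfrak P)=(f_I(\mathfrak P),1)$ otherwise. *)

theory Defs
  imports "HOL-Analysis.Analysis" "HOL-Algebra.Algebra" "HOL-Algebra.Algebraic_Closure_Type"
begin

section \<open>Algebraic setting\<close>

text \<open>
  The field \<open>L\<close> is the type \<open>'a\<close>; the rings \<open>\<oo>\<close>, \<open>\<OO>\<close>, the field \<open>K\<close> and all ideals are
  subsets of it. The structure that a subset \<open>S\<close> inherits from \<open>L\<close> is given as a
  HOL-Algebra ring, so that noetherian domains, prime and maximal ideals, products of ideals
  and algebraicity are those of HOL-Algebra.
\<close>

abbreviation ambient :: "'a::field ring" where
  "ambient \<equiv> ring_of_type_algebra"

abbreviation ring_on :: "'a::field set \<Rightarrow> 'a ring" where
  "ring_on S \<equiv> ambient\<lparr>carrier := S\<rparr>"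

definition frac_field :: "'a::field set \<Rightarrow> 'a set" where
  "frac_field S = {a / b | a b. a \<in> S \<and> b \<in> S \<and> b \<noteq> 0}"

definition integral_over :: "'a::field set \<Rightarrow> 'a \<Rightarrow> bool" where
  "integral_over S x \<longleftrightarrow>
     (\<exists>p :: 'a poly. Polynomial.lead_coeff p = 1 \<and> (\<forall>i. Polynomial.coeff p i \<in> S) \<and> poly p x = 0)"

definition integral_closure :: "'a::field set \<Rightarrow> 'a set" where
  "integral_closure S = {x. integral_over S x}"

definition dedekind_domain :: "'a::field set \<Rightarrow> bool" where
  "dedekind_domain S \<longleftrightarrow>
     subring S ambient \<and>
     noetherian_domain (ring_on S) \<and>
     (\<forall>x \<in> frac_field S. integral_over S x \<longrightarrow> x \<in> S) \<and>
     (\<forall>P. primeideal P (ring_on S) \<and> P \<noteq> {0} \<longrightarrow> maximalideal P (ring_on S))"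

definition algebraic_extension :: "'a::field set \<Rightarrow> bool" where
  "algebraic_extension K \<longleftrightarrow> (\<forall>x::'a. ring.algebraic ambient K x)"


section \<open>Fractional ideals\<close>

definition fractional_ideal :: "'a::field set \<Rightarrow> 'a set \<Rightarrow> bool" where
  "fractional_ideal \<OO> I \<longleftrightarrow>
     additive_subgroup I ambient \<and> (\<forall>r\<in>\<OO>. \<forall>x\<in>I. r * x \<in> I) \<and> I \<noteq> {0} \<and>
     (\<exists>d. d \<noteq> 0 \<and> (\<forall>x\<in>I. d * x \<in> \<OO>))"

definition frac_ideal_monoid :: "'a::field set \<Rightarrow> 'a set monoid" where
  "frac_ideal_monoid \<OO> =
     \<lparr>carrier = {I. fractional_ideal \<OO> I}, mult = ideal_prod ambient, one = \<OO>\<rparr>"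

definition invertible_ideals :: "'a::field set \<Rightarrow> 'a set set" where
  "invertible_ideals \<OO> =
     {I. fractional_ideal \<OO> I \<and> (\<exists>J. fractional_ideal \<OO> J \<and> ideal_prod ambient I J = \<OO>)}"

definition vn_regular :: "('m, 'b) monoid_scheme \<Rightarrow> 'm set" where
  "vn_regular A = {a \<in> carrier A. \<exists>b \<in> carrier A. a = a \<otimes>\<^bsub>A\<^esub> b \<otimes>\<^bsub>A\<^esub> a}"


section \<open>The maximal spectrum with the Krull-like topology\<close>

definition mSpec :: "'a::field set \<Rightarrow> 'a set set" where
  "mSpec \<OO> = {\<PP>. maximalideal \<PP> (ring_on \<OO>)}"

definition basic_open :: "'a::field set \<Rightarrow> 'a set \<Rightarrow> 'a set set" where
  "basic_open \<OO> A = {\<PP> \<in> mSpec \<OO>. A \<subseteq> \<PP>}"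

definition mSpec_topology :: "'a::field set \<Rightarrow> 'a set topology" where
  "mSpec_topology \<OO> =
     topology (arbitrary union_of (\<lambda>U. \<exists>A. finite A \<and> A \<subseteq> \<OO> \<and> U = basic_open \<OO> A))"

lemma openin_mSpec_topology:
  "openin (mSpec_topology \<OO>) =
     arbitrary union_of (\<lambda>U. \<exists>A. finite A \<and> A \<subseteq> \<OO> \<and> U = basic_open \<OO> A)"
proof -
  have "basic_open \<OO> A \<inter> basic_open \<OO> B = basic_open \<OO> (A \<union> B)" for A B
    by (auto simp: basic_open_def)
  then have "istopology (arbitrary union_of (\<lambda>U. \<exists>A. finite A \<and> A \<subseteq> \<OO> \<and> U = basic_open \<OO> A))"
    by (intro istopology_base) (metis finite_UnI Un_least)
  then show ?thesis
    by (simp add: mSpec_topology_def topology_inverse')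
qed

lemma topspace_mSpec_topology [simp]: "topspace (mSpec_topology \<OO>) = mSpec \<OO>"
proof
  have "openin (mSpec_topology \<OO>) (basic_open \<OO> {})"
    unfolding openin_mSpec_topology by (rule union_of_inc) (auto simp: arbitrary_def)
  then show "mSpec \<OO> \<subseteq> topspace (mSpec_topology \<OO>)"
    by (auto simp: basic_open_def dest: openin_subset)
  show "topspace (mSpec_topology \<OO>) \<subseteq> mSpec \<OO>"
    unfolding topspace_def openin_mSpec_topology
    by (auto simp: union_of_def basic_open_def)
qed


section \<open>The monoid of tagged reals\<close>

text \<open>
  \<open>TReal \<alpha> s\<close> stands for the pair \<open>(\<alpha>, s)\<close> in \<open>\<real> \<times> {0, 1}\<close>, with \<open>False\<close> for \<open>0\<close> and \<open>True\<close>
  for \<open>1\<close>; on \<open>bool\<close> we have \<open>False < True\<close>. A separate type is used because the order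
  on products in HOL-Analysis is the componentwise one.
\<close>

datatype treal = TReal real bool

instantiation treal :: linorder
begin

fun less_eq_treal :: "treal \<Rightarrow> treal \<Rightarrow> bool" where
  "less_eq_treal (TReal \<alpha> s) (TReal \<beta> t) \<longleftrightarrow> \<alpha> < \<beta> \<or> \<alpha> = \<beta> \<and> s \<le> t"

definition less_treal :: "treal \<Rightarrow> treal \<Rightarrow> bool" where
  "less_treal x y \<longleftrightarrow> x \<le> y \<and> \<not> y \<le> x"

instance
proof
  fix x y z :: treal
  show "x < y \<longleftrightarrow> x \<le> y \<and> \<not> y \<le> x" by (rule less_treal_def)
  show "x \<le> x" by (cases x) auto
  show "x \<le> y \<Longrightarrow> y \<le> z \<Longrightarrow> x \<le> z" by (cases x; cases y; cases z) auto
  show "x \<le> y \<Longrightarrow> y \<le> x \<Longrightarrow> x = y" by (cases x; cases y) auto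
  show "x \<le> y \<or> y \<le> x" by (cases x; cases y) auto
qed

end

instantiation treal :: comm_monoid_add
begin

definition zero_treal :: treal where
  "zero_treal = TReal 0 False"

fun plus_treal :: "treal \<Rightarrow> treal \<Rightarrow> treal" where
  "plus_treal (TReal \<alpha> s) (TReal \<beta> t) = TReal (\<alpha> + \<beta>) (max s t)"

instance
proof
  fix x y z :: treal
  show "x + y + z = x + (y + z)" by (cases x; cases y; cases z) (auto simp: max.assoc)
  show "x + y = y + x" by (cases x; cases y) (auto simp: max.commute)
  show "0 + x = x" by (cases x) (auto simp: zero_treal_def max_def)
qed

end

fun iota :: "treal \<Rightarrow> treal" where
  "iota (TReal \<alpha> s) = TReal (- \<alpha>) s"


section \<open>Semicontinuous functions\<close>

definition upper_semicont :: "'x topology \<Rightarrow> ('x \<Rightarrow> treal) \<Rightarrow> bool" where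
  "upper_semicont T f \<longleftrightarrow> (\<forall>a. openin T {x \<in> topspace T. f x < a})"

definition compactly_supported :: "'x topology \<Rightarrow> ('x \<Rightarrow> treal) \<Rightarrow> bool" where
  "compactly_supported T f \<longleftrightarrow> (\<exists>Y. compactin T Y \<and> (\<forall>x \<in> topspace T - Y. f x = 0))"

definition bounded_fun :: "'x topology \<Rightarrow> ('x \<Rightarrow> treal) \<Rightarrow> bool" where
  "bounded_fun T f \<longleftrightarrow> (\<exists>a b. \<forall>x \<in> topspace T. a \<le> f x \<and> f x \<le> b)"

text \<open>
  Functions on a space \<open>T\<close> are represented extensionally, i.e. as total functions that are
  \<open>undefined\<close> outside \<open>topspace T\<close>, so that equality is equality of functions on \<open>T\<close>.
\<close>

definition S_b :: "'x topology \<Rightarrow> ('x \<Rightarrow> treal) set" where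
  "S_b T = {f \<in> extensional (topspace T).
     bounded_fun T f \<and> compactly_supported T f \<and> upper_semicont T f}"

definition S_ref :: "'x topology \<Rightarrow> ('x \<Rightarrow> treal) set" where
  "S_ref T = {f \<in> S_b T. restrict (iota \<circ> f) (topspace T) \<in> S_b T}"

definition pointwise_monoid :: "'x set \<Rightarrow> ('x \<Rightarrow> treal) set \<Rightarrow> ('x \<Rightarrow> treal) monoid" where
  "pointwise_monoid T S = \<lparr>carrier = S, mult = (\<lambda>f g. \<lambda>x\<in>T. f x + g x), one = (\<lambda>x\<in>T. 0)\<rparr>"


section \<open>Valuations\<close>

definition additive_valuation :: "('a::field \<Rightarrow> ereal) \<Rightarrow> bool" where
  "additive_valuation v \<longleftrightarrow>
     v 0 = \<infinity> \<and>
     (\<forall>x. x \<noteq> 0 \<longrightarrow> (\<exists>q::rat. v x = ereal (of_rat q))) \<and>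
     (\<forall>x y. v (x * y) = v x + v y) \<and>
     (\<forall>x y. min (v x) (v y) \<le> v (x + y))"

definition localization_at :: "'a::field set \<Rightarrow> 'a set \<Rightarrow> 'a set" where
  "localization_at \<OO> \<PP> = {a / b | a b. a \<in> \<OO> \<and> b \<in> \<OO> \<and> b \<notin> \<PP>}"

text \<open>
  A valuation corresponds to \<open>\<PP>\<close> if its valuation ring is the localization of \<open>\<OO>\<close> at \<open>\<PP>\<close>.
\<close>

definition normalized_valuation :: "'a::field set \<Rightarrow> 'a set \<Rightarrow> ('a \<Rightarrow> ereal) \<Rightarrow> bool" where
  "normalized_valuation \<oo> \<PP> v \<longleftrightarrow>
     additive_valuation v \<and>
     {x. 0 \<le> v x} = localization_at (integral_closure \<oo>) \<PP> \<and>
     v ` (frac_field \<oo> - {0}) = range (\<lambda>n::int. ereal (of_int n))"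

definition valuation_at :: "'a::field set \<Rightarrow> 'a set \<Rightarrow> 'a \<Rightarrow> ereal" where
  "valuation_at \<oo> \<PP> = (THE v. normalized_valuation \<oo> \<PP> v)"

definition value_group :: "'a::field set \<Rightarrow> 'a set \<Rightarrow> real set" where
  "value_group \<oo> \<PP> = {\<alpha>. \<exists>x. x \<noteq> 0 \<and> valuation_at \<oo> \<PP> x = ereal \<alpha>}"

definition val :: "'a::field set \<Rightarrow> 'a set \<Rightarrow> treal set" where
  "val \<oo> \<PP> = {TReal \<alpha> False | \<alpha>. \<alpha> \<in> value_group \<oo> \<PP>}"

text \<open>
  A subgroup of \<open>\<real>\<close> is either dense or closed, and the value group, being contained in the
  rationals, is not both; the \<open>else\<close> branch below is the case of a closed value group.
\<close>

definition V_tilde :: "'a::field set \<Rightarrow> 'a set \<Rightarrow> treal set" where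
  "V_tilde \<oo> \<PP> =
     (if closure (value_group \<oo> \<PP>) = UNIV
      then val \<oo> \<PP> \<union> {TReal \<beta> True | \<beta>. True}
      else val \<oo> \<PP>)"


section \<open>Function monoids and the function of a fractional ideal\<close>

definition S_b_V :: "'a::field set \<Rightarrow> ('a set \<Rightarrow> treal) set" where
  "S_b_V \<oo> = {f \<in> S_b (mSpec_topology (integral_closure \<oo>)).
     \<forall>\<PP> \<in> mSpec (integral_closure \<oo>). f \<PP> \<in> V_tilde \<oo> \<PP>}"

definition S_ref_V :: "'a::field set \<Rightarrow> ('a set \<Rightarrow> treal) set" where
  "S_ref_V \<oo> = {f \<in> S_ref (mSpec_topology (integral_closure \<oo>)).
     \<forall>\<PP> \<in> mSpec (integral_closure \<oo>). f \<PP> \<in> V_tilde \<oo> \<PP>}"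

definition S_ref_val :: "'a::field set \<Rightarrow> ('a set \<Rightarrow> treal) set" where
  "S_ref_val \<oo> = {f \<in> S_ref (mSpec_topology (integral_closure \<oo>)).
     \<forall>\<PP> \<in> mSpec (integral_closure \<oo>). f \<PP> \<in> val \<oo> \<PP>}"

definition S_b_V_monoid :: "'a::field set \<Rightarrow> ('a set \<Rightarrow> treal) monoid" where
  "S_b_V_monoid \<oo> = pointwise_monoid (mSpec (integral_closure \<oo>)) (S_b_V \<oo>)"

definition f_ideal :: "'a::field set \<Rightarrow> 'a set \<Rightarrow> 'a set \<Rightarrow> ereal" where
  "f_ideal \<oo> I \<PP> = (INF x\<in>I. valuation_at \<oo> \<PP> x)"

definition Max_ideal :: "'a::field set \<Rightarrow> 'a set \<Rightarrow> 'a set set" where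
  "Max_ideal \<oo> I =
     {\<PP> \<in> mSpec (integral_closure \<oo>). \<exists>x\<in>I. valuation_at \<oo> \<PP> x = f_ideal \<oo> I \<PP>}"

text \<open>
  The infimum \<open>f_ideal \<oo> I \<PP>\<close> is finite for a fractional ideal \<open>I\<close>, since \<open>I \<noteq> {0}\<close> and
  \<open>I\<close> has a common denominator; \<open>real_of_ereal\<close> only changes its type.
\<close>

definition F_tilde :: "'a::field set \<Rightarrow> 'a set \<Rightarrow> 'a set \<Rightarrow> treal" where
  "F_tilde \<oo> I =
     (\<lambda>\<PP> \<in> mSpec (integral_closure \<oo>).
        TReal (real_of_ereal (f_ideal \<oo> I \<PP>)) (\<PP> \<notin> Max_ideal \<oo> I))"

end

theory Submission
  imports Defs "Jordan_Normal_Form.Char_Poly"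
begin

text \<open>
  Everything rests on one description of \<open>F_tilde\<close>: for a fractional ideal \<open>I\<close>, a maximal ideal
  \<open>P\<close> and a real \<open>a\<close>, the value of \<open>F_tilde \<oo> I\<close> at \<open>P\<close> is at most \<open>TReal a False\<close> iff some non-zero
  \<open>x \<in> I\<close> has \<open>v\<^sub>P(x) \<le> a\<close> (\<open>F_tilde_le_iff\<close>). The untagged bounds detect both the infimum and
  whether it is attained, so they determine the tagged value. Multiplicativity of \<open>F_tilde\<close> follows
  at once, and injectivity follows because \<open>I\<close> is the intersection of its localizations
  (\<open>fracid_local\<close>).

  \<^bold>\<open>Valuations.\<close> The localization of \<open>\<oo>\<close> at a non-zero prime has a principal maximal ideal, generated
  by some \<open>t\<close> (\<open>uniformizer\<close>). An element \<open>x\<close> of \<open>L\<close> is a root of a polynomial over \<open>\<oo>\<close> with a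
  coefficient outside \<open>P\<close>, and Horner's scheme then produces \<open>x\<close> or its inverse in the localization
  of \<open>\<OO>\<close> at \<open>P\<close> (\<open>localization_valuation_ring\<close>). Two terms of an equation for \<open>x\<close> must have the same
  value, so some power of \<open>x\<close> is a power of \<open>t\<close> up to a unit (\<open>unit_power\<close>), which makes the
  valuation rational.

  \<^bold>\<open>Topology.\<close> For fixed \<open>x \<noteq> 0\<close> the value \<open>v\<^sub>P(x)\<close> is locally constant in \<open>P\<close>
  (\<open>rval_locally_constant\<close>), and the maximal ideals containing a fixed \<open>n \<noteq> 0\<close> form a compact set
  (\<open>compactin_basic\<close>). Local constancy gives the semicontinuity of \<open>F_tilde \<oo> I\<close>; compactness gives
  boundedness and an approximation statement (\<open>separating_element\<close>): some element of \<open>\<OO>\<close> is a unit at a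
  given \<open>P\<close> while its values outside a given neighbourhood of \<open>P\<close> are large.

  \<^bold>\<open>Surjectivity.\<close> A function \<open>f\<close> is the image of the ideal of all \<open>x\<close> whose values dominate \<open>f\<close>.
  If \<open>g\<close> is in the value group at \<open>P\<close> and \<open>f\<close> is at most \<open>TReal g False\<close> at \<open>P\<close>, hence near \<open>P\<close>, one
  multiplies an element of value \<open>g\<close> by a separating element and lands in that ideal
  (\<open>F_tilde_surj\<close>). The laws of the monoid of ideals are then pulled back from the functions, while the
  functions are closed under addition because ideals are closed under multiplication. The regular and
  the invertible elements are computed pointwise.
\<close>

section \<open>Subrings, submodules and ideals of a field\<close>

definition is_subring :: "'a::field set \<Rightarrow> bool" where
  "is_subring S \<longleftrightarrow> 1 \<in> S \<and> (\<forall>x\<in>S. \<forall>y\<in>S. x - y \<in> S \<and> x * y \<in> S)"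

definition is_submodule :: "'a::field set \<Rightarrow> 'a set \<Rightarrow> bool" where
  "is_submodule S M \<longleftrightarrow> 0 \<in> M \<and> (\<forall>x\<in>M. \<forall>y\<in>M. x + y \<in> M) \<and> (\<forall>r\<in>S. \<forall>x\<in>M. r * x \<in> M)"

definition is_ideal :: "'a::field set \<Rightarrow> 'a set \<Rightarrow> bool" where
  "is_ideal S I \<longleftrightarrow> I \<subseteq> S \<and> is_submodule S I"

definition is_prime :: "'a::field set \<Rightarrow> 'a set \<Rightarrow> bool" where
  "is_prime S P \<longleftrightarrow> is_ideal S P \<and> 1 \<notin> P \<and> (\<forall>x\<in>S. \<forall>y\<in>S. x * y \<in> P \<longrightarrow> x \<in> P \<or> y \<in> P)"

text \<open>
  Maximality appears as invertibility modulo \<open>P\<close> of the elements outside \<open>P\<close>, the form in which it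
  is used throughout.
\<close>

definition is_maximal :: "'a::field set \<Rightarrow> 'a set \<Rightarrow> bool" where
  "is_maximal S P \<longleftrightarrow> is_ideal S P \<and> 1 \<notin> P \<and> (\<forall>x\<in>S - P. \<exists>y\<in>S. 1 - x * y \<in> P)"

lemma is_subringD:
  assumes "is_subring S"
  shows "1 \<in> S" "0 \<in> S" "x \<in> S \<Longrightarrow> y \<in> S \<Longrightarrow> x - y \<in> S" "x \<in> S \<Longrightarrow> - x \<in> S"
    "x \<in> S \<Longrightarrow> y \<in> S \<Longrightarrow> x + y \<in> S" "x \<in> S \<Longrightarrow> y \<in> S \<Longrightarrow> x * y \<in> S"
proof -
  show 1: "1 \<in> S" using assms by (auto simp: is_subring_def)
  have d: "x - y \<in> S" if "x \<in> S" "y \<in> S" for x y using assms that by (auto simp: is_subring_def)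
  show 0: "0 \<in> S" using d[OF 1 1] by simp
  have m: "- x \<in> S" if "x \<in> S" for x using d[OF 0 that] by simp
  show "x \<in> S \<Longrightarrow> - x \<in> S" by (rule m)
  show "x \<in> S \<Longrightarrow> y \<in> S \<Longrightarrow> x - y \<in> S" by (rule d)
  show "x \<in> S \<Longrightarrow> y \<in> S \<Longrightarrow> x + y \<in> S" using d[OF _ m] by fastforce
  show "x \<in> S \<Longrightarrow> y \<in> S \<Longrightarrow> x * y \<in> S" using assms by (auto simp: is_subring_def)
qed

lemma is_subring_power: "is_subring S \<Longrightarrow> x \<in> S \<Longrightarrow> x ^ n \<in> S"
  by (induction n) (auto intro: is_subringD)

lemma is_subring_sum: "is_subring S \<Longrightarrow> (\<And>i. i \<in> A \<Longrightarrow> f i \<in> S) \<Longrightarrow> sum f A \<in> S"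
  by (induction A rule: infinite_finite_induct) (auto intro: is_subringD)

lemma is_subring_prod: "is_subring S \<Longrightarrow> (\<And>i. i \<in> A \<Longrightarrow> f i \<in> S) \<Longrightarrow> prod f A \<in> S"
  by (induction A rule: infinite_finite_induct) (auto intro: is_subringD)

lemma is_submoduleD:
  assumes "is_submodule S M"
  shows "0 \<in> M" "x \<in> M \<Longrightarrow> y \<in> M \<Longrightarrow> x + y \<in> M" "r \<in> S \<Longrightarrow> x \<in> M \<Longrightarrow> r * x \<in> M"
  using assms by (auto simp: is_submodule_def)

lemma is_submodule_uminus: "is_subring S \<Longrightarrow> is_submodule S M \<Longrightarrow> x \<in> M \<Longrightarrow> - x \<in> M"
  using is_submoduleD(3)[of S M "-1" x] is_subringD(1,4)[of S] by force

lemma is_submodule_diff: "is_subring S \<Longrightarrow> is_submodule S M \<Longrightarrow> x \<in> M \<Longrightarrow> y \<in> M \<Longrightarrow> x - y \<in> M"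
  using is_submoduleD(2)[of S M x "- y"] is_submodule_uminus[of S M y] by force

lemma is_submodule_sum: "is_submodule S M \<Longrightarrow> (\<And>i. i \<in> A \<Longrightarrow> f i \<in> M) \<Longrightarrow> sum f A \<in> M"
  by (induction A rule: infinite_finite_induct) (auto intro: is_submoduleD)

lemma is_idealD:
  assumes "is_ideal S I"
  shows "is_submodule S I" "x \<in> I \<Longrightarrow> x \<in> S"
  using assms by (auto simp: is_ideal_def)

lemma is_maximalD:
  assumes "is_maximal S P"
  shows "is_ideal S P" "is_submodule S P" "1 \<notin> P" "P \<subseteq> S" "0 \<in> P"
    "x \<in> S \<Longrightarrow> x \<notin> P \<Longrightarrow> \<exists>y\<in>S. 1 - x * y \<in> P"
  using assms by (auto simp: is_maximal_def is_ideal_def is_submodule_def)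

lemma is_maximal_prime:
  assumes S: "is_subring S" and P: "is_maximal S P"
  shows "is_prime S P"
proof -
  have "y \<in> P" if xy: "x \<in> S" "y \<in> S" "x * y \<in> P" "x \<notin> P" for x y
  proof -
    obtain z where z: "z \<in> S" "1 - x * z \<in> P" using is_maximalD(6)[OF P] xy by blast
    have "y * (1 - x * z) + z * (x * y) \<in> P"
      using is_submoduleD[OF is_maximalD(2)[OF P]] xy z by blast
    also have "y * (1 - x * z) + z * (x * y) = y" by (simp add: algebra_simps)
    finally show ?thesis .
  qed
  then show ?thesis using P by (auto simp: is_prime_def is_maximal_def)
qed

lemma is_prime_power: "is_subring S \<Longrightarrow> is_prime S P \<Longrightarrow> x \<in> S \<Longrightarrow> x ^ n \<in> P \<Longrightarrow> x \<in> P"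
proof (induction n)
  case (Suc n)
  then show ?case using is_subring_power[of S x n] unfolding is_prime_def power_Suc by blast
qed (auto simp: is_prime_def)

text \<open>
  The set in question is the ideal generated by \<open>P\<close> and \<open>x\<close>.
\<close>

lemma ideal_adjoin:
  assumes S: "is_subring S" and P: "is_ideal S P" and x: "x \<in> S"
  shows "is_ideal S {p + x * y | p y. p \<in> P \<and> y \<in> S}" (is "is_ideal S ?J")
    and "P \<subseteq> {p + x * y | p y. p \<in> P \<and> y \<in> S}"
    and "x \<in> {p + x * y | p y. p \<in> P \<and> y \<in> S}"
proof -
  note D = is_idealD[OF P] is_submoduleD[OF is_idealD(1)[OF P]]
  note R = is_subringD[OF S]
  show "P \<subseteq> ?J"
  proof
    fix p assume "p \<in> P"
    moreover have "p = p + x * 0" by simp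
    ultimately show "p \<in> ?J" using R(2) by (intro CollectI exI[of _ p] exI[of _ 0]) simp
  qed
  show "x \<in> ?J" using D(3) R(1) by (intro CollectI exI[of _ 0] exI[of _ 1]) simp
  show "is_ideal S ?J"
    unfolding is_ideal_def is_submodule_def
  proof (intro conjI ballI)
    show "?J \<subseteq> S" using D(2) R(5,6) x by auto
    show "0 \<in> ?J" using D(3) R(2) by (intro CollectI exI[of _ 0]) simp
    show "u + w \<in> ?J" if u: "u \<in> ?J" and w: "w \<in> ?J" for u w
    proof -
      obtain p y where 1: "u = p + x * y" "p \<in> P" "y \<in> S" using u by blast
      obtain q z where 2: "w = q + x * z" "q \<in> P" "z \<in> S" using w by blast
      have "u + w = (p + q) + x * (y + z)" using 1 2 by (simp add: algebra_simps)
      moreover have "p + q \<in> P" "y + z \<in> S" using D(4) R(5) 1(2,3) 2(2,3) by auto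
      ultimately show ?thesis by blast
    qed
    show "r * u \<in> ?J" if r: "r \<in> S" and u: "u \<in> ?J" for u r
    proof -
      obtain p y where 1: "u = p + x * y" "p \<in> P" "y \<in> S" using u by blast
      have "r * u = r * p + x * (r * y)" using 1 by (simp add: algebra_simps)
      moreover have "r * p \<in> P" "r * y \<in> S" using D(5) R(6) 1(2,3) r by auto
      ultimately show ?thesis by blast
    qed
  qed
qed

section \<open>Correspondence with HOL-Algebra\<close>

lemma ambient_sel [simp]:
  "carrier (ambient :: 'a::field ring) = UNIV" "mult (ambient :: 'a ring) = (*)"
  "one (ambient :: 'a ring) = 1" "ring.zero (ambient :: 'a ring) = 0"
  "add (ambient :: 'a ring) = (+)"
  by (auto simp: ring_of_type_algebra_def)

lemma ring_ambient: "ring (ambient :: 'a::field ring)"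
  and field_ambient: "Ring.field (ambient :: 'a::field ring)"
  by (rule ring_from_type_algebra field_from_type_algebra)+

lemma ambient_inv_add: "inv\<^bsub>add_monoid (ambient :: 'a::field ring)\<^esub> x = - x"
proof -
  interpret ring "ambient :: 'a ring" by (rule ring_ambient)
  have "\<ominus>\<^bsub>ambient\<^esub> x = - x"
    by (rule minus_equality) auto
  then show ?thesis by (simp only: a_inv_def)
qed

lemma subring_ambient_iff: "subring S (ambient :: 'a::field ring) \<longleftrightarrow> is_subring S"
proof
  interpret ring "ambient :: 'a ring" by (rule ring_ambient)
  have [simp]: "\<ominus>\<^bsub>ambient\<^esub> x = - x" for x :: 'a by (simp only: a_inv_def ambient_inv_add)
  show "subring S ambient \<Longrightarrow> is_subring S"
    using subringE[of S ambient] unfolding is_subring_def by (auto) (metis diff_conv_add_uminus)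
  assume S: "is_subring S"
  show "subring S ambient"
    by (rule subringI) (use is_subringD[OF S] in auto)
qed

lemma ring_ring_on: "is_subring S \<Longrightarrow> ring (ring_on S)" "is_subring S \<Longrightarrow> cring (ring_on S)"
  "is_subring S \<Longrightarrow> domain (ring_on S)"
proof -
  interpret domain "ambient :: 'a ring" using field_ambient by (rule field.axioms)
  assume "is_subring S"
  then have S: "subring S ambient" by (simp add: subring_ambient_iff)
  show "ring (ring_on S)" by (rule subring_is_ring[OF S])
  show "domain (ring_on S)" by (rule subring_is_domain[OF S])
  then show "cring (ring_on S)" by (simp add: domain_def)
qed

lemma ring_on_inv_add:
  assumes S: "is_subring S" and x: "x \<in> S"
  shows "inv\<^bsub>add_monoid (ring_on S)\<^esub> x = - x"
proof -
  interpret ring "ring_on S" by (rule ring_ring_on[OF S])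
  have "\<ominus>\<^bsub>ring_on S\<^esub> x = - x"
    by (rule minus_equality) (use is_subringD[OF S] x in auto)
  then show ?thesis by (simp add: a_inv_def)
qed

lemma ideal_ring_on_iff:
  assumes S: "is_subring S"
  shows "ideal I (ring_on S) \<longleftrightarrow> is_ideal S I"
proof
  assume I: "ideal I (ring_on S)"
  interpret ideal I "ring_on S" by (rule I)
  show "is_ideal S I" unfolding is_ideal_def is_submodule_def
    using Icarr I_l_closed additive_subgroup.a_closed[OF is_additive_subgroup] zero_closed
      additive_subgroup.zero_closed[OF is_additive_subgroup] by auto
next
  assume I: "is_ideal S I"
  interpret ring "ring_on S" by (rule ring_ring_on[OF S])
  note D = is_idealD[OF I] is_submoduleD[OF is_idealD(1)[OF I]]
  show "ideal I (ring_on S)"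
  proof (rule idealI[OF ring_axioms])
    show "subgroup I (add_monoid (ring_on S))"
    proof (rule group.subgroupI)
      show "Group.group (add_monoid (ring_on S))" by (rule a_group)
      show "I \<subseteq> carrier (add_monoid (ring_on S))" using D by auto
      show "I \<noteq> {}" using D by auto
      show "inv\<^bsub>add_monoid (ring_on S)\<^esub> a \<in> I" if "a \<in> I" for a
        using ring_on_inv_add[OF S, of a] is_submodule_uminus[OF S D(1) that] D(2)[OF that] by simp
      show "a \<otimes>\<^bsub>add_monoid (ring_on S)\<^esub> b \<in> I" if "a \<in> I" "b \<in> I" for a b
        using D that by auto
    qed
    show "x \<otimes>\<^bsub>ring_on S\<^esub> a \<in> I" "a \<otimes>\<^bsub>ring_on S\<^esub> x \<in> I" if "a \<in> I" "x \<in> carrier (ring_on S)" for a x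
      using D(5)[of x a] that by (simp_all add: mult.commute)
  qed
qed

lemma primeideal_ring_on_iff:
  assumes S: "is_subring S"
  shows "primeideal P (ring_on S) \<longleftrightarrow> is_prime S P"
proof
  assume P: "primeideal P (ring_on S)"
  then interpret primeideal P "ring_on S" .
  have I: "is_ideal S P" using is_ideal ideal_ring_on_iff[OF S] by auto
  have "1 \<notin> P"
  proof
    assume "1 \<in> P"
    then have "S \<subseteq> P" using is_submoduleD(3)[OF is_idealD(1)[OF I], of _ 1] by auto
    then show False using I_notcarr is_idealD(2)[OF I] by auto
  qed
  then show "is_prime S P" using I I_prime by (auto simp: is_prime_def)
next
  assume P: "is_prime S P"
  show "primeideal P (ring_on S)"
    by (rule primeidealI) (use P ideal_ring_on_iff[OF S] ring_ring_on[OF S] is_subringD[OF S] in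
        \<open>auto simp: is_prime_def\<close>)
qed

lemma maximalideal_ring_on_iff:
  assumes S: "is_subring S"
  shows "maximalideal P (ring_on S) \<longleftrightarrow> is_maximal S P"
proof
  assume P: "maximalideal P (ring_on S)"
  then interpret maximalideal P "ring_on S" .
  have I: "is_ideal S P" using is_ideal ideal_ring_on_iff[OF S] by auto
  note D = is_idealD[OF I] is_submoduleD[OF is_idealD(1)[OF I]]
  note R = is_subringD[OF S]
  have 1: "1 \<notin> P"
  proof
    assume "1 \<in> P"
    then have "S \<subseteq> P" using D(5)[of _ 1] by auto
    then show False using I_notcarr D(2) by auto
  qed
  have "\<exists>y\<in>S. 1 - x * y \<in> P" if x: "x \<in> S" "x \<notin> P" for x
  proof -
    let ?J = "{p + x * y | p y. p \<in> P \<and> y \<in> S}"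
    have J: "is_ideal S ?J" and PJ: "P \<subseteq> ?J" and "x \<in> ?J"
      by (rule ideal_adjoin[OF S I x(1)])+
    then have "?J \<noteq> P" using x(2) by metis
    moreover have "ideal ?J (ring_on S)" using J ideal_ring_on_iff[OF S] by simp
    moreover have "?J \<subseteq> carrier (ring_on S)" using J unfolding is_ideal_def by simp
    ultimately have "?J = carrier (ring_on S)" using I_maximal[OF _ PJ] by metis
    then have "?J = S" by simp
    then have "1 \<in> ?J" using R(1) by simp
    then obtain p y where py: "1 = p + x * y" "p \<in> P" "y \<in> S" by blast
    then have "1 - x * y = p" by (simp add: algebra_simps)
    then show ?thesis using py by auto
  qed
  then show "is_maximal S P" using I 1 by (auto simp: is_maximal_def)
next
  assume P: "is_maximal S P"
  note D = is_maximalD[OF P]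
  show "maximalideal P (ring_on S)"
  proof (rule maximalidealI)
    show "ideal P (ring_on S)" using D(1) ideal_ring_on_iff[OF S] by auto
    show "carrier (ring_on S) \<noteq> P" using D(3) is_subringD(1)[OF S] by auto
    fix J assume "ideal J (ring_on S)" "P \<subseteq> J" "J \<subseteq> carrier (ring_on S)"
    then have J: "is_ideal S J" "P \<subseteq> J" "J \<subseteq> S" using ideal_ring_on_iff[OF S] by auto
    show "J = P \<or> J = carrier (ring_on S)"
    proof (cases "J \<subseteq> P")
      case False
      then obtain x where x: "x \<in> J" "x \<notin> P" by auto
      then obtain y where y: "y \<in> S" "1 - x * y \<in> P" using D(6) J by blast
      note JD = is_submoduleD[OF is_idealD(1)[OF J(1)]]
      have "(1 - x * y) + y * x \<in> J" using J y x by (intro JD) auto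
      then have "1 \<in> J" by (simp add: algebra_simps)
      then have "S \<subseteq> J" using JD(3)[of _ 1] by auto
      then show ?thesis using J by auto
    qed (use J in auto)
  qed
qed

lemma field_ring_on:
  assumes S: "is_subring S" and "\<And>x. x \<in> S \<Longrightarrow> x \<noteq> 0 \<Longrightarrow> inverse x \<in> S"
  shows "Ring.field (ring_on S)"
proof -
  interpret cring "ring_on S" by (rule ring_ring_on[OF S])
  show ?thesis
    by (rule cring_fieldI) (use assms(2) in \<open>auto simp: Units_def\<close>, metis left_inverse right_inverse)
qed

text \<open>
  Zorn's lemma applies because in a noetherian ring the union of a non-empty chain of ideals
  is a member of the chain.
\<close>

lemma noetherian_maximal_element:
  assumes S: "is_subring S" and N: "noetherian_domain (ring_on S)"
    and C: "\<C> \<noteq> {}" "\<And>I. I \<in> \<C> \<Longrightarrow> is_ideal S I"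
  shows "\<exists>M\<in>\<C>. \<forall>I\<in>\<C>. M \<subseteq> I \<longrightarrow> I = M"
proof (rule subset_Zorn_nonempty[OF C(1)])
  interpret noetherian_domain "ring_on S" by (rule N)
  fix \<D> assume D: "\<D> \<noteq> {}" "subset.chain \<C> \<D>"
  have "subset.chain {I. ideal I (ring_on S)} \<D>"
    using D(2) C(2) ideal_ring_on_iff[OF S] by (auto simp: subset.chain_def)
  from ideal_chain_is_trivial[OF D(1) this] show "\<Union> \<D> \<in> \<C>"
    using D(2) by (auto simp: subset.chain_def)
qed

lemma noetherian_finitely_generated:
  assumes S: "is_subring S" and N: "noetherian_domain (ring_on S)" and I: "is_ideal S I"
  shows "\<exists>A. finite A \<and> A \<subseteq> I \<and> (\<forall>J. is_ideal S J \<longrightarrow> A \<subseteq> J \<longrightarrow> I \<subseteq> J)"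
proof -
  interpret noetherian_domain "ring_on S" by (rule N)
  obtain A where A: "A \<subseteq> S" "finite A" "I = Idl\<^bsub>ring_on S\<^esub> A"
    using finetely_gen[of I] I ideal_ring_on_iff[OF S] by auto
  have "A \<subseteq> I" using genideal_self[of A] A by auto
  moreover have "I \<subseteq> J" if "is_ideal S J" "A \<subseteq> J" for J
    using genideal_minimal[of J A] that A ideal_ring_on_iff[OF S] by auto
  ultimately show ?thesis using A by blast
qed

section \<open>Integral elements\<close>

definition span_over :: "'a::field set \<Rightarrow> 'a set \<Rightarrow> 'a set" where
  "span_over S W = {\<Sum>w\<in>W. c w * w | c. \<forall>w\<in>W. c w \<in> S}"

lemma span_overI: "(\<And>w. w \<in> W \<Longrightarrow> c w \<in> S) \<Longrightarrow> (\<Sum>w\<in>W. c w * w) \<in> span_over S W"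
  unfolding span_over_def by blast

lemma span_over_submodule:
  assumes S: "is_subring S"
  shows "is_submodule S (span_over S W)"
  unfolding is_submodule_def
proof (intro conjI ballI)
  show "0 \<in> span_over S W"
    unfolding span_over_def using is_subringD(2)[OF S] by (intro CollectI exI[of _ "\<lambda>_. 0"]) simp
  show "x + y \<in> span_over S W" if x: "x \<in> span_over S W" and y: "y \<in> span_over S W" for x y
  proof -
    obtain c d where "x = (\<Sum>w\<in>W. c w * w)" "y = (\<Sum>w\<in>W. d w * w)" "\<forall>w\<in>W. c w \<in> S" "\<forall>w\<in>W. d w \<in> S"
      using x y unfolding span_over_def by blast
    then show ?thesis unfolding span_over_def using is_subringD(5)[OF S]
      by (intro CollectI exI[of _ "\<lambda>w. c w + d w"]) (simp add: sum.distrib distrib_right)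
  qed
  show "r * x \<in> span_over S W" if r: "r \<in> S" and x: "x \<in> span_over S W" for r x
  proof -
    obtain c where "x = (\<Sum>w\<in>W. c w * w)" "\<forall>w\<in>W. c w \<in> S"
      using x unfolding span_over_def by blast
    then show ?thesis unfolding span_over_def using is_subringD(6)[OF S] r
      by (intro CollectI exI[of _ "\<lambda>w. r * c w"]) (simp add: sum_distrib_left mult.assoc)
  qed
qed

lemma span_over_base:
  assumes S: "is_subring S" and W: "finite W" "w \<in> (W :: 'a::field set)"
  shows "w \<in> span_over S W"
proof -
  define c where "c = (\<lambda>u. if u = w then 1 else 0 :: 'a)"
  have "(\<Sum>u\<in>W. c u * u) = (\<Sum>u\<in>W. if u = w then u else 0)"
    unfolding c_def by (rule sum.cong) auto
  then have "(\<Sum>u\<in>W. c u * u) = w" using W by (simp add: sum.delta)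
  moreover have "(\<Sum>u\<in>W. c u * u) \<in> span_over S W"
    by (rule span_overI) (use is_subringD(1,2)[OF S] in \<open>auto simp: c_def\<close>)
  ultimately show ?thesis by metis
qed

lemma span_over_minimal:
  assumes M: "is_submodule S M" "W \<subseteq> M"
  shows "span_over S W \<subseteq> M"
proof
  fix x assume "x \<in> span_over S W"
  then obtain c where c: "x = (\<Sum>w\<in>W. c w * w)" "\<And>w. w \<in> W \<Longrightarrow> c w \<in> S"
    unfolding span_over_def by blast
  show "x \<in> M"
    unfolding c(1) by (rule is_submodule_sum[OF M(1)], rule is_submoduleD(3)[OF M(1)]) (use c M in auto)
qed

lemma span_over_stable:
  assumes S: "is_subring S" and W: "finite W" and x: "\<And>w. w \<in> W \<Longrightarrow> x * w \<in> span_over S W"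
    and m: "m \<in> span_over S W"
  shows "x * m \<in> span_over S W"
proof -
  obtain c where c: "m = (\<Sum>w\<in>W. c w * w)" "\<forall>w\<in>W. c w \<in> S"
    using m unfolding span_over_def by blast
  have "x * m = (\<Sum>w\<in>W. c w * (x * w))" unfolding c(1) sum_distrib_left by (simp add: mult_ac)
  also have "\<dots> \<in> span_over S W"
    by (rule is_submodule_sum[OF span_over_submodule[OF S]], rule is_submoduleD(3)[OF span_over_submodule[OF S]])
      (use c(2) x in auto)
  finally show ?thesis .
qed

definition coeffs_in :: "'a::field set \<Rightarrow> 'a poly \<Rightarrow> bool" where
  "coeffs_in S p \<longleftrightarrow> (\<forall>i. Polynomial.coeff p i \<in> S)"

lemma coeffs_in_add: "is_subring S \<Longrightarrow> coeffs_in S p \<Longrightarrow> coeffs_in S q \<Longrightarrow> coeffs_in S (p + q)"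
  by (auto simp: coeffs_in_def intro: is_subringD)

lemma coeffs_in_mult: "is_subring S \<Longrightarrow> coeffs_in S p \<Longrightarrow> coeffs_in S q \<Longrightarrow> coeffs_in S (p * q)"
  by (auto simp: coeffs_in_def coeff_mult intro!: is_subring_sum is_subringD(6))

lemma coeffs_in_sum: "is_subring S \<Longrightarrow> (\<And>i. i \<in> A \<Longrightarrow> coeffs_in S (f i)) \<Longrightarrow> coeffs_in S (sum f A)"
  by (auto simp: coeffs_in_def Polynomial.coeff_sum intro!: is_subring_sum)

lemma coeffs_in_const: "is_subring S \<Longrightarrow> a \<in> S \<Longrightarrow> coeffs_in S [:a:]"
  by (auto simp: coeffs_in_def coeff_pCons is_subringD(2) split: nat.splits)

lemma coeffs_in_prod: "is_subring S \<Longrightarrow> (\<And>i. i \<in> A \<Longrightarrow> coeffs_in S (f i)) \<Longrightarrow> coeffs_in S (prod f A)"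
proof (induction A rule: infinite_finite_induct)
  case (insert x F) then show ?case by (auto intro: coeffs_in_mult)
qed (use coeffs_in_const[of S 1] is_subringD(1)[of S] in \<open>auto simp: one_pCons\<close>)

lemma coeffs_in_pCons: "is_subring S \<Longrightarrow> coeffs_in S (pCons c q) \<longleftrightarrow> c \<in> S \<and> coeffs_in S q"
  unfolding coeffs_in_def by (metis coeff_pCons_0 coeff_pCons_Suc not0_implies_Suc)

text \<open>
  The determinant trick. Multiplication by \<open>x\<close> is given on the generators by a matrix over \<open>S\<close>. The
  vector of the generators is an eigenvector for \<open>x\<close>, non-zero because of \<open>w0\<close>, so the characteristic
  polynomial of the matrix is an integral equation for \<open>x\<close>.
\<close>

lemma integral_over_if_stable:
  assumes S: "is_subring S" and W: "finite W" and w0: "w0 \<in> W" "w0 \<noteq> 0"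
    and x: "\<And>w. w \<in> W \<Longrightarrow> x * w \<in> span_over S W"
  shows "integral_over S x"
proof -
  define n where "n = card W"
  obtain e where e: "bij_betw e {0..<n} W"
    using W unfolding n_def by (metis ex_bij_betw_nat_finite)
  have "\<forall>w\<in>W. \<exists>c. x * w = (\<Sum>u\<in>W. c u * u) \<and> (\<forall>u\<in>W. c u \<in> S)"
    using x unfolding span_over_def by blast
  then obtain c where c: "\<And>w. w \<in> W \<Longrightarrow> x * w = (\<Sum>u\<in>W. c w u * u)"
    and cS: "\<And>w u. w \<in> W \<Longrightarrow> u \<in> W \<Longrightarrow> c w u \<in> S" by metis
  define A where "A = mat n n (\<lambda>(i, j). c (e i) (e j))"
  have A: "A \<in> carrier_mat n n" by (simp add: A_def)
  have eW: "e i \<in> W" if "i < n" for i using e that by (auto simp: bij_betw_def)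
  define v where "v = vec n e"
  have v: "v \<in> carrier_vec n" by (simp add: v_def)
  obtain i0 where i0: "i0 < n" "e i0 = w0" using e w0 by (auto simp: bij_betw_def image_iff)
  have v0: "v \<noteq> 0\<^sub>v n"
  proof
    assume "v = 0\<^sub>v n"
    then have "v $ i0 = 0" using i0 by simp
    then show False using i0 w0 by (simp add: v_def)
  qed
  have "A *\<^sub>v v = x \<cdot>\<^sub>v v"
  proof (rule eq_vecI)
    fix i assume "i < dim_vec (x \<cdot>\<^sub>v v)"
    then have i: "i < n" by (simp add: v_def)
    have "(A *\<^sub>v v) $ i = (\<Sum>j = 0..<n. c (e i) (e j) * e j)"
      using i by (simp add: A_def v_def scalar_prod_def)
    also have "\<dots> = (\<Sum>u\<in>W. c (e i) u * u)" by (rule sum.reindex_bij_betw[OF e])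
    also have "\<dots> = x * e i" using c[OF eW[OF i]] by simp
    finally show "(A *\<^sub>v v) $ i = (x \<cdot>\<^sub>v v) $ i" using i by (simp add: v_def)
  qed (simp add: A_def v_def)
  then have "eigenvector A v x" using A v v0 by (simp add: eigenvector_def)
  then have root: "poly (char_poly A) x = 0"
    using eigenvalue_root_char_poly[OF A] unfolding eigenvalue_def by blast
  have "coeffs_in S (char_poly A)"
  proof -
    have M: "char_poly_matrix A \<in> carrier_mat n n" using A by simp
    have "coeffs_in S (char_poly_matrix A $$ (i, j))" if "i < n" "j < n" for i j
    proof -
      have "- A $$ (i, j) \<in> S" using that cS eW is_subringD(4)[OF S] by (simp add: A_def)
      then have a: "coeffs_in S [:- A $$ (i, j):]" by (rule coeffs_in_const[OF S])
      have b: "coeffs_in S [:0, 1:]"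
        using is_subringD[OF S] by (auto simp: coeffs_in_def coeff_pCons split: nat.splits)
      have "char_poly_matrix A $$ (i, j) = (if i = j then [:0, 1:] else 0) + [:- A $$ (i, j):]"
        using that A unfolding char_poly_matrix_def by auto
      then show ?thesis using a b coeffs_in_add[OF S b a] by (auto split: if_splits)
    qed
    moreover have "coeffs_in S (signof p :: 'a poly)" for p
      using coeffs_in_const[OF S is_subringD(1)[OF S]]
        coeffs_in_const[OF S is_subringD(4)[OF S is_subringD(1)[OF S]]]
      by (auto simp: sign_def one_pCons)
    ultimately show ?thesis
      unfolding char_poly_def det_def'[OF M]
      by (intro coeffs_in_sum[OF S] coeffs_in_mult[OF S] coeffs_in_prod[OF S])
        (auto dest: permutes_in_image)
  qed
  then show ?thesis
    using root degree_monic_char_poly[OF A] unfolding integral_over_def coeffs_in_def by metis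
qed

lemma integral_over_base: "is_subring S \<Longrightarrow> x \<in> S \<Longrightarrow> integral_over S x"
proof -
  assume S: "is_subring S" "x \<in> S"
  have "coeffs_in S [:- x, 1:]"
    using S by (auto simp: coeffs_in_pCons is_subringD) (simp add: coeffs_in_def is_subringD)
  then show ?thesis unfolding integral_over_def coeffs_in_def
    by (intro exI[of _ "[:- x, 1:]"]) simp
qed

text \<open>
  This reduces the top power of \<open>x\<close>, times \<open>z\<close>, to the lower ones by means of the integral equation.
\<close>

lemma power_degree_in_module:
  assumes S: "is_subring S" and M: "is_submodule S M"
    and p: "Polynomial.lead_coeff p = 1" "coeffs_in S p" "poly p x = 0"
    and z: "\<And>i. i < Polynomial.degree p \<Longrightarrow> x ^ i * z \<in> M"
  shows "x ^ Polynomial.degree p * z \<in> M"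
proof -
  let ?n = "Polynomial.degree p"
  have "0 = (\<Sum>i\<le>?n. Polynomial.coeff p i * x ^ i)" using p(3) by (simp add: poly_altdef)
  also have "\<dots> = x ^ ?n + (\<Sum>i<?n. Polynomial.coeff p i * x ^ i)"
    using p(1) by (simp add: lessThan_Suc_atMost[symmetric])
  finally have "x ^ ?n = - (\<Sum>i<?n. Polynomial.coeff p i * x ^ i)"
    by (simp add: eq_neg_iff_add_eq_0)
  then have "x ^ ?n * z = - (\<Sum>i<?n. Polynomial.coeff p i * (x ^ i * z))"
    by (simp add: sum_distrib_right mult.assoc)
  also have "\<dots> \<in> M"
    by (rule is_submodule_uminus[OF S M], rule is_submodule_sum[OF M], rule is_submoduleD(3)[OF M])
      (use p(2) z in \<open>auto simp: coeffs_in_def\<close>)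
  finally show ?thesis .
qed

text \<open>
  If \<open>x\<close> and \<open>y\<close> have integral equations of degrees \<open>n\<close> and \<open>m\<close>, the module spanned by the products
  \<open>x ^ i * y ^ j\<close> with \<open>i < n\<close> and \<open>j < m\<close> is stable under \<open>x\<close> and \<open>y\<close>, hence under \<open>x - y\<close> and \<open>x * y\<close>.
\<close>

lemma integral_over_diff_mult:
  assumes S: "is_subring S" and x: "integral_over S x" and y: "integral_over S y"
  shows "integral_over S (x - y)" "integral_over S (x * y)"
proof -
  obtain p q where p: "Polynomial.lead_coeff p = 1" "coeffs_in S p" "poly p x = 0"
    and q: "Polynomial.lead_coeff q = 1" "coeffs_in S q" "poly q y = 0"
    using x y unfolding integral_over_def coeffs_in_def by blast
  let ?n = "Polynomial.degree p" and ?m = "Polynomial.degree q"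
  let ?W = "(\<lambda>(i, j). x ^ i * y ^ j) ` ({..<?n} \<times> {..<?m})"
  let ?M = "span_over S ?W"
  have nz: "0 < Polynomial.degree r" if "Polynomial.lead_coeff r = 1" "poly r z = 0" for r :: "'a poly" and z
  proof (rule ccontr)
    assume "\<not> 0 < Polynomial.degree r"
    then obtain a where "r = [:a:]" by (metis degree_eq_zeroE neq0_conv)
    then show False using that by auto
  qed
  have M: "is_submodule S ?M" by (rule span_over_submodule[OF S])
  have fin: "finite ?W" by simp
  have base: "x ^ i * y ^ j \<in> ?M" if "i < ?n" "j < ?m" for i j
    by (rule span_over_base[OF S fin]) (use that in auto)
  have xs: "x * w \<in> ?M" if "w \<in> ?W" for w
  proof -
    obtain i j where ij: "i < ?n" "j < ?m" "w = x ^ i * y ^ j" using \<open>w \<in> ?W\<close> by auto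
    show ?thesis
    proof (cases "Suc i = ?n")
      case True
      have "x ^ ?n * y ^ j \<in> ?M"
        by (rule power_degree_in_module[OF S M p]) (use base ij in auto)
      moreover have "x * w = x ^ Suc i * y ^ j" using ij by (simp add: mult_ac)
      ultimately show ?thesis using True by simp
    next
      case False
      then have "x ^ Suc i * y ^ j \<in> ?M" using ij by (intro base) auto
      then show ?thesis using ij by (simp add: mult_ac)
    qed
  qed
  have ys: "y * w \<in> ?M" if "w \<in> ?W" for w
  proof -
    obtain i j where ij: "i < ?n" "j < ?m" "w = x ^ i * y ^ j" using \<open>w \<in> ?W\<close> by auto
    show ?thesis
    proof (cases "Suc j = ?m")
      case True
      have "y ^ ?m * x ^ i \<in> ?M"
        by (rule power_degree_in_module[OF S M q]) (use base ij in \<open>auto simp: mult.commute\<close>)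
      moreover have "y * w = y ^ Suc j * x ^ i" using ij by (simp add: mult_ac)
      ultimately show ?thesis using True by simp
    next
      case False
      then have "x ^ i * y ^ Suc j \<in> ?M" using ij by (intro base) auto
      then show ?thesis using ij by (simp add: mult_ac)
    qed
  qed
  have "1 \<in> ?W"
    by (rule image_eqI[of _ _ "(0, 0)"]) (use nz[OF p(1,3)] nz[OF q(1,3)] in auto)
  note det = integral_over_if_stable[OF S fin this one_neq_zero]
  show "integral_over S (x - y)"
  proof (rule det)
    fix w assume w: "w \<in> ?W"
    have "x * w - y * w \<in> ?M" by (rule is_submodule_diff[OF S M xs[OF w] ys[OF w]])
    then show "(x - y) * w \<in> ?M" by (simp add: left_diff_distrib)
  qed
  show "integral_over S (x * y)"
  proof (rule det)
    fix w assume w: "w \<in> ?W"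
    have "x * (y * w) \<in> ?M" by (rule span_over_stable[OF S fin xs ys[OF w]])
    then show "x * y * w \<in> ?M" by (simp add: mult.assoc)
  qed
qed

lemma integral_closure_subring:
  assumes S: "is_subring S"
  shows "is_subring (integral_closure S)" "S \<subseteq> integral_closure S"
  using integral_over_diff_mult[OF S] integral_over_base[OF S] is_subringD(1)[OF S]
  by (auto simp: is_subring_def integral_closure_def)

text \<open>
  The \<open>b j\<close> are the partial results of Horner's scheme. The module spanned by the powers \<open>x ^ k\<close> with
  \<open>k < n\<close> is stable under both elements: in \<open>b j * x ^ k\<close> the exponents stay below \<open>n\<close> if \<open>k < j\<close>, and
  otherwise the equation replaces it by minus the sum of the terms of index less than \<open>j\<close>.
\<close>

lemma horner_partial_sum_integral:
  fixes a :: "nat \<Rightarrow> 'a::field"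
  assumes S: "is_subring S" and a: "\<And>i. i \<le> n \<Longrightarrow> a i \<in> S" and n: "0 < n"
    and root: "(\<Sum>i\<le>n. a i * x ^ i) = 0"
  defines "b \<equiv> \<lambda>j. \<Sum>i=j..n. a i * x ^ (i - j)"
  shows "b j \<in> integral_closure S" "b j * x \<in> integral_closure S"
proof -
  let ?W = "(\<lambda>k. x ^ k) ` {..<n}"
  let ?M = "span_over S ?W"
  have M: "is_submodule S ?M" by (rule span_over_submodule[OF S])
  have fin: "finite ?W" by simp
  have base: "x ^ k \<in> ?M" if "k < n" for k
    by (rule span_over_base[OF S fin]) (use that in auto)
  have comb: "(\<Sum>i\<in>A. a i * x ^ h i) \<in> ?M" if "\<And>i. i \<in> A \<Longrightarrow> i \<le> n \<and> h i < n" for A h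
    by (rule is_submodule_sum[OF M], rule is_submoduleD(3)[OF M]) (use that a base in auto)
  have key: "b j * x ^ k \<in> ?M" if "k \<le> n" for k
  proof (cases "j \<le> k")
    case False
    have "b j * x ^ k = (\<Sum>i=j..n. a i * x ^ (i - j + k))"
      unfolding b_def by (simp only: sum_distrib_right power_add mult.assoc)
    also have "\<dots> \<in> ?M" by (rule comb) (use False in auto)
    finally show ?thesis .
  next
    case True
    have "b j * x ^ k = x ^ (k - j) * (\<Sum>i=j..n. a i * x ^ i)"
      unfolding b_def sum_distrib_right sum_distrib_left
    proof (rule sum.cong)
      fix i assume "i \<in> {j..n}"
      then have "i - j + k = k - j + i" using True by auto
      then have "x ^ (i - j) * x ^ k = x ^ (k - j) * x ^ i" by (simp flip: power_add)
      then show "a i * x ^ (i - j) * x ^ k = x ^ (k - j) * (a i * x ^ i)"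
        by (simp add: mult_ac)
    qed simp
    also have "(\<Sum>i=j..n. a i * x ^ i) = - (\<Sum>i<j. a i * x ^ i)"
    proof -
      have "{..n} = {..<j} \<union> {j..n}" using True that by auto
      then have "(\<Sum>i\<le>n. a i * x ^ i) = (\<Sum>i<j. a i * x ^ i) + (\<Sum>i=j..n. a i * x ^ i)"
        by (simp add: sum.union_disjoint ivl_disj_int)
      then show ?thesis using root by (simp add: eq_neg_iff_add_eq_0 add.commute)
    qed
    also have "x ^ (k - j) * - (\<Sum>i<j. a i * x ^ i) = - (\<Sum>i<j. a i * x ^ (k - j + i))"
      by (simp add: sum_distrib_left power_add mult_ac)
    also have "\<dots> \<in> ?M"
      by (intro is_submodule_uminus[OF S M] comb) (use True that in auto)
    finally show ?thesis .
  qed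
  have "1 \<in> ?W" by (rule image_eqI[of _ _ 0]) (use n in auto)
  note det = integral_over_if_stable[OF S fin this one_neq_zero]
  have "b j * w \<in> ?M" if "w \<in> ?W" for w using that key by auto
  from det[OF this] show "b j \<in> integral_closure S" by (simp add: integral_closure_def)
  have "b j * x * w \<in> ?M" if "w \<in> ?W" for w
  proof -
    obtain k where k: "k < n" "w = x ^ k" using \<open>w \<in> ?W\<close> by auto
    then have "b j * x ^ Suc k \<in> ?M" by (intro key) auto
    then show ?thesis using k by (simp add: mult_ac)
  qed
  from det[OF this] show "b j * x \<in> integral_closure S" by (simp add: integral_closure_def)
qed

section \<open>Prime ideals\<close>

lemma maximal_mono_eq:
  assumes P: "is_maximal S P" and Q: "is_maximal S Q" and sub: "P \<subseteq> Q"
  shows "P = Q"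
proof (rule ccontr)
  assume "P \<noteq> Q"
  then obtain x where x: "x \<in> Q" "x \<notin> P" using sub by blast
  then obtain y where y: "y \<in> S" "1 - x * y \<in> P" using is_maximalD(6)[OF P, of x] is_maximalD(4)[OF Q] by blast
  have "(1 - x * y) + y * x \<in> Q" using is_submoduleD[OF is_maximalD(2)[OF Q]] x(1) y sub by blast
  then show False using is_maximalD(3)[OF Q] by (simp add: mult.commute)
qed

lemma is_prime_prod_list:
  assumes "is_prime S P" "is_subring S" "set xs \<subseteq> S" "prod_list xs \<in> P"
  shows "\<exists>a\<in>set xs. a \<in> P"
  using assms(3,4)
proof (induction xs)
  case (Cons a xs)
  have "prod_list xs \<in> S"
    using Cons.prems(1) by (induction xs) (use is_subringD(1,6)[OF assms(2)] in auto)
  then show ?case using Cons assms(1) unfolding is_prime_def by auto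
qed (use assms(1) in \<open>simp add: is_prime_def\<close>)

text \<open>
  By Zorn's lemma there is a maximal element among the ideals that contain \<open>I\<close> and are disjoint from
  \<open>M\<close>. It is prime: for \<open>x\<close> and \<open>y\<close> outside it, the ideals enlarged by \<open>x\<close> and by \<open>y\<close> meet \<open>M\<close>, and the
  product of two such elements of \<open>M\<close> lies in the ideal enlarged by \<open>x * y\<close>.
\<close>

lemma prime_avoiding:
  assumes S: "is_subring S" and I: "is_ideal S I"
    and M: "1 \<in> M" "M \<subseteq> S" "\<And>x y. x \<in> M \<Longrightarrow> y \<in> M \<Longrightarrow> x * y \<in> M" and IM: "I \<inter> M = {}"
  shows "\<exists>P. is_prime S P \<and> I \<subseteq> P \<and> P \<inter> M = {}"
proof -
  define C where "C = {J. is_ideal S J \<and> I \<subseteq> J \<and> J \<inter> M = {}}"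
  have "I \<in> C" using I IM by (simp add: C_def)
  then have Cne: "C \<noteq> {}" by blast
  have "\<exists>P\<in>C. \<forall>J\<in>C. P \<subseteq> J \<longrightarrow> J = P"
  proof (rule subset_Zorn_nonempty[OF Cne])
    fix D assume D: "D \<noteq> {}" "subset.chain C D"
    then have DC: "\<And>J. J \<in> D \<Longrightarrow> is_ideal S J \<and> I \<subseteq> J \<and> J \<inter> M = {}"
      and lin: "\<And>J J'. J \<in> D \<Longrightarrow> J' \<in> D \<Longrightarrow> J \<subseteq> J' \<or> J' \<subseteq> J"
      unfolding C_def subset_chain_def by blast+
    have "is_ideal S (\<Union>D)"
      unfolding is_ideal_def is_submodule_def
    proof (intro conjI ballI)
      show "\<Union>D \<subseteq> S" using DC by (auto simp: is_ideal_def)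
      show "0 \<in> \<Union>D" using DC D(1) by (auto simp: is_ideal_def is_submodule_def)
      show "x + y \<in> \<Union>D" if xy: "x \<in> \<Union>D" "y \<in> \<Union>D" for x y
      proof -
        obtain J J' where J: "x \<in> J" "J \<in> D" "y \<in> J'" "J' \<in> D" using xy by blast
        obtain J'' where "x \<in> J''" "y \<in> J''" "J'' \<in> D" using lin[OF J(2,4)] J by blast
        then show ?thesis using DC[of J''] by (auto simp: is_ideal_def is_submodule_def)
      qed
      show "r * x \<in> \<Union>D" if rx: "r \<in> S" "x \<in> \<Union>D" for r x
      proof -
        obtain J where "x \<in> J" "J \<in> D" using rx(2) by blast
        then show ?thesis using DC[of J] rx(1) unfolding is_ideal_def is_submodule_def by blast
      qed
    qed
    then show "\<Union>D \<in> C" using DC D(1) by (auto simp: C_def)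
  qed
  then obtain P where PC: "P \<in> C" and mx: "\<And>J. J \<in> C \<Longrightarrow> P \<subseteq> J \<Longrightarrow> J = P" by blast
  have P: "is_ideal S P" "I \<subseteq> P" "P \<inter> M = {}" using PC by (auto simp: C_def)
  note D = is_idealD[OF P(1)] is_submoduleD[OF is_idealD(1)[OF P(1)]]
  note R = is_subringD[OF S]
  have meets: "\<exists>p\<in>P. \<exists>s\<in>S. p + x * s \<in> M" if x: "x \<in> S" "x \<notin> P" for x
  proof -
    let ?J = "{p + x * y | p y. p \<in> P \<and> y \<in> S}"
    have "?J \<noteq> P" using ideal_adjoin(3)[OF S P(1) x(1)] x(2) by metis
    then have "?J \<notin> C" using mx[OF _ ideal_adjoin(2)[OF S P(1) x(1)]] by metis
    moreover have "I \<subseteq> ?J" using ideal_adjoin(2)[OF S P(1) x(1)] P(2) by (rule subset_trans[rotated])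
    ultimately have "?J \<inter> M \<noteq> {}" using ideal_adjoin(1)[OF S P(1) x(1)] unfolding C_def by simp
    then show ?thesis by blast
  qed
  have "is_prime S P"
    unfolding is_prime_def
  proof (intro conjI ballI impI)
    show "is_ideal S P" by (rule P(1))
    show "1 \<notin> P" using P(3) M(1) by blast
    fix x y assume xy: "x \<in> S" "y \<in> S" "x * y \<in> P"
    show "x \<in> P \<or> y \<in> P"
    proof (rule ccontr)
      assume "\<not> (x \<in> P \<or> y \<in> P)"
      then obtain p s q t where p: "p \<in> P" "s \<in> S" "p + x * s \<in> M" and q: "q \<in> P" "t \<in> S" "q + y * t \<in> M"
        using meets[of x] meets[of y] xy by blast
      have "(q + y * t) * p + ((x * s) * q + (s * t) * (x * y)) \<in> P"
        using p q xy D(2,4,5) R(5,6) by simp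
      also have "(q + y * t) * p + ((x * s) * q + (s * t) * (x * y)) = (p + x * s) * (q + y * t)"
        by (simp add: algebra_simps)
      finally show False using M(3)[OF p(3) q(3)] P(3) by blast
    qed
  qed
  then show ?thesis using P by blast
qed

lemma poly_in_subring: "is_subring S \<Longrightarrow> coeffs_in S p \<Longrightarrow> x \<in> S \<Longrightarrow> poly p x \<in> S"
  unfolding poly_altdef coeffs_in_def
  by (rule is_subring_sum) (auto intro: is_subringD(6) is_subring_power)

lemma coeffs_in_mono: "S \<subseteq> T \<Longrightarrow> coeffs_in S p \<Longrightarrow> coeffs_in T p"
  by (auto simp: coeffs_in_def)

lemma is_prime_compl:
  assumes S: "is_subring S" and P: "is_prime S P"
  shows "1 \<in> S - P" "x \<in> S - P \<Longrightarrow> y \<in> S - P \<Longrightarrow> x * y \<in> S - P"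
    "x \<in> S - P \<Longrightarrow> x \<noteq> 0" "x \<in> S - P \<Longrightarrow> x ^ n \<in> S - P"
    "x \<in> S \<Longrightarrow> y \<in> S \<Longrightarrow> x * y \<notin> P \<Longrightarrow> x \<in> S - P"
proof -
  have 0: "0 \<in> P" and m: "\<And>x y. x \<in> P \<Longrightarrow> y \<in> S \<Longrightarrow> y * x \<in> P"
    using P by (auto simp: is_prime_def is_ideal_def is_submodule_def)
  show 1: "1 \<in> S - P" using P is_subringD(1)[OF S] by (auto simp: is_prime_def)
  show c: "x \<in> S - P \<Longrightarrow> y \<in> S - P \<Longrightarrow> x * y \<in> S - P" for x y
    using P is_subringD(6)[OF S] by (auto simp: is_prime_def)
  show "x \<in> S - P \<Longrightarrow> x \<noteq> 0" using 0 by auto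
  show "x \<in> S - P \<Longrightarrow> x ^ n \<in> S - P" by (induction n) (use 1 c in auto)
  show "x \<in> S \<Longrightarrow> y \<in> S \<Longrightarrow> x * y \<notin> P \<Longrightarrow> x \<in> S - P" using m[of x y] by (auto simp: mult.commute)
qed

text \<open>
  This is the contraction to \<open>S\<close> of the ideal quotient \<open>(a : b)\<close> in the localization at \<open>P\<close>; for \<open>b = 1\<close>
  it is the contraction of the principal ideal of \<open>a\<close>.
\<close>

definition saturation :: "'a::field set \<Rightarrow> 'a set \<Rightarrow> 'a \<Rightarrow> 'a \<Rightarrow> 'a set" where
  "saturation S P a b = {r \<in> S. \<exists>s\<in>S - P. \<exists>w\<in>S. s * r * b = a * w}"

lemma saturation_ideal:
  assumes S: "is_subring S" and P: "is_prime S P"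
  shows "is_ideal S (saturation S P a b)"
  unfolding is_ideal_def is_submodule_def
proof (intro conjI ballI)
  note R = is_subringD[OF S] and C = is_prime_compl[OF S P]
  show "saturation S P a b \<subseteq> S" by (auto simp: saturation_def)
  show "0 \<in> saturation S P a b"
    unfolding saturation_def using R(2) C(1) by (intro CollectI conjI bexI[of _ 1] bexI[of _ 0]) auto
  show "x + y \<in> saturation S P a b" if x: "x \<in> saturation S P a b" and y: "y \<in> saturation S P a b" for x y
  proof -
    obtain s w where 1: "x \<in> S" "s \<in> S - P" "w \<in> S" "s * x * b = a * w"
      using x unfolding saturation_def by blast
    obtain t z where 2: "y \<in> S" "t \<in> S - P" "z \<in> S" "t * y * b = a * z"
      using y unfolding saturation_def by blast
    have "(s * t) * (x + y) * b = t * (s * x * b) + s * (t * y * b)" by (simp add: algebra_simps)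
    also have "\<dots> = a * (t * w + s * z)" unfolding 1(4) 2(4) by (simp add: algebra_simps)
    finally have eq: "(s * t) * (x + y) * b = a * (t * w + s * z)" .
    have "s * t \<in> S - P" by (rule C(2)[OF 1(2) 2(2)])
    moreover have "t * w + s * z \<in> S" "x + y \<in> S" using 1(1,2,3) 2(1,2,3) R(5,6) by auto
    ultimately show ?thesis unfolding saturation_def using eq by blast
  qed
  show "r * x \<in> saturation S P a b" if r: "r \<in> S" and x: "x \<in> saturation S P a b" for r x
  proof -
    obtain s w where 1: "x \<in> S" "s \<in> S - P" "w \<in> S" "s * x * b = a * w"
      using x unfolding saturation_def by blast
    have "s * (r * x) * b = r * (s * x * b)" by (simp add: algebra_simps)
    also have "\<dots> = a * (r * w)" unfolding 1(4) by (simp add: algebra_simps)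
    finally have eq: "s * (r * x) * b = a * (r * w)" .
    have "r * w \<in> S" "r * x \<in> S" using 1(1,3) r R(6) by auto
    then show ?thesis unfolding saturation_def using eq 1(2) by blast
  qed
qed

section \<open>Valuation rings with rational value group\<close>

definition ring_units :: "'a::field set \<Rightarrow> 'a set" where
  "ring_units B = {x. x \<noteq> 0 \<and> x \<in> B \<and> inverse x \<in> B}"

lemma ring_units_mult: "is_subring B \<Longrightarrow> x \<in> ring_units B \<Longrightarrow> y \<in> ring_units B \<Longrightarrow> x * y \<in> ring_units B"
  using is_subringD(6)[of B] by (auto simp: ring_units_def)

lemma ring_units_inverse: "x \<in> ring_units B \<Longrightarrow> inverse x \<in> ring_units B"
  by (auto simp: ring_units_def)

lemma ring_units_divide: "is_subring B \<Longrightarrow> x \<in> ring_units B \<Longrightarrow> y \<in> ring_units B \<Longrightarrow> x / y \<in> ring_units B"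
  using ring_units_mult ring_units_inverse by (metis divide_inverse)

lemma ring_units_power: "is_subring B \<Longrightarrow> x \<in> ring_units B \<Longrightarrow> x ^ n \<in> ring_units B"
  using is_subring_power[of B x n] is_subring_power[of B "inverse x" n]
  by (simp add: ring_units_def power_inverse)

text \<open>
  Otherwise the inverse of \<open>x\<close> is in \<open>B\<close>, and multiplying \<open>x ^ n\<close> by a power of it gives \<open>x\<close>.
\<close>

lemma valuation_ring_root_closed:
  assumes B: "is_subring B" and V: "x \<in> B \<or> inverse x \<in> B" and x: "x ^ n \<in> B" "0 < n"
  shows "x \<in> B"
proof (cases "x \<in> B \<or> x = 0")
  case False
  then have "inverse x ^ (n - 1) \<in> B" using V is_subring_power[OF B] by blast
  then have "x ^ n * inverse x ^ (n - 1) \<in> B" using is_subringD(6)[OF B] x by blast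
  also have "x ^ n * inverse x ^ (n - 1) = x"
    using x(2) False by (cases n) (auto simp: power_inverse)
  finally show ?thesis .
qed (use is_subringD(2)[OF B] in auto)

text \<open>
  The value of \<open>x\<close> is \<open>k / n\<close> if \<open>x ^ n\<close> and \<open>t powi k\<close> differ by a unit. This is independent of the
  choice of \<open>n\<close> and \<open>k\<close>, as \<open>t powi j\<close> is a unit only for \<open>j = 0\<close>. The last clause of the conclusion
  fixes the normalization, in which \<open>t\<close> has value 1.
\<close>

lemma rank_one_valuation:
  fixes B :: "'a::field set"
  assumes B: "is_subring B" and V: "\<And>x. x \<in> B \<or> inverse x \<in> B"
    and t: "t \<in> B" "t \<noteq> 0" "inverse t \<notin> B"
    and R: "\<And>x. x \<noteq> 0 \<Longrightarrow> \<exists>n k. 0 < n \<and> x ^ n / t powi k \<in> ring_units B"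
  shows "\<exists>v. additive_valuation v \<and> {x. 0 \<le> v x} = B \<and>
    (\<forall>x n k. x \<noteq> 0 \<longrightarrow> 0 < n \<longrightarrow> x ^ n / t powi k \<in> ring_units B \<longrightarrow>
       v x = ereal (of_rat (of_int k / of_nat n)))"
proof -
  note D = is_subringD[OF B]
  have tpos: "k \<le> 0" if "t powi k \<in> ring_units B" for k
  proof (rule ccontr)
    assume "\<not> k \<le> 0"
    then obtain m where m: "k = int (Suc m)" by (metis not_le zero_less_imp_eq_int gr0_implies_Suc)
    have "inverse (t ^ Suc m) * t ^ m \<in> B"
      using that D(6) is_subring_power[OF B t(1)] unfolding m ring_units_def by (simp only: power_int_of_nat mem_Collect_eq)
    also have "inverse (t ^ Suc m) * t ^ m = inverse t" using t(2) by (simp add: field_simps)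
    finally show False using t(3) by simp
  qed
  have t_unit: "k = 0" if "t powi k \<in> ring_units B" for k
    using tpos[OF that] tpos[of "-k"] ring_units_inverse[OF that] by (simp add: power_int_minus)
  have pw: "(x ^ n / t powi k) ^ m = x ^ (n * m) / t powi (k * int m)" for x :: 'a and n k m
    by (simp add: power_divide power_mult power_int_mult)
  have uniq: "k * int m = l * int n"
    if "x \<noteq> 0" "x ^ n / t powi k \<in> ring_units B" "x ^ m / t powi l \<in> ring_units B" for x n m k l
  proof -
    have "(x ^ n / t powi k) ^ m / (x ^ m / t powi l) ^ n \<in> ring_units B"
      using ring_units_divide[OF B] ring_units_power[OF B] that by blast
    also have "(x ^ n / t powi k) ^ m / (x ^ m / t powi l) ^ n = t powi (l * int n) / t powi (k * int m)"
      using that(1) unfolding pw by (simp add: mult.commute[of m n])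
    also have "\<dots> = t powi (l * int n - k * int m)" using t(2) by (simp add: power_int_diff)
    finally show ?thesis using t_unit by force
  qed
  define P where "P x q \<longleftrightarrow> (\<exists>n k. 0 < n \<and> x ^ n / t powi k \<in> ring_units B \<and> q = (of_int k / of_nat n :: rat))" for x q
  define v0 where "v0 x = (SOME q. P x q)" for x
  have v0: "v0 x = of_int k / of_nat n" if "x \<noteq> 0" "0 < n" "x ^ n / t powi k \<in> ring_units B" for x n k
  proof -
    have "P x (of_int k / of_nat n)" using that unfolding P_def by blast
    then have "P x (v0 x)" unfolding v0_def by (rule someI)
    then obtain m l where m: "0 < m" "x ^ m / t powi l \<in> ring_units B" "v0 x = of_int l / of_nat m"
      unfolding P_def by blast
    have "k * int m = l * int n" by (rule uniq[OF that(1,3) m(2)])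
    then have "(of_int (k * int m) :: rat) = of_int (l * int n)" by simp
    then show ?thesis unfolding m(3) using m(1) that(2) by (subst frac_eq_eq) auto
  qed
  have v0_mult: "v0 (x * y) = v0 x + v0 y" if xy: "x \<noteq> 0" "y \<noteq> 0" for x y
  proof -
    obtain n k where x: "0 < n" "x ^ n / t powi k \<in> ring_units B" using R[OF xy(1)] by blast
    obtain m l where y: "0 < m" "y ^ m / t powi l \<in> ring_units B" using R[OF xy(2)] by blast
    have "(x ^ n / t powi k) ^ m * (y ^ m / t powi l) ^ n \<in> ring_units B"
      using ring_units_mult[OF B] ring_units_power[OF B] x y by blast
    also have "(x ^ n / t powi k) ^ m * (y ^ m / t powi l) ^ n
        = (x * y) ^ (n * m) / (t powi (k * int m) * t powi (l * int n))"
      unfolding pw by (simp add: power_mult_distrib mult.commute[of m n])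
    also have "\<dots> = (x * y) ^ (n * m) / t powi (k * int m + l * int n)"
      using t(2) by (simp add: power_int_add)
    finally have "v0 (x * y) = of_int (k * int m + l * int n) / of_nat (n * m)"
      using v0[of "x * y" "n * m"] x(1) y(1) xy by simp
    also have "\<dots> = v0 x + v0 y"
      using v0[OF xy(1) x] v0[OF xy(2) y] x(1) y(1) by (simp add: field_simps)
    finally show ?thesis .
  qed
  have v0_nonneg: "0 \<le> v0 x \<longleftrightarrow> x \<in> B" if x0: "x \<noteq> 0" for x
  proof -
    obtain n k where x: "0 < n" "x ^ n / t powi k \<in> ring_units B" using R[OF x0] by blast
    have "0 \<le> v0 x \<longleftrightarrow> 0 \<le> k" using v0[OF x0 x] x(1) by (simp add: zero_le_divide_iff)
    also have "\<dots> \<longleftrightarrow> x \<in> B"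
    proof
      assume "0 \<le> k"
      then obtain j where j: "k = int j" by (metis nonneg_int_cases)
      have "(x ^ n / t powi k) * t ^ j \<in> B"
        using D(6)[OF _ is_subring_power[OF B t(1)]] x(2) unfolding ring_units_def by blast
      then have "x ^ n \<in> B" using t(2) by (simp add: j)
      then show "x \<in> B" using valuation_ring_root_closed[OF B V] x(1) by blast
    next
      assume xB: "x \<in> B"
      show "0 \<le> k"
      proof (rule ccontr)
        assume "\<not> 0 \<le> k"
        then obtain m where m: "k = - int (Suc m)"
          by (metis add.inverse_inverse neg_0_less_iff_less not_le zero_less_imp_eq_int gr0_implies_Suc)
        have "inverse (x ^ n / t powi k) \<in> B" using x(2) by (simp add: ring_units_def)
        then have "inverse (x ^ n / t powi k) * (x ^ n * t ^ m) \<in> B"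
          using D(6) is_subring_power[OF B] t(1) xB by blast
        also have "inverse (x ^ n / t powi k) * (x ^ n * t ^ m) = inverse t"
          using x0 t(2) unfolding m power_int_minus power_int_of_nat by (simp add: field_simps)
        finally show False using t(3) by simp
      qed
    qed
    finally show ?thesis .
  qed
  define v where "v x = (if x = 0 then \<infinity> else ereal (of_rat (v0 x)))" for x
  have ge: "0 \<le> v x \<longleftrightarrow> x \<in> B" for x
    using v0_nonneg[of x] D(2) by (auto simp: v_def)
  have mult: "v (x * y) = v x + v y" for x y
    using v0_mult[of x y] by (auto simp: v_def of_rat_add)
  have le: "v x \<le> v (x + y)" if "v x \<le> v y" for x y
  proof (cases "x = 0")
    case True
    then show ?thesis using that by (simp add: v_def)
  next
    case False
    have div: "v z \<ge> v x \<longleftrightarrow> z / x \<in> B" for z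
    proof -
      have "v z = v x + v (z / x)" using mult[of x "z / x"] False by simp
      then show ?thesis unfolding ge[symmetric] using False
        by (cases "v (z / x)") (auto simp: v_def)
    qed
    have "1 + y / x \<in> B" using D(1,5) div that by blast
    then have "(x + y) / x \<in> B" using False by (simp add: add_divide_distrib)
    then show ?thesis using div by blast
  qed
  have "min (v x) (v y) \<le> v (x + y)" for x y
    using le[of x y] le[of y x] by (cases "v x \<le> v y") (auto simp: min_def add.commute)
  then have "additive_valuation v"
    unfolding additive_valuation_def using mult by (auto simp: v_def)
  moreover have "{x. 0 \<le> v x} = B" using ge by blast
  ultimately show ?thesis using v0 by (intro exI[of _ v]) (simp add: v_def)
qed

lemma additive_valuation_real:
  fixes v :: "'a::field \<Rightarrow> ereal"
  assumes v: "additive_valuation v"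
  defines "w \<equiv> \<lambda>x. real_of_ereal (v x)"
  shows "x \<noteq> 0 \<Longrightarrow> v x = ereal (w x)"
    and "x \<noteq> 0 \<Longrightarrow> w x \<in> \<rat>"
    and "x \<noteq> 0 \<Longrightarrow> y \<noteq> 0 \<Longrightarrow> w (x * y) = w x + w y"
    and "w 1 = 0"
    and "x \<noteq> 0 \<Longrightarrow> w (inverse x) = - w x"
    and "x \<noteq> 0 \<Longrightarrow> y \<noteq> 0 \<Longrightarrow> w (x / y) = w x - w y"
    and "x \<noteq> 0 \<Longrightarrow> w (x ^ n) = real n * w x"
    and "x \<noteq> 0 \<Longrightarrow> w (x powi k) = of_int k * w x"
proof -
  have rat: "\<exists>q::rat. v x = ereal (of_rat q)" if "x \<noteq> 0" for x
    using v that unfolding additive_valuation_def by blast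
  show fin: "v x = ereal (w x)" if "x \<noteq> 0" for x using rat[OF that] by (auto simp: w_def)
  show "w x \<in> \<rat>" if "x \<noteq> 0" for x using rat[OF that] by (auto simp: w_def)
  show mult: "w (x * y) = w x + w y" if "x \<noteq> 0" "y \<noteq> 0" for x y
  proof -
    have "v (x * y) = v x + v y" using v unfolding additive_valuation_def by blast
    then have "ereal (w (x * y)) = ereal (w x + w y)" using fin[of x] fin[of y] fin[of "x * y"] that by simp
    then show ?thesis by simp
  qed
  show one: "w 1 = 0" using mult[of 1 1] by simp
  show inv: "w (inverse x) = - w x" if "x \<noteq> 0" for x using mult[of x "inverse x"] that one by simp
  show "w (x / y) = w x - w y" if "x \<noteq> 0" "y \<noteq> 0" for x y
    using mult[of x "inverse y"] inv[of y] that by (simp add: divide_inverse)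
  show pow: "w (x ^ n) = real n * w x" if "x \<noteq> 0" for x n
  proof (induction n)
    case (Suc n)
    then show ?case using mult[OF that, of "x ^ n"] that by (simp add: algebra_simps)
  qed (simp add: one)
  show "w (x powi k) = of_int k * w x" if "x \<noteq> 0" for x k
    using pow[OF that, of "nat k"] pow[of "inverse x" "nat (- k)"] inv[OF that] that
    by (auto simp: power_int_def)
qed

lemma additive_valuation_unit_iff:
  assumes v: "additive_valuation v" and x: "x \<noteq> 0"
  shows "x \<in> ring_units {x. 0 \<le> v x} \<longleftrightarrow> real_of_ereal (v x) = 0"
  using additive_valuation_real(1,5)[OF v x] additive_valuation_real(1)[OF v, of "inverse x"] x
  by (auto simp: ring_units_def)

text \<open>
  Rational valuations with the same valuation ring have the same units and are therefore proportional.
  As both map the non-zero elements of the fraction field of \<open>\<oo>\<close> onto the integers, the factor is 1 or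
  \<open>-1\<close>; it is positive since an element of value 1 is in the common valuation ring.
\<close>

lemma normalized_valuation_unique:
  assumes v: "normalized_valuation \<oo> P v" and w: "normalized_valuation \<oo> P w"
  shows "v = w"
proof
  have av: "additive_valuation v" "additive_valuation w"
    and B: "{x. 0 \<le> v x} = {x. 0 \<le> w x}"
    and rv: "v ` (frac_field \<oo> - {0}) = range (\<lambda>n::int. ereal (of_int n))"
    and rw: "w ` (frac_field \<oo> - {0}) = range (\<lambda>n::int. ereal (of_int n))"
    using v w unfolding normalized_valuation_def by auto
  note V = additive_valuation_real[OF av(1)] and W = additive_valuation_real[OF av(2)]
  let ?v = "\<lambda>x. real_of_ereal (v x)" and ?w = "\<lambda>x. real_of_ereal (w x)"
  have "ereal (of_int 1) \<in> v ` (frac_field \<oo> - {0})" unfolding rv by blast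
  then obtain t where "t \<in> frac_field \<oo> - {0}" and t1: "ereal (of_int 1) = v t" by (rule imageE)
  then have t: "t \<in> frac_field \<oo>" "t \<noteq> 0" "?v t = 1" by (auto simp flip: t1)
  have "ereal (of_int 1) \<in> w ` (frac_field \<oo> - {0})" unfolding rw by blast
  then obtain y where "y \<in> frac_field \<oo> - {0}" and y1: "ereal (of_int 1) = w y" by (rule imageE)
  then have y: "y \<in> frac_field \<oo>" "y \<noteq> 0" "?w y = 1" by (auto simp flip: y1)
  have vint: "\<exists>j::int. ?v x = of_int j" if "x \<in> frac_field \<oo>" "x \<noteq> 0" for x
  proof -
    have "v x \<in> range (\<lambda>n::int. ereal (of_int n))" using that rv by blast
    then show ?thesis by force
  qed
  have wint: "\<exists>j::int. ?w x = of_int j" if "x \<in> frac_field \<oo>" "x \<noteq> 0" for x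
  proof -
    have "w x \<in> range (\<lambda>n::int. ereal (of_int n))" using that rw by blast
    then show ?thesis by force
  qed
  have ratio: "?w x = ?v x * ?w t" if x: "x \<noteq> 0" for x
  proof -
    obtain k n where n: "0 < n" "?v x = of_int k / of_nat n"
    proof -
      obtain i j where "j > 0" "?v x = of_int i / of_int j" using Rats_cases'[OF V(2)[OF x]] by metis
      then show thesis using that[of "nat j" i] by simp
    qed
    have nz: "x ^ n \<noteq> 0" "t powi k \<noteq> 0" "x ^ n / t powi k \<noteq> 0" using x t by auto
    have "?v (x ^ n / t powi k) = 0"
      using V(6)[OF nz(1,2)] V(7)[OF x] V(8)[OF t(2)] t(3) n by simp
    then have "?w (x ^ n / t powi k) = 0"
      using additive_valuation_unit_iff[OF av(1) nz(3)] additive_valuation_unit_iff[OF av(2) nz(3)] B by simp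
    then have "real n * ?w x = of_int k * ?w t"
      using W(6)[OF nz(1,2)] W(7)[OF x] W(8)[OF t(2)] by simp
    then have "?w x = of_int k * ?w t / real n" using n(1) by (simp add: field_simps)
    then show ?thesis using n(2) by simp
  qed
  obtain i j where "?v y = of_int i" "?w t = of_int j" using vint[OF y(1,2)] wint[OF t(1,2)] by blast
  then have ij: "i * j = 1" using ratio[OF y(2)] y(3) by (metis of_int_eq_1_iff of_int_mult)
  have "0 \<le> v t" using V(1)[OF t(2)] t(3) by simp
  then have "0 \<le> w t" using B by blast
  then have "0 \<le> ?w t" by (simp add: real_of_ereal_pos)
  then have "?w t = 1" using ij \<open>?w t = of_int j\<close> by (auto simp: zmult_eq_1_iff)
  then have eq: "?w x = ?v x" if "x \<noteq> 0" for x using ratio[OF that] by simp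
  fix x show "v x = w x"
  proof (cases "x = 0")
    case True
    then show ?thesis using av by (simp add: additive_valuation_def)
  next
    case False
    then show ?thesis using V(1)[OF False] W(1)[OF False] eq[OF False] by simp
  qed
qed

lemma finite_total_preorder_least:
  assumes "finite A" "A \<noteq> {}" "\<And>x y. R x y \<or> R y x" "\<And>x y z. R x y \<Longrightarrow> R y z \<Longrightarrow> R x z"
  shows "\<exists>m\<in>A. \<forall>x\<in>A. R m x"
  using assms(1,2)
proof (induction A rule: finite_ne_induct)
  case (singleton x)
  then show ?case using assms(3)[of x x] by blast
next
  case (insert x F)
  then obtain m where "m \<in> F" "\<forall>y\<in>F. R m y" by blast
  then show ?case using assms(3)[of x m] assms(3)[of x x] assms(4) by blast
qed

section \<open>Tagged reals\<close>

text \<open>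
  The reals \<open>a\<close> with \<open>TReal \<alpha> s \<le> TReal a False\<close> form the closed or the open half-line starting at \<open>\<alpha>\<close>,
  depending on the tag \<open>s\<close>.
\<close>

lemma treal_eqI:
  assumes "\<And>a. f \<le> TReal a False \<longleftrightarrow> g \<le> TReal a False"
  shows "f = g"
proof -
  obtain \<alpha> s \<beta> t where fg: "f = TReal \<alpha> s" "g = TReal \<beta> t" by (metis treal.exhaust)
  have "\<alpha> = \<beta>"
  proof (rule ccontr)
    assume "\<alpha> \<noteq> \<beta>"
    then show False using assms[of "(\<alpha> + \<beta>) / 2"] unfolding fg by (auto simp: field_simps)
  qed
  then show ?thesis using assms[of \<alpha>] unfolding fg by auto
qed

lemma treal_add_le_iff:
  "f + g \<le> TReal a False \<longleftrightarrow> (\<exists>b c. f \<le> TReal b False \<and> g \<le> TReal c False \<and> b + c \<le> a)"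
proof -
  obtain \<alpha> s \<beta> t where fg: "f = TReal \<alpha> s" "g = TReal \<beta> t" by (metis treal.exhaust)
  show ?thesis
  proof
    assume le: "f + g \<le> TReal a False"
    show "\<exists>b c. f \<le> TReal b False \<and> g \<le> TReal c False \<and> b + c \<le> a"
    proof (cases "\<alpha> + \<beta> < a")
      case True
      let ?e = "(a - \<alpha> - \<beta>) / 2"
      have "f \<le> TReal (\<alpha> + ?e) False" "g \<le> TReal (\<beta> + ?e) False" using True by (auto simp: fg)
      moreover have "(\<alpha> + ?e) + (\<beta> + ?e) \<le> a" by (simp add: field_simps)
      ultimately show ?thesis by blast
    next
      case False
      then have "\<alpha> + \<beta> = a" "s = False" "t = False" using le by (auto simp: fg max_def split: if_splits)
      then show ?thesis by (intro exI[of _ \<alpha>] exI[of _ \<beta>]) (auto simp: fg)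
    qed
  next
    assume "\<exists>b c. f \<le> TReal b False \<and> g \<le> TReal c False \<and> b + c \<le> a"
    then obtain b c where "f \<le> TReal b False" "g \<le> TReal c False" "b + c \<le> a" by blast
    then show "f + g \<le> TReal a False" by (auto simp: fg max_def split: if_splits)
  qed
qed

lemma treal_less_iff:
  "f < TReal a False \<longleftrightarrow> (\<exists>b<a. f \<le> TReal b False)"
  "f < TReal a True \<longleftrightarrow> f \<le> TReal a False"
proof -
  obtain \<alpha> s where f: "f = TReal \<alpha> s" by (metis treal.exhaust)
  show "f < TReal a True \<longleftrightarrow> f \<le> TReal a False"
    by (auto simp: f less_treal_def)
  show "f < TReal a False \<longleftrightarrow> (\<exists>b<a. f \<le> TReal b False)"
  proof
    assume "f < TReal a False"
    then have "\<alpha> < a" by (auto simp: f less_treal_def)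
    then show "\<exists>b<a. f \<le> TReal b False" by (intro exI[of _ "(\<alpha> + a) / 2"]) (auto simp: f)
  next
    assume "\<exists>b<a. f \<le> TReal b False"
    then show "f < TReal a False" by (auto simp: f less_treal_def)
  qed
qed

lemma treal_le_trans: "f \<le> TReal a False \<Longrightarrow> a \<le> b \<Longrightarrow> f \<le> TReal b False"
  by (cases f) auto

lemma treal_regular_inverse:
  fixes f g :: treal
  shows "f = f + g + f \<Longrightarrow> iota f = f + g + g"
  by (cases f; cases g) (auto simp: max_def split: if_splits)

lemma treal_iota_regular: "f + iota f + f = f"
  by (cases f) (auto simp: max_def)

lemma treal_sum_zero:
  assumes "f + g = 0"
  obtains a where "f = TReal a False" "g = iota f"
proof -
  obtain \<alpha> s \<beta> t where fg: "f = TReal \<alpha> s" "g = TReal \<beta> t" by (metis treal.exhaust)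
  then have "s = False" "t = False" "\<beta> = - \<alpha>"
    using assms by (auto simp: zero_treal_def max_def split: if_splits)
  then show thesis using that[of \<alpha>] fg by simp
qed

section \<open>The integral closure of a Dedekind domain in an algebraic extension\<close>

locale dedekind_extension =
  fixes \<oo> :: "'a::field set"
  assumes dedekind: "dedekind_domain \<oo>"
    and not_field: "\<not> Ring.field (ring_on \<oo>)"
    and algebraic: "algebraic_extension (frac_field \<oo>)"
begin

abbreviation K :: "'a set" where "K \<equiv> frac_field \<oo>"
abbreviation iprod :: "'a set \<Rightarrow> 'a set \<Rightarrow> 'a set" where "iprod \<equiv> ideal_prod ambient"
abbreviation Ft :: "'a set \<Rightarrow> 'a set \<Rightarrow> treal" where "Ft \<equiv> F_tilde \<oo>"
abbreviation FM :: "'a set monoid" where "FM \<equiv> frac_ideal_monoid (integral_closure \<oo>)"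
abbreviation SM :: "('a set \<Rightarrow> treal) monoid" where "SM \<equiv> S_b_V_monoid \<oo>"
abbreviation \<OO> :: "'a set" where "\<OO> \<equiv> integral_closure \<oo>"

lemma base_subring: "is_subring \<oo>"
  using dedekind by (simp add: dedekind_domain_def subring_ambient_iff)

lemma OO_subring: "is_subring \<OO>" and base_subset_OO: "\<oo> \<subseteq> \<OO>"
  using integral_closure_subring[OF base_subring] .

lemmas oD = is_subringD[OF base_subring] and OD = is_subringD[OF OO_subring]

lemma base_noetherian: "noetherian_domain (ring_on \<oo>)"
  using dedekind by (simp add: dedekind_domain_def)

lemma base_prime_maximal: "is_prime \<oo> P \<Longrightarrow> P \<noteq> {0} \<Longrightarrow> is_maximal \<oo> P"
  using dedekind primeideal_ring_on_iff[OF base_subring] maximalideal_ring_on_iff[OF base_subring]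
  by (simp add: dedekind_domain_def)

lemma base_integrally_closed: "x \<in> K \<Longrightarrow> x \<in> \<OO> \<Longrightarrow> x \<in> \<oo>"
  using dedekind by (simp add: dedekind_domain_def integral_closure_def)

lemma frac_fieldI: "a \<in> \<oo> \<Longrightarrow> b \<in> \<oo> \<Longrightarrow> b \<noteq> 0 \<Longrightarrow> a / b \<in> K"
  unfolding frac_field_def by blast

lemma frac_fieldE:
  assumes "x \<in> K"
  obtains a b where "a \<in> \<oo>" "b \<in> \<oo>" "b \<noteq> 0" "x = a / b"
  using assms unfolding frac_field_def by blast

lemma frac_field_subring: "is_subring K"
  unfolding is_subring_def
proof (intro conjI ballI)
  show "1 \<in> K" using frac_fieldI[of 1 1] oD(1) by simp
  fix x y assume "x \<in> K" "y \<in> K"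
  then obtain a b c d where 1: "a \<in> \<oo>" "b \<in> \<oo>" "b \<noteq> 0" "x = a / b" "c \<in> \<oo>" "d \<in> \<oo>" "d \<noteq> 0" "y = c / d"
    by (metis frac_fieldE)
  have "x - y = (a * d - c * b) / (b * d)" using 1 by (simp add: field_simps)
  then show "x - y \<in> K" using 1(1-3,5-7) frac_fieldI oD(3,6) by simp
  have "x * y = (a * c) / (b * d)" using 1 by (simp add: field_simps)
  then show "x * y \<in> K" using 1(1-3,5-7) frac_fieldI oD(3,6) by simp
qed

text \<open>
  The constant coefficient of a monic equation for \<open>x\<close> is a multiple of \<open>x\<close>. If it vanishes, the
  equation is divided by the indeterminate.
\<close>

lemma OO_divides_base:
  assumes x: "x \<in> \<OO>" "x \<noteq> 0"
  shows "\<exists>y\<in>\<OO>. x * y \<in> \<oo> \<and> x * y \<noteq> 0"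
proof -
  have "\<exists>y\<in>\<OO>. x * y \<in> \<oo> \<and> x * y \<noteq> 0"
    if "Polynomial.lead_coeff p = 1" "coeffs_in \<oo> p" "poly p x = 0" for p
    using that
  proof (induction p)
    case (pCons c q)
    have q: "c \<in> \<oo>" "coeffs_in \<oo> q" using pCons.prems(2) coeffs_in_pCons[OF base_subring] by auto
    have "q \<noteq> 0" using pCons.prems(1,3) by (auto split: if_splits)
    then have lc: "Polynomial.lead_coeff q = 1" using pCons.prems(1) by simp
    have eq: "x * poly q x = - c" using pCons.prems(3) by (simp add: eq_neg_iff_add_eq_0 add.commute)
    show ?case
    proof (cases "c = 0")
      case True
      then show ?thesis using pCons.IH[OF lc q(2)] eq x by simp
    next
      case False
      have "poly q x \<in> \<OO>"
        by (rule poly_in_subring[OF OO_subring coeffs_in_mono[OF base_subset_OO q(2)] x(1)])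
      then show ?thesis using eq False q(1) oD(4) by (intro bexI[of _ "poly q x"]) auto
    qed
  qed simp
  then show ?thesis using x unfolding integral_closure_def integral_over_def coeffs_in_def by blast
qed

lemma common_denominator:
  assumes "finite A" "A \<subseteq> K"
  shows "\<exists>d\<in>\<oo>. d \<noteq> 0 \<and> (\<forall>x\<in>A. d * x \<in> \<oo>)"
  using assms
proof (induction A rule: finite_induct)
  case empty
  then show ?case using oD(1) by (intro bexI[of _ 1]) auto
next
  case (insert x F)
  then obtain d where d: "d \<in> \<oo>" "d \<noteq> 0" "\<forall>x\<in>F. d * x \<in> \<oo>" by auto
  obtain a b where ab: "a \<in> \<oo>" "b \<in> \<oo>" "b \<noteq> 0" "x = a / b" using insert.prems frac_fieldE by auto
  have "b * d * x = d * a" using ab by simp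
  then have "b * d * x \<in> \<oo>" using oD(6) ab d by simp
  moreover have "b * d * y \<in> \<oo>" if "y \<in> F" for y using oD(6)[of b "d * y"] d ab that by (simp add: mult.assoc)
  ultimately show ?case using oD(6)[of b d] ab d by (intro bexI[of _ "b * d"]) auto
qed

text \<open>
  Denominators are cleared in an equation over the fraction field. The polynomials of HOL-Algebra are
  lists that start with the leading coefficient, whence the reversal.
\<close>

lemma algebraic_equation:
  obtains a n where "0 < n" "\<And>i. a i \<in> \<oo>" "a n \<noteq> 0" "(\<Sum>i\<le>n. a i * x ^ i) = 0"
proof -
  interpret A: domain "ambient :: 'a ring" by (rule field.axioms(1)[OF field_ambient])
  have "subring K ambient" by (rule iffD2[OF subring_ambient_iff frac_field_subring])
  moreover have "A.algebraic K x" using algebraic unfolding algebraic_extension_def by simp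
  ultimately obtain p where p: "p \<in> carrier (K [X]\<^bsub>ambient\<^esub>)" "p \<noteq> []" "A.eval p x = \<zero>\<^bsub>ambient\<^esub>"
    using A.algebraicE[of "K" x] unfolding over_def by auto
  then obtain c ps where cps: "p = c # ps" by (cases p) auto
  have sub: "set p \<subseteq> K" and c0: "c \<noteq> 0"
    using p(1) cps unfolding univ_poly_carrier[symmetric] polynomial_def by auto
  have pow: "y [^]\<^bsub>ambient\<^esub> k = y ^ k" for y :: 'a and k :: nat
    by (induction k) (simp_all add: mult.commute)
  have ev: "A.eval qs x = (\<Sum>i<length qs. rev qs ! i * x ^ i)" for qs
  proof (induction qs)
    case (Cons q qs)
    have "(\<Sum>i<length qs. rev (q # qs) ! i * x ^ i) = (\<Sum>i<length qs. rev qs ! i * x ^ i)"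
      by (rule sum.cong) (auto simp: nth_append)
    then show ?case using Cons by (simp add: pow nth_append add.commute)
  qed simp
  obtain d where d: "d \<in> \<oo>" "d \<noteq> 0" "\<forall>y\<in>set p. d * y \<in> \<oo>"
    using common_denominator[OF finite_set sub] by blast
  define a where "a = (\<lambda>i. if i < length p then d * (rev p ! i) else 0)"
  have n: "length p = Suc (length ps)" using cps by simp
  have eq: "(\<Sum>i\<le>length ps. a i * x ^ i) = 0"
  proof -
    have "(\<Sum>i\<le>length ps. a i * x ^ i) = (\<Sum>i<length p. d * (rev p ! i * x ^ i))"
      unfolding n lessThan_Suc_atMost by (rule sum.cong) (auto simp: a_def n)
    also have "\<dots> = d * A.eval p x" unfolding ev by (simp add: sum_distrib_left)
    finally show ?thesis using p(3) by simp
  qed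
  have an: "a (length ps) \<noteq> 0" using d c0 by (simp add: a_def cps nth_append)
  have "length ps \<noteq> 0" using eq an by auto
  moreover have "a i \<in> \<oo>" for i
  proof (cases "i < length p")
    case True
    then have "rev p ! i \<in> set p" by (metis length_rev nth_mem set_rev)
    then show ?thesis using d True by (simp add: a_def)
  qed (simp add: a_def oD(2))
  ultimately show ?thesis using that[of "length ps" a] eq an by blast
qed

text \<open>
  The leading coefficient is one of the partial results of Horner's scheme.
\<close>

lemma OO_denominator: "\<exists>d\<in>\<oo>. d \<noteq> 0 \<and> d * x \<in> \<OO>"
proof -
  obtain a n where a: "0 < n" "\<And>i. a i \<in> \<oo>" "a n \<noteq> 0" "(\<Sum>i\<le>n. a i * x ^ i) = 0"
    using algebraic_equation[of x] by metis
  have "(\<Sum>i=n..n. a i * x ^ (i - n)) * x \<in> \<OO>"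
    by (rule horner_partial_sum_integral(2)[OF base_subring a(2) a(1) a(4)])
  then show ?thesis using a by auto
qed

text \<open>
  If the zero ideal were maximal, \<open>\<OO>\<close> would be a field. The inverse of a non-zero element of \<open>\<oo>\<close> would
  then be integral over \<open>\<oo>\<close> and hence in \<open>\<oo>\<close>, which is not a field.
\<close>

lemma maximal_nonzero:
  assumes P: "is_maximal \<OO> P"
  shows "\<exists>x\<in>P \<inter> \<oo>. x \<noteq> 0"
proof -
  have "\<exists>x\<in>P. x \<noteq> 0"
  proof (rule ccontr)
    assume "\<not> (\<exists>x\<in>P. x \<noteq> 0)"
    then have P0: "P = {0}" using is_maximalD(5)[OF P] by auto
    have "Ring.field (ring_on \<oo>)"
    proof (rule field_ring_on[OF base_subring])
      fix x assume x: "x \<in> \<oo>" "x \<noteq> 0"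
      then obtain y where y: "y \<in> \<OO>" "1 - x * y \<in> P" using is_maximalD(6)[OF P, of x] P0 base_subset_OO by auto
      then have "y = 1 / x" using x P0 by (simp add: field_simps)
      then have "inverse x \<in> \<OO>" "inverse x \<in> K"
        using y frac_fieldI[OF oD(1) x] by (simp_all add: inverse_eq_divide)
      then show "inverse x \<in> \<oo>" using base_integrally_closed by simp
    qed
    then show False using not_field by simp
  qed
  then obtain x where x: "x \<in> P" "x \<noteq> 0" by blast
  then obtain y where "y \<in> \<OO>" "x * y \<in> \<oo>" "x * y \<noteq> 0" using OO_divides_base is_maximalD(4)[OF P] by blast
  moreover have "x * y \<in> P"
    using is_submoduleD(3)[OF is_maximalD(2)[OF P], of y x] x \<open>y \<in> \<OO>\<close> by (simp add: mult.commute)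
  ultimately show ?thesis by blast
qed

lemma prime_contraction:
  assumes P: "is_prime \<OO> P"
  shows "is_prime \<oo> (P \<inter> \<oo>)"
  using P base_subset_OO oD(2,5,6)
  unfolding is_prime_def is_ideal_def is_submodule_def by (auto 4 3)

lemma maximal_contraction:
  assumes P: "is_maximal \<OO> P"
  shows "is_maximal \<oo> (P \<inter> \<oo>)"
  using base_prime_maximal[OF prime_contraction[OF is_maximal_prime[OF OO_subring P]]]
    maximal_nonzero[OF P] by blast

text \<open>
  Modulo \<open>P\<close> an element \<open>x\<close> outside \<open>P\<close> satisfies a monic equation over the residue field of \<open>P \<inter> \<oo>\<close>.
  After powers of \<open>x\<close> have been cancelled, the constant coefficient is invertible modulo \<open>P\<close>, and the
  equation exhibits an inverse of \<open>x\<close>.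
\<close>

lemma OO_prime_maximal:
  assumes P: "is_prime \<OO> P" and nz: "P \<noteq> {0}"
  shows "is_maximal \<OO> P"
proof -
  have I: "is_ideal \<OO> P" using P by (simp add: is_prime_def)
  note D = is_idealD[OF I] is_submoduleD[OF is_idealD(1)[OF I]]
  obtain z where "z \<in> P" "z \<noteq> 0" using nz D(3) by auto
  then obtain y where "y \<in> \<OO>" "z * y \<in> \<oo>" "z * y \<noteq> 0" using OO_divides_base D(2) by blast
  then have "z * y \<in> P \<inter> \<oo>" using D(5)[of y z] \<open>z \<in> P\<close> by (simp add: mult.commute)
  then have p: "is_maximal \<oo> (P \<inter> \<oo>)"
    using base_prime_maximal[OF prime_contraction[OF P]] \<open>z * y \<noteq> 0\<close> by blast
  have "\<exists>y\<in>\<OO>. 1 - x * y \<in> P" if x: "x \<in> \<OO>" "x \<notin> P" for x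
  proof -
    have "\<exists>y\<in>\<OO>. 1 - x * y \<in> P"
      if "Polynomial.lead_coeff p = 1" "coeffs_in \<oo> p" "poly p x \<in> P" for p
      using that
    proof (induction p)
      case (pCons c q)
      have q: "c \<in> \<oo>" "coeffs_in \<oo> q" using pCons.prems(2) coeffs_in_pCons[OF base_subring] by auto
      have "q \<noteq> 0" using pCons.prems(1,3) P by (auto simp: is_prime_def split: if_splits)
      then have lc: "Polynomial.lead_coeff q = 1" using pCons.prems(1) by simp
      have qx: "poly q x \<in> \<OO>"
        by (rule poly_in_subring[OF OO_subring coeffs_in_mono[OF base_subset_OO q(2)] x(1)])
      have eq: "c + x * poly q x \<in> P" using pCons.prems(3) by simp
      show ?case
      proof (cases "c \<in> P")
        case True
        have "(c + x * poly q x) - c \<in> P" by (rule is_submodule_diff[OF OO_subring D(1) eq True])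
        then have "x * poly q x \<in> P" by simp
        then have "poly q x \<in> P" using P x qx unfolding is_prime_def by blast
        then show ?thesis using pCons.IH[OF lc q(2)] by simp
      next
        case False
        then obtain c' where c': "c' \<in> \<oo>" "1 - c * c' \<in> P" using is_maximalD(6)[OF p, of c] q(1) by blast
        have c'O: "c' \<in> \<OO>" using c' base_subset_OO by blast
        have "(1 - c * c') + c' * (c + x * poly q x) \<in> P" using D(4,5) c' c'O eq by blast
        also have "(1 - c * c') + c' * (c + x * poly q x) = 1 - x * (- (c' * poly q x))"
          by (simp add: algebra_simps)
        finally show ?thesis using OD(4,6) c'O qx by blast
      qed
    qed simp
    moreover obtain p where "Polynomial.lead_coeff p = 1" "coeffs_in \<oo> p" "poly p x = 0"
      using x(1) unfolding integral_closure_def integral_over_def coeffs_in_def by blast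
    ultimately show ?thesis using D(3) by simp
  qed
  then show ?thesis using P by (auto simp: is_maximal_def is_prime_def)
qed

section \<open>Uniformizers of the base ring\<close>

text \<open>
  In the localization at \<open>p\<close> the element \<open>u\<close> is a unit, so that \<open>t\<close> generates the maximal ideal. A
  maximal element \<open>saturation \<oo> p a b\<close> among the proper ones is prime and therefore equal to \<open>p\<close>. Up to a
  denominator, \<open>c = b / a\<close> then satisfies \<open>c p \<subseteq> \<oo>\<close>, but \<open>c\<close> is not in the localization. If \<open>c p\<close> were
  contained in \<open>p\<close>, the determinant trick would make \<open>c\<close> integral over \<open>\<oo>\<close>. So \<open>u = c t\<close> is outside \<open>p\<close>
  for some \<open>t \<in> p\<close>, and \<open>r u = t (c r)\<close>.
\<close>

lemma uniformizer:
  assumes p: "is_maximal \<oo> p" and nz: "p \<noteq> {0}"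
  shows "\<exists>t\<in>p. \<exists>u\<in>\<oo> - p. \<forall>r\<in>p. \<exists>w\<in>\<oo>. r * u = t * w"
proof -
  note D = is_maximalD[OF p]
  note M = is_submoduleD[OF D(2)]
  have prime: "is_prime \<oo> p" by (rule is_maximal_prime[OF base_subring p])
  note C = is_prime_compl[OF base_subring prime]
  obtain a where a: "a \<in> p" "a \<noteq> 0" using nz D(5) by blast
  have ao: "a \<in> \<oo>" using a D(4) by blast
  let ?q = "saturation \<oo> p a"
  have qI: "is_ideal \<oo> (?q b)" for b by (rule saturation_ideal[OF base_subring prime])
  define \<C> where "\<C> = {?q b | b. b \<in> \<oo> \<and> 1 \<notin> ?q b}"
  have "1 \<notin> ?q 1"
  proof
    assume "1 \<in> ?q 1"
    then obtain s w where "s \<in> \<oo> - p" "w \<in> \<oo>" "s = a * w" unfolding saturation_def by auto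
    then show False using M(3)[of w a] a by (auto simp: mult.commute)
  qed
  then have "?q 1 \<in> \<C>" unfolding \<C>_def using oD(1) by blast
  then have ne: "\<C> \<noteq> {}" by blast
  have "is_ideal \<oo> I" if "I \<in> \<C>" for I using that qI unfolding \<C>_def by auto
  then obtain Q where Q: "Q \<in> \<C>" "\<And>I. I \<in> \<C> \<Longrightarrow> Q \<subseteq> I \<Longrightarrow> I = Q"
    using noetherian_maximal_element[OF base_subring base_noetherian ne] by auto
  then obtain b where b: "b \<in> \<oo>" "1 \<notin> ?q b" "Q = ?q b" unfolding \<C>_def by blast
  have notin: "r * b \<noteq> a * w" if "r \<in> \<oo> - p" "w \<in> \<oo>" for r w
    using b(2) that oD(1) unfolding saturation_def by auto
  have primeQ: "is_prime \<oo> (?q b)"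
    unfolding is_prime_def
  proof (intro conjI ballI impI)
    show "is_ideal \<oo> (?q b)" "1 \<notin> ?q b" using qI b by auto
    fix x y assume x: "x \<in> \<oo>" and y: "y \<in> \<oo>" and xy: "x * y \<in> ?q b"
    show "x \<in> ?q b \<or> y \<in> ?q b"
    proof (rule ccontr)
      assume n: "\<not> (x \<in> ?q b \<or> y \<in> ?q b)"
      have "1 \<notin> ?q (b * y)"
      proof
        assume "1 \<in> ?q (b * y)"
        then obtain s w where "s \<in> \<oo> - p" "w \<in> \<oo>" "s * (b * y) = a * w" unfolding saturation_def by auto
        moreover from this have "s * y * b = a * w" by (simp add: mult_ac)
        ultimately have "y \<in> ?q b" unfolding saturation_def using y by blast
        then show False using n by simp
      qed
      then have "?q (b * y) \<in> \<C>" unfolding \<C>_def using oD(6)[OF b(1) y] by blast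
      moreover have "?q b \<subseteq> ?q (b * y)"
      proof
        fix r assume "r \<in> ?q b"
        then obtain s w where 1: "r \<in> \<oo>" "s \<in> \<oo> - p" "w \<in> \<oo>" "s * r * b = a * w" unfolding saturation_def by auto
        have "s * r * (b * y) = a * (w * y)" using 1(4) by (simp flip: mult.assoc)
        then show "r \<in> ?q (b * y)" unfolding saturation_def using 1(1,2) oD(6)[OF 1(3) y] by blast
      qed
      ultimately have "?q (b * y) = ?q b" using Q(2) b(3) by metis
      moreover have "x \<in> ?q (b * y)"
      proof -
        obtain s w where 1: "s \<in> \<oo> - p" "w \<in> \<oo>" "s * (x * y) * b = a * w"
          using xy unfolding saturation_def by auto
        have "s * x * (b * y) = a * w" using 1(3) by (simp add: mult_ac)
        then show ?thesis unfolding saturation_def using 1(1,2) x by blast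
      qed
      ultimately show False using n by simp
    qed
  qed
  have "1 * a * b = a * b" by simp
  then have "a \<in> ?q b" unfolding saturation_def using ao b(1) C(1) by blast
  then have maxQ: "is_maximal \<oo> (?q b)" using base_prime_maximal[OF primeQ] a(2) by blast
  have Qp: "?q b \<subseteq> p"
  proof
    fix r assume "r \<in> ?q b"
    then obtain s w where 1: "r \<in> \<oo>" "s \<in> \<oo> - p" "w \<in> \<oo>" "s * r * b = a * w" unfolding saturation_def by auto
    then show "r \<in> p" using notin[of "s * r" w] C(2)[of s r] by blast
  qed
  have pQ: "p \<subseteq> ?q b"
  proof
    fix x assume x: "x \<in> p"
    show "x \<in> ?q b"
    proof (rule ccontr)
      assume "x \<notin> ?q b"
      then obtain y where y: "y \<in> \<oo>" "1 - x * y \<in> p" using is_maximalD(6)[OF maxQ] x D(4) Qp by blast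
      have "(1 - x * y) + y * x \<in> p" using M x y by blast
      then show False using D(3) by (simp add: algebra_simps)
    qed
  qed
  obtain A where A: "finite A" "A \<subseteq> p" "\<And>J. is_ideal \<oo> J \<Longrightarrow> A \<subseteq> J \<Longrightarrow> p \<subseteq> J"
    using noetherian_finitely_generated[OF base_subring base_noetherian D(1)] by blast
  \<comment> \<open>a common denominator for the generators\<close>
  have "\<exists>s\<in>\<oo> - p. \<forall>g\<in>A. \<exists>w\<in>\<oo>. s * g * b = a * w"
    using A(1,2)
  proof (induction A rule: finite_induct)
    case (insert g F)
    then obtain s where s: "s \<in> \<oo> - p" "\<forall>g\<in>F. \<exists>w\<in>\<oo>. s * g * b = a * w" by auto
    obtain s' w' where s': "s' \<in> \<oo> - p" "w' \<in> \<oo>" "s' * g * b = a * w'"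
      using pQ insert.prems unfolding saturation_def by blast
    have "\<exists>w\<in>\<oo>. (s * s') * h * b = a * w" if h: "h \<in> insert g F" for h
    proof (cases "h = g")
      case True
      have "(s * s') * h * b = a * (s * w')" using s'(3) True by (simp add: mult_ac)
      then show ?thesis using oD(6)[of s w'] s s' by blast
    next
      case False
      then obtain w where w: "w \<in> \<oo>" "s * h * b = a * w" using s(2) h by blast
      have "(s * s') * h * b = s' * (s * h * b)" by (simp add: mult_ac)
      also have "\<dots> = a * (s' * w)" unfolding w(2) by (simp add: mult_ac)
      finally show ?thesis using oD(6)[of s' w] s' w by blast
    qed
    then show ?case using C(2)[OF s(1) s'(1)] by blast
  qed (use C(1) in auto)
  then obtain s where s: "s \<in> \<oo> - p" "\<And>g. g \<in> A \<Longrightarrow> \<exists>w\<in>\<oo>. s * g * b = a * w" by blast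
  \<comment> \<open>\<open>c\<close> multiplies \<open>p\<close> into \<open>\<oo>\<close> without lying in \<open>\<oo>\<close>\<close>
  define c where "c = s * b / a"
  have cK: "c \<in> K" unfolding c_def using frac_fieldI[of "s * b" a] oD(6)[of s b] s b ao a by simp
  have cp: "c * r \<in> \<oo>" if "r \<in> p" for r
  proof -
    have "is_ideal \<oo> {r \<in> \<oo>. c * r \<in> \<oo>}"
      unfolding is_ideal_def is_submodule_def
      using oD by (auto simp: distrib_left mult.left_commute[of c])
    moreover have "A \<subseteq> {r \<in> \<oo>. c * r \<in> \<oo>}"
    proof
      fix g assume g: "g \<in> A"
      then obtain w where w: "w \<in> \<oo>" "s * g * b = a * w" using s by blast
      then have "c * g = w" unfolding c_def using a by (simp add: field_simps)
      then show "g \<in> {r \<in> \<oo>. c * r \<in> \<oo>}" using w g A(2) D(4) by auto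
    qed
    ultimately show ?thesis using A(3) that by blast
  qed
  have "\<exists>t\<in>p. c * t \<notin> p"
  proof (rule ccontr)
    assume "\<not> (\<exists>t\<in>p. c * t \<notin> p)"
    then have st: "\<And>t. t \<in> p \<Longrightarrow> c * t \<in> p" by blast
    have "span_over \<oo> A \<subseteq> p" by (rule span_over_minimal[OF D(2) A(2)])
    then have "is_ideal \<oo> (span_over \<oo> A)"
      using span_over_submodule[OF base_subring] D(4) unfolding is_ideal_def by blast
    then have pA: "p \<subseteq> span_over \<oo> A"
      by (rule A(3)) (use span_over_base[OF base_subring A(1)] in blast)
    have "is_ideal \<oo> {0}" using oD(2) by (auto simp: is_ideal_def is_submodule_def)
    then obtain w0 where w0: "w0 \<in> A" "w0 \<noteq> 0" using A(3)[of "{0}"] a by blast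
    have "integral_over \<oo> c"
      by (rule integral_over_if_stable[OF base_subring A(1) w0]) (use st A(2) pA in blast)
    then have "c \<in> \<oo>" using base_integrally_closed[OF cK] by (simp add: integral_closure_def)
    then show False using notin[OF s(1), of c] a by (simp add: c_def)
  qed
  then obtain t where t: "t \<in> p" "c * t \<notin> p" by blast
  have "\<exists>w\<in>\<oo>. r * (c * t) = t * w" if "r \<in> p" for r
    using cp[OF that] by (intro bexI[of _ "c * r"]) (auto simp: mult_ac)
  then show ?thesis using t cp[OF t(1)] by blast
qed

text \<open>
  Among the elements without such a factorization choose one whose principal ideal, saturated at \<open>p\<close>, is
  maximal. It lies in \<open>p\<close>, so it can be divided by \<open>t\<close>; the quotient has no factorization either, but
  its ideal is strictly larger.
\<close>

lemma uniformizer_factorization: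
  assumes p: "is_maximal \<oo> p" and t: "t \<in> p" and u: "u \<in> \<oo> - p"
    and tu: "\<And>r. r \<in> p \<Longrightarrow> \<exists>w\<in>\<oo>. r * u = t * w"
    and r: "r \<in> \<oo>" "r \<noteq> 0"
  shows "\<exists>n s s'. s \<in> \<oo> - p \<and> s' \<in> \<oo> - p \<and> s * r = t ^ n * s'"
proof (rule ccontr)
  note D = is_maximalD[OF p]
  note M = is_submoduleD[OF D(2)]
  have prime: "is_prime \<oo> p" by (rule is_maximal_prime[OF base_subring p])
  note C = is_prime_compl[OF base_subring prime]
  define good where "good r \<longleftrightarrow> (\<exists>n s s'. s \<in> \<oo> - p \<and> s' \<in> \<oo> - p \<and> s * r = t ^ n * s')" for r
  let ?I = "\<lambda>r. saturation \<oo> p r 1"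
  define \<C> where "\<C> = {?I r | r. r \<in> \<oo> \<and> r \<noteq> 0 \<and> \<not> good r}"
  assume "\<not> (\<exists>n s s'. s \<in> \<oo> - p \<and> s' \<in> \<oo> - p \<and> s * r = t ^ n * s')"
  then have "\<not> good r" by (simp add: good_def)
  then have "?I r \<in> \<C>" unfolding \<C>_def using r by blast
  then have ne: "\<C> \<noteq> {}" by blast
  have "is_ideal \<oo> I" if "I \<in> \<C>" for I
    using that saturation_ideal[OF base_subring prime] unfolding \<C>_def by auto
  then obtain Q where Q: "Q \<in> \<C>" "\<And>I. I \<in> \<C> \<Longrightarrow> Q \<subseteq> I \<Longrightarrow> I = Q"
    using noetherian_maximal_element[OF base_subring base_noetherian ne] by auto
  then obtain a where a: "a \<in> \<oo>" "a \<noteq> 0" "\<not> good a" "Q = ?I a" unfolding \<C>_def by blast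
  have "a \<in> p"
  proof (rule ccontr)
    assume "a \<notin> p"
    moreover have "1 * a = t ^ 0 * a" by simp
    ultimately have "good a" unfolding good_def using C(1) a(1) by blast
    then show False using a(3) by simp
  qed
  then obtain w where w: "w \<in> \<oo>" "a * u = t * w" using tu by blast
  have t0: "t \<noteq> 0" and w0: "w \<noteq> 0" using w(2) a(2) C(3)[OF u] by auto
  have "\<not> good w"
  proof
    assume "good w"
    then obtain n s s' where s: "s \<in> \<oo> - p" "s' \<in> \<oo> - p" "s * w = t ^ n * s'" unfolding good_def by blast
    have "(s * u) * a = t * (s * w)" using w(2) by (simp add: mult_ac)
    then have "(s * u) * a = t ^ Suc n * s'" unfolding s(3) by (simp add: mult_ac)
    then have "good a" unfolding good_def using C(2)[OF s(1) u] s(2) by blast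
    then show False using a(3) by simp
  qed
  then have "?I w \<in> \<C>" unfolding \<C>_def using w w0 by blast
  moreover have "?I a \<subseteq> ?I w"
  proof
    fix x assume "x \<in> ?I a"
    then obtain s z where 1: "x \<in> \<oo>" "s \<in> \<oo> - p" "z \<in> \<oo>" "s * x = a * z" unfolding saturation_def by auto
    have "(s * u) * x = u * (s * x)" by (simp add: mult_ac)
    also have "\<dots> = w * (t * z)" using w(2) unfolding 1(4) by (simp add: mult_ac flip: w(2))
    finally have "(s * u) * x * 1 = w * (t * z)" by simp
    moreover have "t * z \<in> \<oo>" using oD(6) t D(4) 1(3) by blast
    ultimately show "x \<in> ?I w" unfolding saturation_def using 1(1) C(2)[OF 1(2) u] by blast
  qed
  ultimately have "?I w = ?I a" using Q(2) a(4) by metis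
  moreover have "w \<in> ?I w" unfolding saturation_def using w(1) C(1) oD(1) by auto
  ultimately obtain s z where 1: "s \<in> \<oo> - p" "z \<in> \<oo>" "s * w = a * z" unfolding saturation_def by auto
  have "a * (s * u) = t * (s * w)" using w(2) by (simp add: mult_ac)
  then have "a * (s * u) = a * (z * t)" unfolding 1(3) by (simp add: mult_ac)
  then have "s * u = z * t" using a(2) by simp
  then have "s * u \<in> p" using M(3)[OF 1(2) t] by simp
  then show False using C(2)[OF 1(1) u] by blast
qed

section \<open>The valuation of a maximal ideal\<close>

abbreviation localization :: "'a set \<Rightarrow> 'a set" where "localization \<equiv> localization_at \<OO>"

lemma localizationI: "a \<in> \<OO> \<Longrightarrow> b \<in> \<OO> \<Longrightarrow> b \<notin> P \<Longrightarrow> a / b \<in> localization P"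
  unfolding localization_at_def by blast

lemma localization_subring:
  assumes P: "is_maximal \<OO> P"
  shows "is_subring (localization P)" "\<OO> \<subseteq> localization P"
proof -
  note C = is_prime_compl[OF OO_subring is_maximal_prime[OF OO_subring P]]
  show sub: "\<OO> \<subseteq> localization P"
  proof
    fix x assume "x \<in> \<OO>"
    then show "x \<in> localization P" using localizationI[of x 1 P] C(1) by simp
  qed
  show "is_subring (localization P)"
    unfolding is_subring_def
  proof (intro conjI ballI)
    show "1 \<in> localization P" using sub OD(1) by blast
    fix x y assume "x \<in> localization P" "y \<in> localization P"
    then obtain a b c d where 1: "a \<in> \<OO>" "b \<in> \<OO> - P" "x = a / b" "c \<in> \<OO>" "d \<in> \<OO> - P" "y = c / d"
      unfolding localization_at_def by blast
    have nz: "b \<noteq> 0" "d \<noteq> 0" "b * d \<in> \<OO> - P" using C(2,3) 1(2,5) by auto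
    have "x - y = (a * d - c * b) / (b * d)" using 1(3,6) nz by (simp add: field_simps)
    moreover have "a * d - c * b \<in> \<OO>" using OD(3,6) 1(1,2,4,5) by blast
    ultimately show "x - y \<in> localization P" using localizationI nz(3) by simp
    have "x * y = (a * c) / (b * d)" using 1(3,6) by simp
    moreover have "a * c \<in> \<OO>" using OD(6) 1(1,4) by blast
    ultimately show "x * y \<in> localization P" using localizationI nz(3) by simp
  qed
qed

lemma localization_unit:
  assumes P: "is_maximal \<OO> P" and x: "x \<in> \<OO>" "x \<notin> P"
  shows "x \<in> ring_units (localization P)"
  using localizationI[OF OD(1) x] localization_subring(2)[OF P] x is_maximalD(5)[OF P]
  by (auto simp: ring_units_def inverse_eq_divide)

lemma localization_nonunit:
  assumes P: "is_maximal \<OO> P" and x: "x \<in> P" "x \<noteq> 0"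
  shows "inverse x \<notin> localization P"
proof
  assume "inverse x \<in> localization P"
  then obtain a b where 1: "a \<in> \<OO>" "b \<in> \<OO>" "b \<notin> P" "inverse x = a / b"
    unfolding localization_at_def by blast
  then have "b \<noteq> 0" using is_maximalD(5)[OF P] by auto
  then have "b = a * x" using 1(4) x by (simp add: field_simps)
  then show False using 1 is_submoduleD(3)[OF is_maximalD(2)[OF P] 1(1) x(1)] by simp
qed

lemma localization_eq_contraction:
  "x \<in> \<oo> - P \<inter> \<oo> \<longleftrightarrow> x \<in> \<oo> \<and> x \<in> \<OO> \<and> x \<notin> P"
  using base_subset_OO by blast

lemma base_unit_power:
  assumes P: "is_maximal \<OO> P" and t: "t \<in> P \<inter> \<oo>" "t \<noteq> 0" and u: "u \<in> \<oo> - P \<inter> \<oo>"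
    and tu: "\<And>r. r \<in> P \<inter> \<oo> \<Longrightarrow> \<exists>w\<in>\<oo>. r * u = t * w"
    and r: "r \<in> \<oo>" "r \<noteq> 0"
  shows "\<exists>n. r / t ^ n \<in> ring_units (localization P)"
proof -
  obtain n s s' where s: "s \<in> \<oo> - P \<inter> \<oo>" "s' \<in> \<oo> - P \<inter> \<oo>" "s * r = t ^ n * s'"
    using uniformizer_factorization[OF maximal_contraction[OF P] t(1) u tu r] by blast
  have U: "s \<in> ring_units (localization P)" "s' \<in> ring_units (localization P)"
    using localization_unit[OF P] s(1,2) unfolding localization_eq_contraction by auto
  have "r / t ^ n = s' / s" using s(3) U(1) t(2) by (simp add: ring_units_def field_simps)
  then show ?thesis using ring_units_divide[OF localization_subring(1)[OF P] U(2,1)] by metis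
qed

text \<open>
  In the localization every non-zero coefficient is a power of \<open>t\<close> times a unit, and the equation can be
  divided by the least power that occurs.
\<close>

lemma primitive_equation:
  assumes P: "is_maximal \<OO> P" and t: "t \<in> P \<inter> \<oo>" "t \<noteq> 0" and u: "u \<in> \<oo> - P \<inter> \<oo>"
    and tu: "\<And>r. r \<in> P \<inter> \<oo> \<Longrightarrow> \<exists>w\<in>\<oo>. r * u = t * w"
  shows "\<exists>n a j. 0 < n \<and> (\<forall>i. a i \<in> \<oo>) \<and> j \<le> n \<and> a j \<notin> P \<and> (\<Sum>i\<le>n. a i * x ^ i) = 0"
proof -
  let ?p = "P \<inter> \<oo>"
  note C = is_prime_compl[OF base_subring is_maximal_prime[OF base_subring maximal_contraction[OF P]]]
  obtain a n where a: "0 < n" "\<And>i. a i \<in> \<oo>" "a n \<noteq> 0" "(\<Sum>i\<le>n. a i * x ^ i) = 0"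
    using algebraic_equation[of x] by metis
  have "\<exists>m s s'. s \<in> \<oo> - ?p \<and> s' \<in> \<oo> - ?p \<and> s * a i = t ^ m * s'" if "a i \<noteq> 0" for i
    using uniformizer_factorization[OF maximal_contraction[OF P] t(1) u tu a(2) that] by blast
  then obtain m s s' where s: "\<And>i. a i \<noteq> 0 \<Longrightarrow> s i \<in> \<oo> - ?p \<and> s' i \<in> \<oo> - ?p \<and> s i * a i = t ^ (m i) * s' i"
    by metis
  define I where "I = {i. i \<le> n \<and> a i \<noteq> 0}"
  have I: "finite I" "n \<in> I" using a by (auto simp: I_def)
  \<comment> \<open>the power of \<open>t\<close> that is divided out\<close>
  define \<mu> where "\<mu> = Min (m ` I)"
  have "\<mu> \<in> m ` I" unfolding \<mu>_def by (rule Min_in) (use I in auto)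
  then obtain j where j: "j \<in> I" "m j = \<mu>" by auto
  have mu: "\<mu> \<le> m i" if "i \<in> I" for i unfolding \<mu>_def using I that by simp
  have prod: "(\<Prod>k\<in>J. s k) \<in> \<oo> - ?p" if "J \<subseteq> I" for J
  proof -
    have "finite J" using that I finite_subset by blast
    then show ?thesis using that
      by (induction J rule: finite_induct) (use C(1,2) s in \<open>auto simp: I_def\<close>)
  qed
  define b where "b i = (if i \<in> I then t ^ (m i - \<mu>) * (s' i * (\<Prod>k\<in>I - {i}. s k)) else 0)" for i
  have b: "(\<Prod>k\<in>I. s k) * a i = t ^ \<mu> * b i" if "i \<le> n" for i
  proof (cases "i \<in> I")
    case True
    have "(\<Prod>k\<in>I. s k) * a i = (s i * a i) * (\<Prod>k\<in>I - {i}. s k)"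
      using prod.remove[OF I(1) True, of s] by (simp add: mult_ac)
    also have "s i * a i = t ^ \<mu> * t ^ (m i - \<mu>) * s' i"
      using s[of i] True mu[OF True] by (simp add: I_def flip: power_add)
    finally show ?thesis using True by (simp add: b_def mult_ac)
  next
    case False
    then show ?thesis using that by (auto simp: b_def I_def)
  qed
  have "b i \<in> \<oo>" for i
    using s[of i] prod[of "I - {i}"] t(1) oD(2,6) is_subring_power[OF base_subring, of t]
    by (auto simp: b_def I_def)
  moreover have "b j \<notin> P"
  proof -
    have "b j = s' j * (\<Prod>k\<in>I - {j}. s k)" using j by (simp add: b_def)
    also have "\<dots> \<in> \<oo> - ?p" by (rule C(2)) (use s[of j] j prod[of "I - {j}"] in \<open>auto simp: I_def\<close>)
    finally show ?thesis by blast
  qed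
  moreover have "(\<Sum>i\<le>n. b i * x ^ i) = 0"
  proof -
    have "t ^ \<mu> * (\<Sum>i\<le>n. b i * x ^ i) = (\<Sum>i\<le>n. (\<Prod>k\<in>I. s k) * a i * x ^ i)"
      unfolding sum_distrib_left by (rule sum.cong) (use b in auto)
    also have "\<dots> = (\<Prod>k\<in>I. s k) * (\<Sum>i\<le>n. a i * x ^ i)" by (simp add: sum_distrib_left mult.assoc)
    finally show ?thesis using a(4) t(2) by simp
  qed
  moreover have "j \<le> n" using j by (simp add: I_def)
  ultimately show ?thesis using a(1) by blast
qed

text \<open>
  Horner's scheme for an equation with \<open>a j \<notin> P\<close> gives \<open>a j = b j - b (j + 1) * x\<close>, so that one of the
  two terms on the right is outside \<open>P\<close>. As all \<open>b i\<close> and \<open>b i * x\<close> are in \<open>\<OO>\<close>, either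
  \<open>x = (b j * x) / b j\<close> or \<open>inverse x = b (j + 1) / (b (j + 1) * x)\<close> is in the localization.
\<close>

lemma localization_valuation_ring:
  assumes P: "is_maximal \<OO> P" and t: "t \<in> P \<inter> \<oo>" "t \<noteq> 0" and u: "u \<in> \<oo> - P \<inter> \<oo>"
    and tu: "\<And>r. r \<in> P \<inter> \<oo> \<Longrightarrow> \<exists>w\<in>\<oo>. r * u = t * w"
  shows "x \<in> localization P \<or> inverse x \<in> localization P"
proof (cases "x = 0")
  case True
  then show ?thesis using localization_subring[OF P] OD(2) by blast
next
  case False
  obtain n a j where a: "0 < n" "\<And>i. a i \<in> \<oo>" "j \<le> n" "a j \<notin> P" "(\<Sum>i\<le>n. a i * x ^ i) = 0"
    using primitive_equation[OF P t u tu] by blast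
  define b where "b = (\<lambda>j. \<Sum>i=j..n. a i * x ^ (i - j))"
  have bO: "b k \<in> \<OO>" "b k * x \<in> \<OO>" for k
    unfolding b_def using horner_partial_sum_integral[OF base_subring a(2) a(1) a(5)] by auto
  have "b j = a j + b (Suc j) * x"
  proof -
    have "b j = a j + (\<Sum>i=Suc j..n. a i * x ^ (i - j))"
      unfolding b_def using a(3) by (simp add: sum.atLeast_Suc_atMost)
    also have "(\<Sum>i=Suc j..n. a i * x ^ (i - j)) = b (Suc j) * x"
      unfolding b_def sum_distrib_right
    proof (rule sum.cong)
      fix i assume "i \<in> {Suc j..n}"
      then have "i - j = Suc (i - Suc j)" by auto
      then show "a i * x ^ (i - j) = a i * x ^ (i - Suc j) * x" by (simp add: mult_ac)
    qed simp
    finally show ?thesis .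
  qed
  then have "b j \<notin> P \<or> b (Suc j) * x \<notin> P"
    using is_submodule_diff[OF OO_subring is_maximalD(2)[OF P], of "b j" "b (Suc j) * x"] a(4) by auto
  then show ?thesis
  proof
    assume bP: "b j \<notin> P"
    then have "x = (b j * x) / b j" using is_maximalD(5)[OF P] by auto
    then show ?thesis using localizationI[OF bO(2) bO(1) bP] by metis
  next
    assume bP: "b (Suc j) * x \<notin> P"
    then have "b (Suc j) \<noteq> 0" using is_maximalD(5)[OF P] by auto
    then have "inverse x = b (Suc j) / (b (Suc j) * x)" using False by (simp add: field_simps)
    then show ?thesis using localizationI[OF bO(1) bO(2) bP] by metis
  qed
qed

text \<open>
  In an equation for \<open>x\<close> two distinct terms have the same value: otherwise the term of least value
  would dominate the sum of the others. The quotient of these two terms is a power of \<open>x\<close> times a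
  quotient of coefficients, which is a power of \<open>t\<close> up to a unit.
\<close>

lemma unit_power:
  assumes P: "is_maximal \<OO> P" and t: "t \<in> P \<inter> \<oo>" "t \<noteq> 0" and u: "u \<in> \<oo> - P \<inter> \<oo>"
    and tu: "\<And>r. r \<in> P \<inter> \<oo> \<Longrightarrow> \<exists>w\<in>\<oo>. r * u = t * w" and x: "x \<noteq> 0"
  shows "\<exists>n k. 0 < n \<and> x ^ n / t powi k \<in> ring_units (localization P)"
proof -
  let ?B = "localization P"
  note B = localization_subring(1)[OF P] and V = localization_valuation_ring[OF P t u tu]
  note BD = is_subringD[OF B]
  obtain a n where a: "0 < n" "\<And>i. a i \<in> \<oo>" "a n \<noteq> 0" "(\<Sum>i\<le>n. a i * x ^ i) = 0"
    using algebraic_equation[of x] by metis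
  define I where "I = {i. i \<le> n \<and> a i \<noteq> 0}"
  have I: "finite I" "n \<in> I" using a by (auto simp: I_def)
  define y where "y i = a i * x ^ i" for i
  have y0: "y i \<noteq> 0" if "i \<in> I" for i using that x by (simp add: y_def I_def)
  have ysum: "(\<Sum>i\<in>I. y i) = 0"
  proof -
    have "(\<Sum>i\<in>I. y i) = (\<Sum>i\<le>n. y i)" by (rule sum.mono_neutral_left) (auto simp: I_def y_def)
    then show ?thesis using a(4) by (simp add: y_def)
  qed
  have "\<exists>i\<in>I. \<forall>j\<in>I. y i \<noteq> 0 \<and> y j / y i \<in> ?B \<or> y j = 0"
  proof (rule finite_total_preorder_least)
    show "finite I" "I \<noteq> {}" using I by auto
    fix i j k
    show "(y i \<noteq> 0 \<and> y j / y i \<in> ?B \<or> y j = 0) \<or> (y j \<noteq> 0 \<and> y i / y j \<in> ?B \<or> y i = 0)"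
      using V[of "y j / y i"] by auto
    show "y i \<noteq> 0 \<and> y k / y i \<in> ?B \<or> y k = 0"
      if "y i \<noteq> 0 \<and> y j / y i \<in> ?B \<or> y j = 0" "y j \<noteq> 0 \<and> y k / y j \<in> ?B \<or> y k = 0"
      using that BD(6)[of "y k / y j" "y j / y i"] by auto
  qed
  then obtain i where i: "i \<in> I" "\<And>j. j \<in> I \<Longrightarrow> y j / y i \<in> ?B" using y0 by blast
  have "\<exists>j\<in>I. j \<noteq> i \<and> y i / y j \<in> ?B"
  proof (rule ccontr)
    assume non: "\<not> (\<exists>j\<in>I. j \<noteq> i \<and> y i / y j \<in> ?B)"
    \<comment> \<open>the maximal ideal of the valuation ring; it would contain \<open>-1\<close>, the sum of the other terms\<close>
    define N where "N = {z \<in> ?B. z = 0 \<or> inverse z \<notin> ?B}"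
    have Nadd: "z + z' \<in> N" if z: "z \<in> N" "z' \<in> N" for z z'
    proof (cases "z = 0 \<or> z' = 0 \<or> z + z' = 0")
      case True
      then show ?thesis using z BD(2) by (auto simp: N_def)
    next
      case False
      have key: "inverse (z + z') \<notin> ?B" if zz: "z \<in> N" "z \<noteq> 0" "z + z' \<noteq> 0" "z' / z \<in> ?B" for z z'
      proof
        assume "inverse (z + z') \<in> ?B"
        then have "(1 + z' / z) * inverse (z + z') \<in> ?B" using BD(1,5,6) zz(4) by blast
        also have "(1 + z' / z) * inverse (z + z') = inverse z" using zz(2,3) by (simp add: field_simps)
        finally show False using zz(1,2) by (simp add: N_def)
      qed
      have "inverse (z + z') \<notin> ?B"
        using V[of "z' / z"] key[of z z'] key[of z' z] z False by (auto simp: add.commute)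
      then show ?thesis using z BD(5) by (auto simp: N_def)
    qed
    have Nsum: "sum f A \<in> N" if "\<And>j. j \<in> A \<Longrightarrow> f j \<in> N" for f and A :: "nat set"
      using that by (induction A rule: infinite_finite_induct) (use Nadd BD(2) in \<open>auto simp: N_def\<close>)
    have "(\<Sum>j\<in>I - {i}. y j / y i) \<in> N"
      by (rule Nsum) (use i non in \<open>auto simp: N_def\<close>)
    also have "(\<Sum>j\<in>I - {i}. y j / y i) = - 1"
    proof -
      have "(\<Sum>j\<in>I - {i}. y j) = - y i" using sum.remove[OF I(1) i(1), of y] ysum
        by (simp add: eq_neg_iff_add_eq_0 add.commute)
      then show ?thesis using y0[OF i(1)] by (simp flip: sum_divide_distrib)
    qed
    finally show False using BD(1) BD(4)[of 1] by (simp add: N_def)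
  qed
  then obtain j where j: "j \<in> I" "j \<noteq> i" "y i / y j \<in> ?B" by blast
  have base: "\<exists>m. a l / t ^ m \<in> ring_units ?B" if "l \<in> I" for l
    using base_unit_power[OF P t u tu, of "a l"] a(2) that by (simp add: I_def)
  have fin: ?thesis if ij: "i \<in> I" "j \<in> I" "i < j" "y j / y i \<in> ring_units ?B" for i j
  proof -
    obtain k l where kl: "a i / t ^ k \<in> ring_units ?B" "a j / t ^ l \<in> ring_units ?B" using base ij(1,2) by blast
    have "(y j / y i) * ((a i / t ^ k) / (a j / t ^ l)) \<in> ring_units ?B"
      using ring_units_mult[OF B] ring_units_divide[OF B] kl ij(4) by blast
    also have "(y j / y i) * ((a i / t ^ k) / (a j / t ^ l)) = x ^ (j - i) / t powi (int k - int l)"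
    proof -
      have "x ^ j = x ^ (j - i) * x ^ i" using ij(3) by (simp flip: power_add)
      then show ?thesis using ij(1,2) x t(2) by (simp add: y_def I_def power_int_diff field_simps)
    qed
    finally show ?thesis using ij(3) by (intro exI[of _ "j - i"] exI[of _ "int k - int l"]) auto
  qed
  have unit: "y j / y i \<in> ring_units ?B" "y i / y j \<in> ring_units ?B"
    using i(2)[OF j(1)] j(3) y0[OF i(1)] y0[OF j(1)] by (auto simp: ring_units_def)
  show ?thesis using fin[OF i(1) j(1) _ unit(1)] fin[OF j(1) i(1) _ unit(2)] j(2) by (meson nat_neq_iff)
qed

text \<open>
  The same \<open>t\<close> serves all \<open>P\<close> above \<open>p\<close>. This uniformity is what makes the normalization compatible with
  the topology: \<open>t\<close> has value 1 at all of these \<open>P\<close>.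
\<close>

lemma normalized_valuation_exists:
  assumes p: "is_maximal \<oo> p" "p \<noteq> {0}"
  shows "\<exists>t\<in>p. t \<noteq> 0 \<and>
    (\<forall>P. is_maximal \<OO> P \<longrightarrow> P \<inter> \<oo> = p \<longrightarrow> (\<exists>v. normalized_valuation \<oo> P v \<and> v t = 1))"
proof -
  obtain t u where t: "t \<in> p" and u: "u \<in> \<oo> - p" and tu: "\<And>r. r \<in> p \<Longrightarrow> \<exists>w\<in>\<oo>. r * u = t * w"
    using uniformizer[OF p] by blast
  have t0: "t \<noteq> 0"
  proof
    assume "t = 0"
    obtain r where "r \<in> p" "r \<noteq> 0" using p is_maximalD(5)[OF p(1)] by blast
    then show False using tu[of r] \<open>t = 0\<close> u is_maximalD(5)[OF p(1)] by auto
  qed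
  have "\<exists>v. normalized_valuation \<oo> P v \<and> v t = 1" if P: "is_maximal \<OO> P" and eq: "P \<inter> \<oo> = p" for P
  proof -
    let ?B = "localization P"
    have t': "t \<in> P \<inter> \<oo>" and u': "u \<in> \<oo> - P \<inter> \<oo>"
      and tu': "\<And>r. r \<in> P \<inter> \<oo> \<Longrightarrow> \<exists>w\<in>\<oo>. r * u = t * w" using t u tu eq by auto
    note B = localization_subring[OF P]
    have to: "t \<in> \<oo>" "t \<in> ?B" using t' B(2) base_subset_OO by auto
    have tn: "inverse t \<notin> ?B" using localization_nonunit[OF P _ t0] t' by blast
    from rank_one_valuation[OF B(1) localization_valuation_ring[OF P t' t0 u' tu'] to(2) t0 tn
        unit_power[OF P t' t0 u' tu']]
    obtain v where "additive_valuation v \<and> {x. 0 \<le> v x} = ?B \<and>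
      (\<forall>x n k. x \<noteq> 0 \<longrightarrow> 0 < n \<longrightarrow> x ^ n / t powi k \<in> ring_units ?B \<longrightarrow>
         v x = ereal (of_rat (of_int k / of_nat n)))" ..
    then have v: "additive_valuation v" "{x. 0 \<le> v x} = ?B"
      and vv: "\<And>x n k. x \<noteq> 0 \<Longrightarrow> 0 < n \<Longrightarrow> x ^ n / t powi k \<in> ring_units ?B \<Longrightarrow>
        v x = ereal (of_rat (of_int k / of_nat n))" by auto
    have vk: "v x = ereal (of_int k)" if "x \<noteq> 0" "x / t powi k \<in> ring_units ?B" for x k
      using vv[of x 1 k] that by simp
    have one: "1 \<in> ring_units ?B" using is_subringD(1)[OF B(1)] by (simp add: ring_units_def)
    have "v ` (K - {0}) = range (\<lambda>n::int. ereal (of_int n))"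
    proof (intro equalityI subsetI)
      fix z assume "z \<in> v ` (K - {0})"
      then obtain y where y: "z = v y" "y \<in> K - {0}" by (rule imageE)
      obtain a b where yab: "a \<in> \<oo>" "b \<in> \<oo>" "b \<noteq> 0" "y = a / b"
        using frac_fieldE[of y] y(2) by blast
      then have ab: "a \<in> \<oo>" "b \<in> \<oo>" "a \<noteq> 0" "b \<noteq> 0" "z = v (a / b)" using y by auto
      obtain n m where nm: "a / t ^ n \<in> ring_units ?B" "b / t ^ m \<in> ring_units ?B"
        using base_unit_power[OF P t' t0 u' tu'] ab(1-4) by metis
      have "(a / b) / t powi (int n - int m) = (a / t ^ n) / (b / t ^ m)"
        using t0 by (simp add: power_int_diff)
      then have "(a / b) / t powi (int n - int m) \<in> ring_units ?B" using ring_units_divide[OF B(1) nm] by simp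
      then have "z = ereal (of_int (int n - int m))" using vk[of "a / b"] ab by simp
      then show "z \<in> range (\<lambda>n::int. ereal (of_int n))" by blast
    next
      fix z assume "z \<in> range (\<lambda>n::int. ereal (of_int n))"
      then obtain k :: int where k: "z = ereal (of_int k)" by blast
      have "t \<in> K" "inverse t \<in> K"
        using frac_fieldI[of t 1] frac_fieldI[of 1 t] oD(1) to t0 by (auto simp: inverse_eq_divide)
      then have "t powi k \<in> K"
        using is_subring_power[OF frac_field_subring] by (simp add: power_int_def)
      moreover have "v (t powi k) = z" using vk[of "t powi k" k] t0 one k by simp
      ultimately show "z \<in> v ` (K - {0})" using t0 by (intro image_eqI[of _ _ "t powi k"]) auto
    qed
    then have "normalized_valuation \<oo> P v" using v unfolding normalized_valuation_def by simp
    moreover have "v t = 1" using vk[of t 1] t0 one by simp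
    ultimately show ?thesis by blast
  qed
  then show ?thesis using t t0 by blast
qed

abbreviation Sp :: "'a set set" where "Sp \<equiv> mSpec \<OO>"
abbreviation T :: "'a set topology" where "T \<equiv> mSpec_topology \<OO>"

lemma mSpec_iff: "P \<in> Sp \<longleftrightarrow> is_maximal \<OO> P"
  by (simp add: mSpec_def maximalideal_ring_on_iff[OF OO_subring])

lemma mSpec_prime: "P \<in> Sp \<Longrightarrow> is_prime \<OO> P"
  using is_maximal_prime[OF OO_subring] mSpec_iff by blast

lemma contraction_nonzero: "is_maximal \<OO> P \<Longrightarrow> P \<inter> \<oo> \<noteq> {0}"
  using maximal_nonzero by blast

lemma valuation_at_normalized:
  assumes "P \<in> Sp"
  shows "normalized_valuation \<oo> P (valuation_at \<oo> P)"
proof -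
  have P: "is_maximal \<OO> P" using assms mSpec_iff by simp
  obtain v where v: "normalized_valuation \<oo> P v"
    using normalized_valuation_exists[OF maximal_contraction[OF P] contraction_nonzero[OF P]] P by blast
  show ?thesis unfolding valuation_at_def
    by (rule theI[where P = "normalized_valuation \<oo> P", OF v]) (rule normalized_valuation_unique[OF _ v])
qed

definition rval :: "'a set \<Rightarrow> 'a \<Rightarrow> real" where
  "rval P x = real_of_ereal (valuation_at \<oo> P x)"

lemma valuation_at_additive:
  "P \<in> Sp \<Longrightarrow> additive_valuation (valuation_at \<oo> P)"
  using valuation_at_normalized unfolding normalized_valuation_def by blast

lemma valuation_at_rval:
  assumes "P \<in> Sp"
  shows "valuation_at \<oo> P x = (if x = 0 then \<infinity> else ereal (rval P x))"
  using additive_valuation_real(1)[OF valuation_at_additive[OF assms], of x]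
    valuation_at_additive[OF assms] by (auto simp: rval_def additive_valuation_def)

lemma rval_simps:
  assumes P: "P \<in> Sp"
  shows "x \<noteq> 0 \<Longrightarrow> y \<noteq> 0 \<Longrightarrow> rval P (x * y) = rval P x + rval P y"
    and "rval P 1 = 0"
    and "x \<noteq> 0 \<Longrightarrow> rval P (inverse x) = - rval P x"
    and "x \<noteq> 0 \<Longrightarrow> y \<noteq> 0 \<Longrightarrow> rval P (x / y) = rval P x - rval P y"
    and "x \<noteq> 0 \<Longrightarrow> rval P (x ^ n) = real n * rval P x"
    and "x \<noteq> 0 \<Longrightarrow> rval P (x powi k) = of_int k * rval P x"
  unfolding rval_def by (fact additive_valuation_real(3-8)[OF valuation_at_additive[OF P]])+

lemma rval_rational:
  assumes P: "P \<in> Sp" and x: "x \<noteq> 0"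
  obtains n k where "0 < n" "real n * rval P x = of_int k"
proof -
  have "rval P x \<in> \<rat>"
    unfolding rval_def by (rule additive_valuation_real(2)[OF valuation_at_additive[OF P] x])
  then obtain i j where j: "j > 0" "rval P x = of_int i / of_int j" using Rats_cases' by metis
  then have "real (nat j) * rval P x = of_int i" by simp
  then show thesis using that[of "nat j" i] j(1) by simp
qed

lemma rval_nonneg_iff:
  assumes P: "P \<in> Sp" and x: "x \<noteq> 0"
  shows "0 \<le> rval P x \<longleftrightarrow> x \<in> localization P"
proof -
  have "x \<in> localization P \<longleftrightarrow> 0 \<le> valuation_at \<oo> P x"
    using valuation_at_normalized[OF P] unfolding normalized_valuation_def by blast
  then show ?thesis using x by (simp add: valuation_at_rval[OF P])
qed

lemma rval_OO:
  assumes P: "P \<in> Sp" and x: "x \<in> \<OO>" "x \<noteq> 0"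
  shows "0 \<le> rval P x" and "x \<notin> P \<Longrightarrow> rval P x = 0" and "x \<in> P \<Longrightarrow> 0 < rval P x"
proof -
  have M: "is_maximal \<OO> P" using P mSpec_iff by simp
  show nn: "0 \<le> rval P x" using rval_nonneg_iff[OF P x(2)] localization_subring(2)[OF M] x by blast
  show "rval P x = 0" if "x \<notin> P"
  proof -
    have "inverse x \<in> localization P" using localization_unit[OF M x(1) that] by (simp add: ring_units_def)
    then show ?thesis using rval_nonneg_iff[OF P, of "inverse x"] rval_simps(3)[OF P x(2)] x nn by simp
  qed
  show "0 < rval P x" if "x \<in> P"
    using rval_nonneg_iff[OF P, of "inverse x"] rval_simps(3)[OF P x(2)] x localization_nonunit[OF M that x(2)]
    by simp
qed

lemma rval_uniformizer:
  assumes P: "P \<in> Sp"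
  obtains t where "t \<in> \<oo>" "t \<noteq> 0" "\<And>Q. Q \<in> Sp \<Longrightarrow> Q \<inter> \<oo> = P \<inter> \<oo> \<Longrightarrow> rval Q t = 1"
proof -
  have M: "is_maximal \<OO> P" using P mSpec_iff by simp
  obtain t where t: "t \<in> P \<inter> \<oo>" "t \<noteq> 0"
    and ex: "\<And>Q. is_maximal \<OO> Q \<Longrightarrow> Q \<inter> \<oo> = P \<inter> \<oo> \<Longrightarrow> \<exists>v. normalized_valuation \<oo> Q v \<and> v t = 1"
    using normalized_valuation_exists[OF maximal_contraction[OF M] contraction_nonzero[OF M]] by blast
  have "rval Q t = 1" if Q: "Q \<in> Sp" "Q \<inter> \<oo> = P \<inter> \<oo>" for Q
  proof -
    obtain v where v: "normalized_valuation \<oo> Q v" "v t = 1" using ex Q mSpec_iff by blast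
    have "valuation_at \<oo> Q = v" by (rule normalized_valuation_unique[OF valuation_at_normalized[OF Q(1)] v(1)])
    then show ?thesis using v(2) by (simp add: rval_def)
  qed
  then show thesis using that t by blast
qed

lemma rval_add:
  assumes P: "P \<in> Sp" and "x \<noteq> 0" "y \<noteq> 0" "x + y \<noteq> 0"
  shows "min (rval P x) (rval P y) \<le> rval P (x + y)"
proof -
  have "min (valuation_at \<oo> P x) (valuation_at \<oo> P y) \<le> valuation_at \<oo> P (x + y)"
    using valuation_at_additive[OF P] unfolding additive_valuation_def by blast
  then show ?thesis using assms by (auto simp: valuation_at_rval min_def split: if_splits)
qed

section \<open>The topology of the maximal spectrum\<close>

lemma openin_basic: "finite A \<Longrightarrow> A \<subseteq> \<OO> \<Longrightarrow> openin T (basic_open \<OO> A)"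
  unfolding openin_mSpec_topology by (rule union_of_inc) (auto simp: arbitrary_def)

lemma openin_mem: "a \<in> \<OO> \<Longrightarrow> openin T {P \<in> Sp. a \<in> P}"
  using openin_basic[of "{a}"] by (simp add: basic_open_def)

text \<open>
  If \<open>a \<notin> P\<close>, then \<open>1 = q + a r\<close> with \<open>q \<in> P\<close>, and \<open>q \<in> Q\<close> forces \<open>a \<notin> Q\<close>. Hence the topology is finer
  than the Zariski topology.
\<close>

lemma openin_notin:
  assumes a: "a \<in> \<OO>"
  shows "openin T {P \<in> Sp. a \<notin> P}"
proof (subst openin_subopen, intro ballI)
  fix P assume "P \<in> {P \<in> Sp. a \<notin> P}"
  then have P: "P \<in> Sp" "is_maximal \<OO> P" "a \<notin> P" using mSpec_iff by auto
  obtain r where r: "r \<in> \<OO>" "1 - a * r \<in> P" using is_maximalD(6)[OF P(2) a P(3)] by blast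
  let ?U = "{Q \<in> Sp. 1 - a * r \<in> Q}"
  have "openin T ?U" by (rule openin_mem) (use r is_maximalD(4)[OF P(2)] in blast)
  moreover have "?U \<subseteq> {P \<in> Sp. a \<notin> P}"
  proof (intro subsetI CollectI conjI notI)
    fix Q assume Q: "Q \<in> ?U"
    then show "Q \<in> Sp" by simp
    assume aQ: "a \<in> Q"
    have M: "is_maximal \<OO> Q" using Q mSpec_iff by simp
    have "(1 - a * r) + r * a \<in> Q" using is_submoduleD[OF is_maximalD(2)[OF M]] aQ r(1) Q by blast
    then show False using is_maximalD(3)[OF M] by (simp add: mult.commute)
  qed
  ultimately show "\<exists>V. openin T V \<and> P \<in> V \<and> V \<subseteq> {P \<in> Sp. a \<notin> P}" using P(1) r(2) by blast
qed

text \<open>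
  The denominator of a representation of \<open>y\<close> in the localization at \<open>P\<close> stays outside all nearby \<open>Q\<close>.
\<close>

lemma openin_rval_nonneg:
  assumes y: "y \<noteq> 0"
  shows "openin T {P \<in> Sp. 0 \<le> rval P y}"
proof (subst openin_subopen, intro ballI)
  fix P assume "P \<in> {P \<in> Sp. 0 \<le> rval P y}"
  then have P: "P \<in> Sp" "y \<in> localization P" using rval_nonneg_iff y by auto
  then obtain a b where ab: "a \<in> \<OO>" "b \<in> \<OO>" "b \<notin> P" "y = a / b" unfolding localization_at_def by blast
  have "{Q \<in> Sp. b \<notin> Q} \<subseteq> {P \<in> Sp. 0 \<le> rval P y}"
    using rval_nonneg_iff[OF _ y] localizationI[OF ab(1,2)] ab(4) by auto
  then show "\<exists>V. openin T V \<and> P \<in> V \<and> V \<subseteq> {P \<in> Sp. 0 \<le> rval P y}"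
    using openin_notin[OF ab(2)] P(1) ab(3) by blast
qed

text \<open>
  Let \<open>n\<close> times the value of \<open>x\<close> be \<open>k\<close>, and let \<open>t\<close> be a uniformizer of \<open>P \<inter> \<oo>\<close>. Then \<open>x ^ n / t powi k\<close>
  is a unit at \<open>P\<close> and therefore at all nearby \<open>Q\<close>. As \<open>P \<inter> \<oo>\<close> is finitely generated, all nearby \<open>Q\<close> have
  the same intersection with \<open>\<oo>\<close>, so that \<open>t\<close> has value 1 there as well.
\<close>

lemma rval_locally_constant:
  assumes P: "P \<in> Sp" and x: "x \<noteq> 0"
  obtains U where "openin T U" "P \<in> U" "\<And>Q. Q \<in> U \<Longrightarrow> rval Q x = rval P x"
proof -
  have M: "is_maximal \<OO> P" using P mSpec_iff by simp
  obtain n k where n: "0 < n" "real n * rval P x = of_int k" by (rule rval_rational[OF P x])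
  obtain t where t: "t \<in> \<oo>" "t \<noteq> 0" "\<And>Q. Q \<in> Sp \<Longrightarrow> Q \<inter> \<oo> = P \<inter> \<oo> \<Longrightarrow> rval Q t = 1"
    by (rule rval_uniformizer[OF P]) blast
  \<comment> \<open>a unit at \<open>P\<close>, hence at every \<open>Q\<close> near \<open>P\<close>\<close>
  define y where "y = x ^ n / t powi k"
  have y0: "y \<noteq> 0" using x t by (simp add: y_def)
  have yQ: "rval Q y = real n * rval Q x - of_int k" if Q: "Q \<in> Sp" "Q \<inter> \<oo> = P \<inter> \<oo>" for Q
    using rval_simps(4)[OF Q(1), of "x ^ n" "t powi k"] rval_simps(5)[OF Q(1) x, of n]
      rval_simps(6)[OF Q(1) t(2), of k] t(3)[OF Q] x t(2) by (simp add: y_def)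
  obtain A where A: "finite A" "A \<subseteq> P \<inter> \<oo>" "\<And>J. is_ideal \<oo> J \<Longrightarrow> A \<subseteq> J \<Longrightarrow> P \<inter> \<oo> \<subseteq> J"
    using noetherian_finitely_generated[OF base_subring base_noetherian is_maximalD(1)[OF maximal_contraction[OF M]]]
    by blast
  define U where "U = basic_open \<OO> A \<inter> ({Q \<in> Sp. 0 \<le> rval Q y} \<inter> {Q \<in> Sp. 0 \<le> rval Q (inverse y)})"
  have "openin T U" unfolding U_def
    by (intro openin_Int openin_basic openin_rval_nonneg) (use A(1,2) base_subset_OO y0 in auto)
  moreover have "P \<in> U"
    using P A(2) yQ[OF P refl] n(2) rval_simps(3)[OF P y0] by (auto simp: U_def basic_open_def)
  moreover have "rval Q x = rval P x" if "Q \<in> U" for Q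
  proof -
    have Q: "Q \<in> Sp" "A \<subseteq> Q" and nn: "0 \<le> rval Q y" "0 \<le> rval Q (inverse y)"
      using that by (auto simp: U_def basic_open_def)
    have MQ: "is_maximal \<OO> Q" using Q mSpec_iff by simp
    have "P \<inter> \<oo> \<subseteq> Q \<inter> \<oo>"
      by (rule A(3)) (use is_maximalD(1)[OF maximal_contraction[OF MQ]] A(2) Q in auto)
    then have eq: "Q \<inter> \<oo> = P \<inter> \<oo>"
      using maximal_mono_eq[OF maximal_contraction[OF M] maximal_contraction[OF MQ]] by simp
    have "rval Q y = 0" using nn rval_simps(3)[OF Q(1) y0] by simp
    then have "real n * rval Q x = real n * rval P x" using yQ[OF Q(1) eq] n(2) by simp
    then show ?thesis using n(1) by simp
  qed
  ultimately show thesis using that by blast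
qed

lemma openin_rval:
  assumes x: "x \<noteq> 0"
  shows "openin T {P \<in> Sp. R (rval P x)}"
proof (subst openin_subopen, intro ballI)
  fix P assume P: "P \<in> {P \<in> Sp. R (rval P x)}"
  then obtain U where U: "openin T U" "P \<in> U" "\<And>Q. Q \<in> U \<Longrightarrow> rval Q x = rval P x"
    using rval_locally_constant[OF _ x] by blast
  have "U \<subseteq> Sp" using openin_subset[OF U(1)] by simp
  then have "U \<subseteq> {P \<in> Sp. R (rval P x)}" using U(3) P by auto
  then show "\<exists>V. openin T V \<and> P \<in> V \<and> V \<subseteq> {P \<in> Sp. R (rval P x)}" using U by blast
qed

text \<open>
  By the Alexander subbase theorem it suffices to consider covers by sets \<open>{P. a \<in> P}\<close> with \<open>a\<close> in some
  set \<open>S\<close>. If no product of elements of \<open>S\<close> were a multiple of \<open>n\<close>, there would be a prime ideal containing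
  \<open>n\<close> and disjoint from \<open>S\<close>; it is maximal and not covered. If on the other hand a product of finitely
  many elements of \<open>S\<close> is a multiple of \<open>n\<close>, the sets belonging to these elements form a cover.
\<close>

lemma compactin_basic:
  assumes n: "n \<in> \<OO>" "n \<noteq> 0"
  shows "compactin T {P \<in> Sp. n \<in> P}"
proof -
  let ?D = "\<lambda>a. {P \<in> Sp. a \<in> P}"
  define \<S> where "\<S> = ?D ` \<OO>"
  define G where "G = topology (arbitrary union_of (finite intersection_of (\<lambda>V. V \<in> \<S>) relative_to ?D n))"
  have opG: "openin G = arbitrary union_of (finite intersection_of (\<lambda>V. V \<in> \<S>) relative_to ?D n)"
    unfolding G_def by (rule topology_inverse'[OF istopology_subbase])
  have "compact_space G"
  proof (rule Alexander_subbase_alt[where U = "?D n" and \<B> = \<S>])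
    show "?D n \<subseteq> \<Union>\<S>" using n by (auto simp: \<S>_def)
    show "topology (arbitrary union_of (finite intersection_of (\<lambda>V. V \<in> \<S>) relative_to ?D n)) = G"
      by (simp add: G_def)
    fix C assume C: "C \<subseteq> \<S>" "?D n \<subseteq> \<Union>C"
    define S where "S = {a \<in> \<OO>. ?D a \<in> C}"
    \<comment> \<open>a prime ideal avoiding \<open>M\<close> lies in no member of \<open>C\<close>\<close>
    define M where "M = {prod_list xs | xs. set xs \<subseteq> S}"
    have SM: "S \<subseteq> M"
    proof
      fix a assume "a \<in> S"
      moreover have "a = prod_list [a]" by simp
      ultimately show "a \<in> M" unfolding M_def by (intro CollectI exI[of _ "[a]"]) auto
    qed
    have MO: "M \<subseteq> \<OO>"
    proof
      fix m assume "m \<in> M"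
      then obtain xs where "m = prod_list xs" "set xs \<subseteq> S" unfolding M_def by blast
      moreover have "prod_list xs \<in> \<OO>" if "set xs \<subseteq> S" for xs
        using that by (induction xs) (use OD(1,6) in \<open>auto simp: S_def\<close>)
      ultimately show "m \<in> \<OO>" by simp
    qed
    have M1: "1 \<in> M" unfolding M_def by (intro CollectI exI[of _ "[]"]) simp
    have Mm: "x * y \<in> M" if xy: "x \<in> M" "y \<in> M" for x y
    proof -
      obtain xs ys where 1: "x = prod_list xs" "set xs \<subseteq> S" "y = prod_list ys" "set ys \<subseteq> S"
        using xy unfolding M_def by blast
      then have "x * y = prod_list (xs @ ys)" by simp
      moreover have "set (xs @ ys) \<subseteq> S" using 1 by simp
      ultimately show ?thesis unfolding M_def by blast
    qed
    let ?J = "{p + n * y | p y. p \<in> {0} \<and> y \<in> \<OO>}"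
    have zero: "is_ideal \<OO> {0}" using OD(2) by (auto simp: is_ideal_def is_submodule_def)
    note J = ideal_adjoin[OF OO_subring zero n(1)]
    have "?J \<inter> M \<noteq> {}"
    proof
      assume "?J \<inter> M = {}"
      then obtain P where P: "is_prime \<OO> P" "?J \<subseteq> P" "P \<inter> M = {}"
        using prime_avoiding[OF OO_subring J(1) M1 MO Mm] by blast
      have nP: "n \<in> P" using J(3) P(2) by blast
      then have "P \<in> ?D n" using OO_prime_maximal[OF P(1)] n(2) mSpec_iff by blast
      then obtain V where V: "V \<in> C" "P \<in> V" using C(2) by blast
      then obtain a where a: "a \<in> \<OO>" "V = ?D a" using C(1) by (auto simp: \<S>_def)
      then have "a \<in> M" using V SM by (auto simp: S_def)
      moreover have "a \<in> P" using V(2) a(2) by simp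
      ultimately show False using P(3) by blast
    qed
    then obtain m where m: "m \<in> ?J" "m \<in> M" by blast
    obtain xs where xs1: "m = prod_list xs" "set xs \<subseteq> S" using m(2) unfolding M_def by blast
    obtain y where y: "m = n * y" "y \<in> \<OO>" using m(1) by auto
    have xs: "set xs \<subseteq> S" "y \<in> \<OO>" "prod_list xs = n * y" using xs1 y by auto
    have "?D n \<subseteq> \<Union>(?D ` set xs)"
    proof
      fix P assume P: "P \<in> ?D n"
      then have "is_maximal \<OO> P" using mSpec_iff by simp
      then have "prod_list xs \<in> P"
        using is_submoduleD(3)[OF is_maximalD(2), of \<OO> P y n] P xs(2,3) by (simp add: mult.commute)
      then obtain a where "a \<in> set xs" "a \<in> P"
        using is_prime_prod_list[OF mSpec_prime OO_subring, of P xs] P xs(1) by (auto simp: S_def)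
      then show "P \<in> \<Union>(?D ` set xs)" using P by blast
    qed
    moreover have "?D ` set xs \<subseteq> C" using xs(1) by (auto simp: S_def)
    ultimately show "\<exists>C'. finite C' \<and> C' \<subseteq> C \<and> ?D n \<subseteq> \<Union>C'" by blast
  qed
  moreover have topG: "topspace G = ?D n"
    unfolding G_def by (rule topspace_subbase)
  ultimately have cG: "compactin G (?D n)" by (simp add: compact_space_def)
  have "continuous_map G T id"
  proof (rule continuous_map_into_topology_base[OF openin_mSpec_topology])
    show "id x \<in> topspace T" if "x \<in> topspace G" for x using that topG by simp
    fix V assume "\<exists>A. finite A \<and> A \<subseteq> \<OO> \<and> V = basic_open \<OO> A"
    then obtain A where A: "finite A" "A \<subseteq> \<OO>" "V = basic_open \<OO> A" by blast
    let ?W = "{x \<in> topspace G. id x \<in> V}"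
    have W: "?W = ?D n \<inter> \<Inter>(?D ` insert n A)" unfolding topG A(3) by (auto simp: basic_open_def)
    have "(finite intersection_of (\<lambda>V. V \<in> \<S>)) (\<Inter>(?D ` insert n A))"
      unfolding intersection_of_def using A(1,2) n(1) by (intro exI[of _ "?D ` insert n A"]) (auto simp: \<S>_def)
    then have "(finite intersection_of (\<lambda>V. V \<in> \<S>) relative_to ?D n) ?W"
      unfolding W by (rule relative_to_inc)
    then show "openin G ?W" unfolding opG by (intro union_of_inc) (auto simp: arbitrary_def)
  qed
  from image_compactin[OF cG this] show ?thesis by simp
qed

lemma compact_local_finite:
  assumes Y: "compactin T Y" and g: "\<And>P. P \<in> Y \<Longrightarrow> openin T (g P) \<and> P \<in> g P"
  obtains F where "finite F" "F \<subseteq> Y" "Y \<subseteq> (\<Union>P\<in>F. g P)"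
proof -
  have "\<exists>\<F>. finite \<F> \<and> \<F> \<subseteq> g ` Y \<and> Y \<subseteq> \<Union>\<F>"
    by (rule compactinD[OF Y]) (use g in auto)
  then obtain \<F> where F: "finite \<F>" "\<F> \<subseteq> g ` Y" "Y \<subseteq> \<Union>\<F>" by blast
  then obtain F where "finite F" "F \<subseteq> Y" "\<F> = g ` F" using finite_subset_image[OF F(1,2)] by blast
  then show thesis using that F(3) by blast
qed

lemma rval_bounded:
  assumes x: "x \<in> \<OO>" "x \<noteq> 0"
  obtains B where "\<And>P. P \<in> Sp \<Longrightarrow> rval P x \<le> B"
proof -
  let ?Y = "{P \<in> Sp. x \<in> P}"
  let ?g = "\<lambda>P. {Q \<in> Sp. rval Q x = rval P x}"
  have g: "openin T (?g P) \<and> P \<in> ?g P" if "P \<in> ?Y" for P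
    using openin_rval[OF x(2), of "\<lambda>r. r = rval P x"] that by simp
  obtain F where F: "finite F" "F \<subseteq> ?Y" "?Y \<subseteq> (\<Union>P\<in>F. ?g P)"
    by (rule compact_local_finite[OF compactin_basic[OF x], of ?g, OF g])
  have "rval Q x \<le> Max (insert 0 ((\<lambda>P. rval P x) ` F))" if Q: "Q \<in> Sp" for Q
  proof (cases "x \<in> Q")
    case True
    then have "rval Q x \<in> (\<lambda>P. rval P x) ` F" using F(3) Q by blast
    then show ?thesis using F(1) by (intro Max_ge) auto
  next
    case False
    then show ?thesis using rval_OO(2)[OF Q x] F(1) by simp
  qed
  then show thesis using that by blast
qed

lemma compact_common_element:
  assumes Y: "compactin T Y"
  obtains n where "n \<in> \<oo>" "n \<noteq> 0" "\<And>P. P \<in> Y \<Longrightarrow> n \<in> P"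
proof -
  have YS: "Y \<subseteq> Sp" using compactin_subset_topspace[OF Y] by simp
  have "\<exists>m\<in>P \<inter> \<oo>. m \<noteq> 0" if "P \<in> Y" for P using maximal_nonzero that YS mSpec_iff by blast
  then obtain m where m: "\<And>P. P \<in> Y \<Longrightarrow> m P \<in> P \<and> m P \<in> \<oo> \<and> m P \<noteq> 0" by (metis IntE)
  let ?g = "\<lambda>P. {Q \<in> Sp. m P \<in> Q}"
  have g: "openin T (?g P) \<and> P \<in> ?g P" if "P \<in> Y" for P
  proof -
    have "m P \<in> \<OO>" "P \<in> Sp" using m[OF that] base_subset_OO YS that by auto
    then show ?thesis using openin_mem[of "m P"] m[OF that] by simp
  qed
  obtain F where F: "finite F" "F \<subseteq> Y" "Y \<subseteq> (\<Union>P\<in>F. ?g P)"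
    by (rule compact_local_finite[OF Y, of ?g, OF g])
  have "(\<Prod>P\<in>F. m P) \<in> \<oo>" by (rule is_subring_prod[OF base_subring]) (use m F in blast)
  moreover have "(\<Prod>P\<in>F. m P) \<noteq> 0" using m F by auto
  moreover have "(\<Prod>P\<in>F. m P) \<in> Q" if "Q \<in> Y" for Q
  proof -
    obtain P where P: "P \<in> F" "m P \<in> Q" using F(3) \<open>Q \<in> Y\<close> by blast
    have M: "is_maximal \<OO> Q" using \<open>Q \<in> Y\<close> YS mSpec_iff by blast
    have "(\<Prod>P\<in>F - {P}. m P) \<in> \<OO>"
      by (rule is_subring_prod[OF OO_subring]) (use m F base_subset_OO in blast)
    then have "(\<Prod>P\<in>F - {P}. m P) * m P \<in> Q"
      by (rule is_submoduleD(3)[OF is_maximalD(2)[OF M] _ P(2)])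
    then show ?thesis using prod.remove[OF F(1) P(1), of m] by (simp add: mult.commute)
  qed
  ultimately show thesis using that by blast
qed

text \<open>
  Any \<open>P\<close> outside \<open>W\<close> contains an element that is not in \<open>P0\<close>, and a high power of it dominates \<open>d\<close> at
  \<open>P\<close>, hence near \<open>P\<close>. Only the \<open>P\<close> that contain \<open>d\<close> matter; those outside \<open>W\<close> form a compact set, so the
  product of finitely many of these powers dominates \<open>d\<close> at all of them.
\<close>

lemma separating_element:
  assumes P0: "P0 \<in> Sp" and W: "openin T W" "P0 \<in> W" and d: "d \<in> \<OO>" "d \<noteq> 0"
  obtains z where "z \<in> \<OO>" "z \<notin> P0" "\<And>P. P \<in> Sp \<Longrightarrow> P \<notin> W \<Longrightarrow> rval P d \<le> rval P z"
proof -
  have M0: "is_maximal \<OO> P0" using P0 mSpec_iff by simp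
  let ?Y = "{P \<in> Sp. d \<in> P} \<inter> (Sp - W)"
  have "closedin T (Sp - W)" using W(1) by (metis closedin_diff closedin_topspace topspace_mSpec_topology)
  then have Y: "compactin T ?Y" by (rule compact_Int_closedin[OF compactin_basic[OF d]])
  have "\<exists>z k. z \<in> P \<and> z \<notin> P0 \<and> rval P d \<le> rval P (z ^ k)" if P: "P \<in> ?Y" for P
  proof -
    have M: "is_maximal \<OO> P" using P mSpec_iff by simp
    have "P \<noteq> P0" using P W(2) by blast
    then obtain z where z: "z \<in> P" "z \<notin> P0" using maximal_mono_eq[OF M M0] by blast
    have z0: "z \<noteq> 0" using z(2) is_maximalD(5)[OF M0] by auto
    have "0 < rval P z" using rval_OO(3)[of P z] P z z0 is_maximalD(4)[OF M] by blast
    then obtain k :: nat where "rval P d < real k * rval P z" using reals_Archimedean3 by blast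
    then show ?thesis using z rval_simps(5)[of P z k] z0 P by (intro exI[of _ z] exI[of _ k]) auto
  qed
  then obtain z k where z: "\<And>P. P \<in> ?Y \<Longrightarrow> z P \<in> P \<and> z P \<notin> P0 \<and> rval P d \<le> rval P (z P ^ k P)" by metis
  define c where "c P = z P ^ k P" for P
  have cO: "c P \<in> \<OO>" and cP0: "c P \<notin> P0" and c0: "c P \<noteq> 0" and cd: "rval P d \<le> rval P (c P)" if P: "P \<in> ?Y" for P
  proof -
    have "z P \<in> \<OO>" using z[OF P] P mSpec_iff is_maximalD(4) by blast
    then show "c P \<in> \<OO>" unfolding c_def by (rule is_subring_power[OF OO_subring])
    show "c P \<notin> P0" unfolding c_def
      using is_prime_power[OF OO_subring mSpec_prime[OF P0] \<open>z P \<in> \<OO>\<close>] z[OF P] by blast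
    then show "c P \<noteq> 0" using is_maximalD(5)[OF M0] by auto
    show "rval P d \<le> rval P (c P)" unfolding c_def using z[OF P] by blast
  qed
  let ?g = "\<lambda>P. {Q \<in> Sp. 0 \<le> rval Q (c P / d)}"
  have g: "openin T (?g P) \<and> P \<in> ?g P" if P: "P \<in> ?Y" for P
    using openin_rval_nonneg[of "c P / d"] c0[OF P] d(2) cd[OF P] rval_simps(4)[of P "c P" d] P by simp
  obtain F where F: "finite F" "F \<subseteq> ?Y" "?Y \<subseteq> (\<Union>P\<in>F. ?g P)"
    by (rule compact_local_finite[OF Y, of ?g, OF g])
  define Z where "Z = (\<Prod>P\<in>F. c P)"
  have FO: "\<And>P. P \<in> F \<Longrightarrow> c P \<in> \<OO>" "\<And>P. P \<in> F \<Longrightarrow> c P \<notin> P0" "\<And>P. P \<in> F \<Longrightarrow> c P \<noteq> 0"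
    using F(2) cO cP0 c0 by blast+
  have ZO: "Z \<in> \<OO>" unfolding Z_def by (rule is_subring_prod[OF OO_subring FO(1)])
  have ZP0: "Z \<notin> P0" unfolding Z_def using F(1) FO(1,2)
  proof (induction F rule: finite_induct)
    case empty
    then show ?case using is_maximalD(3)[OF M0] by simp
  next
    case (insert P G)
    have "(\<Prod>P\<in>G. c P) \<in> \<OO>" by (rule is_subring_prod[OF OO_subring]) (use insert.prems in blast)
    then show ?case using insert mSpec_prime[OF P0] unfolding is_prime_def by auto
  qed
  then have Z0: "Z \<noteq> 0" using is_maximalD(5)[OF M0] by auto
  have "rval Q d \<le> rval Q Z" if Q: "Q \<in> Sp" "Q \<notin> W" for Q
  proof (cases "d \<in> Q")
    case False
    then show ?thesis using rval_OO(2)[OF Q(1) d] rval_OO(1)[OF Q(1) ZO Z0] by simp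
  next
    case True
    then obtain P where P: "P \<in> F" "0 \<le> rval Q (c P / d)" using F(3) Q by blast
    let ?R = "\<Prod>P\<in>F - {P}. c P"
    have R: "?R \<in> \<OO>" by (rule is_subring_prod[OF OO_subring]) (use FO(1) in blast)
    have Zeq: "Z = c P * ?R" unfolding Z_def by (rule prod.remove[OF F(1) P(1)])
    then have R0: "?R \<noteq> 0" using Z0 by auto
    have "rval Q Z = rval Q (c P) + rval Q ?R" unfolding Zeq by (rule rval_simps(1)[OF Q(1) FO(3)[OF P(1)] R0])
    then show ?thesis
      using P(2) rval_simps(4)[OF Q(1) FO(3)[OF P(1)] d(2)] rval_OO(1)[OF Q(1) R R0] by simp
  qed
  then show thesis using that ZO ZP0 by blast
qed

section \<open>The function of a fractional ideal\<close>

abbreviation fracid :: "'a set \<Rightarrow> bool" where "fracid \<equiv> fractional_ideal \<OO>"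

lemma fracid_iff:
  "fracid I \<longleftrightarrow> is_submodule \<OO> I \<and> I \<noteq> {0} \<and> (\<exists>d. d \<noteq> 0 \<and> (\<forall>x\<in>I. d * x \<in> \<OO>))"
proof -
  have "additive_subgroup I ambient \<and> (\<forall>r\<in>\<OO>. \<forall>x\<in>I. r * x \<in> I) \<longleftrightarrow> is_submodule \<OO> I" (is "?l \<longleftrightarrow> ?r")
  proof
    assume l: ?l
    then have "subgroup I (add_monoid ambient)" by (simp add: additive_subgroup_def)
    then show ?r
      using l subgroup.m_closed[of I "add_monoid ambient"] subgroup.one_closed[of I "add_monoid ambient"]
      by (simp add: is_submodule_def)
  next
    assume r: ?r
    have "subgroup I (add_monoid ambient)"
    proof
      show "I \<subseteq> carrier (add_monoid ambient)" by simp
      show "x \<otimes>\<^bsub>add_monoid ambient\<^esub> y \<in> I" if "x \<in> I" "y \<in> I" for x y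
        using is_submoduleD(2)[OF r] that by simp
      show "\<one>\<^bsub>add_monoid ambient\<^esub> \<in> I" using is_submoduleD(1)[OF r] by simp
      show "inv\<^bsub>add_monoid ambient\<^esub> x \<in> I" if "x \<in> I" for x
        unfolding ambient_inv_add by (rule is_submodule_uminus[OF OO_subring r that])
    qed
    then show ?l using r by (simp add: additive_subgroup_def is_submodule_def)
  qed
  then show ?thesis unfolding fractional_ideal_def by blast
qed

lemma fracidD:
  assumes "fracid I"
  shows "is_submodule \<OO> I" and "\<exists>x\<in>I. x \<noteq> 0"
    and "\<exists>e\<in>\<OO>. e \<noteq> 0 \<and> (\<forall>x\<in>I. e * x \<in> \<OO>)"
proof -
  show M: "is_submodule \<OO> I" using assms fracid_iff by blast
  show "\<exists>x\<in>I. x \<noteq> 0" using assms is_submoduleD(1)[OF M] unfolding fracid_iff by blast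
  obtain d where d: "d \<noteq> 0" "\<And>x. x \<in> I \<Longrightarrow> d * x \<in> \<OO>" using assms unfolding fracid_iff by blast
  obtain n where n: "n \<in> \<oo>" "n \<noteq> 0" "n * d \<in> \<OO>" using OO_denominator[of d] by blast
  have "n * d * x \<in> \<OO>" if "x \<in> I" for x
    using OD(6)[of n "d * x"] n(1) base_subset_OO d(2)[OF that] by (auto simp: mult.assoc)
  then show "\<exists>e\<in>\<OO>. e \<noteq> 0 \<and> (\<forall>x\<in>I. e * x \<in> \<OO>)" using n d(1) by (intro bexI[of _ "n * d"]) auto
qed

lemma fracid_OO: "fracid \<OO>"
  unfolding fracid_iff is_submodule_def using OD(1,2,5,6) by (auto intro!: exI[of _ 1])

lemma ideal_prod_submodule:
  assumes M: "is_submodule \<OO> I" and N: "is_submodule \<OO> J"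
  shows "is_submodule \<OO> (iprod I J)"
  unfolding is_submodule_def
proof (intro conjI ballI)
  show "0 \<in> iprod I J"
    using ideal_prod.prod[of 0 I 0 J ambient] is_submoduleD(1)[OF M] is_submoduleD(1)[OF N] by simp
  show "x + y \<in> iprod I J" if "x \<in> iprod I J" "y \<in> iprod I J" for x y
    using ideal_prod.sum[OF that] by simp
  show "r * x \<in> iprod I J" if r: "r \<in> \<OO>" and x: "x \<in> iprod I J" for r x
    using x
  proof (induction rule: ideal_prod.induct)
    case (prod i j)
    have "(r * i) \<otimes>\<^bsub>ambient\<^esub> j \<in> iprod I J"
      by (rule ideal_prod.prod[OF is_submoduleD(3)[OF M r prod(1)] prod(2)])
    then show ?case by (simp add: mult.assoc)
  next
    case (sum s1 s2)
    then show ?case using ideal_prod.sum[OF sum.IH] by (simp add: distrib_left)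
  qed
qed

lemma ideal_prod_fracid:
  assumes I: "fracid I" and J: "fracid J"
  shows "fracid (iprod I J)"
proof -
  obtain e e' where e: "e \<in> \<OO>" "e \<noteq> 0" "\<And>x. x \<in> I \<Longrightarrow> e * x \<in> \<OO>"
    and e': "e' \<in> \<OO>" "e' \<noteq> 0" "\<And>x. x \<in> J \<Longrightarrow> e' * x \<in> \<OO>"
    using fracidD(3)[OF I] fracidD(3)[OF J] by blast
  have "e * e' * z \<in> \<OO>" if "z \<in> iprod I J" for z
    using that
  proof (induction rule: ideal_prod.induct)
    case (prod i j)
    have "(e * i) * (e' * j) \<in> \<OO>" by (rule OD(6)[OF e(3)[OF prod(1)] e'(3)[OF prod(2)]])
    then show ?case by (simp add: mult_ac)
  next
    case (sum s1 s2)
    then show ?case using OD(5)[OF sum.IH] by (simp add: distrib_left)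
  qed
  moreover obtain x y where "x \<in> I" "x \<noteq> 0" "y \<in> J" "y \<noteq> 0" using fracidD(2)[OF I] fracidD(2)[OF J] by blast
  then have "x * y \<in> iprod I J" "x * y \<noteq> 0" using ideal_prod.prod[of x I y J ambient] by auto
  ultimately show ?thesis
    unfolding fracid_iff using ideal_prod_submodule[OF fracidD(1)[OF I] fracidD(1)[OF J]] e(2) e'(2)
    by (metis mult_eq_0_iff singletonD)
qed

lemma ideal_prod_rval:
  assumes P: "P \<in> Sp" and z: "z \<in> iprod I J" "z \<noteq> 0"
  shows "\<exists>x\<in>I. \<exists>y\<in>J. x \<noteq> 0 \<and> y \<noteq> 0 \<and> rval P x + rval P y \<le> rval P z"
    (is "?Q (rval P z)")
  using z
proof (induction rule: ideal_prod.induct)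
  case (prod i j)
  then show ?case using rval_simps(1)[OF P, of i j] by (intro bexI[of _ i] bexI[of _ j]) auto
next
  case (sum s1 s2)
  show ?case
  proof (cases "s1 = 0 \<or> s2 = 0")
    case True
    then show ?thesis using sum by auto
  next
    case False
    then have "min (rval P s1) (rval P s2) \<le> rval P (s1 + s2)" using rval_add[OF P] sum.prems by simp
    then have "rval P s1 \<le> rval P (s1 + s2) \<or> rval P s2 \<le> rval P (s1 + s2)" by (auto simp: min_def split: if_splits)
    moreover have mono: "?Q (rval P (s1 + s2))" if "?Q c" "c \<le> rval P (s1 + s2)" for c
      using that order_trans by blast
    moreover have "?Q (rval P s1)" "?Q (rval P s2)" using sum.IH False by auto
    ultimately have "?Q (rval P (s1 + s2))" by blast
    then show ?thesis by simp
  qed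
qed

lemma fracid_rval_lower:
  assumes I: "fracid I"
  obtains e where "e \<in> \<OO>" "e \<noteq> 0" "\<And>x. x \<in> I \<Longrightarrow> e * x \<in> \<OO>"
    "\<And>P x. P \<in> Sp \<Longrightarrow> x \<in> I \<Longrightarrow> x \<noteq> 0 \<Longrightarrow> - rval P e \<le> rval P x"
proof -
  obtain e where e: "e \<in> \<OO>" "e \<noteq> 0" "\<And>x. x \<in> I \<Longrightarrow> e * x \<in> \<OO>" using fracidD(3)[OF I] by blast
  have "- rval P e \<le> rval P x" if P: "P \<in> Sp" and x: "x \<in> I" "x \<noteq> 0" for P x
    using rval_OO(1)[OF P e(3)[OF x(1)]] rval_simps(1)[OF P e(2) x(2)] e(2) x(2) by simp
  then show thesis using that e by blast
qed

lemma F_tilde_eq: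
  assumes I: "fracid I" and P: "P \<in> Sp"
  defines "R \<equiv> rval P ` (I - {0})"
  shows "Ft I P = TReal (Inf R) (Inf R \<notin> R)" and "R \<noteq> {}" and "bdd_below R"
proof -
  show ne: "R \<noteq> {}" using fracidD(2)[OF I] unfolding R_def by blast
  obtain e where "\<And>x. x \<in> I \<Longrightarrow> x \<noteq> 0 \<Longrightarrow> - rval P e \<le> rval P x"
    using fracid_rval_lower[OF I] P by metis
  then show bdd: "bdd_below R" unfolding R_def by (intro bdd_belowI[of _ "- rval P e"]) auto
  have f: "f_ideal \<oo> I P = ereal (Inf R)"
  proof (rule antisym)
    show "ereal (Inf R) \<le> f_ideal \<oo> I P"
      unfolding f_ideal_def
    proof (rule INF_greatest)
      fix x assume "x \<in> I"
      then show "ereal (Inf R) \<le> valuation_at \<oo> P x"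
        using cInf_lower[OF _ bdd, of "rval P x"] by (auto simp: valuation_at_rval[OF P] R_def)
    qed
    have le: "f_ideal \<oo> I P \<le> ereal r" if "r \<in> R" for r
    proof -
      obtain x where x: "x \<in> I" "x \<noteq> 0" "r = rval P x" using \<open>r \<in> R\<close> unfolding R_def by blast
      have "f_ideal \<oo> I P \<le> valuation_at \<oo> P x" unfolding f_ideal_def by (rule INF_lower[OF x(1)])
      then show ?thesis using x by (simp add: valuation_at_rval[OF P])
    qed
    show "f_ideal \<oo> I P \<le> ereal (Inf R)"
    proof (cases "f_ideal \<oo> I P")
      case (real q)
      then have "q \<le> Inf R" using le by (intro cInf_greatest[OF ne]) auto
      then show ?thesis using real by simp
    next
      case PInf
      obtain r where "r \<in> R" using ne by blast
      then show ?thesis using le[of r] PInf by simp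
    qed simp
  qed
  have "P \<in> Max_ideal \<oo> I \<longleftrightarrow> Inf R \<in> R"
  proof
    assume "P \<in> Max_ideal \<oo> I"
    then obtain x where x: "x \<in> I" "valuation_at \<oo> P x = ereal (Inf R)" unfolding Max_ideal_def f[symmetric] by blast
    then have "x \<noteq> 0" "rval P x = Inf R" using valuation_at_rval[OF P, of x] by (auto split: if_splits)
    then show "Inf R \<in> R" using x(1) unfolding R_def by (metis DiffI empty_iff imageI insert_iff)
  next
    assume "Inf R \<in> R"
    then obtain x where x: "x \<in> I" "x \<noteq> 0" "Inf R = rval P x" unfolding R_def by blast
    then have "valuation_at \<oo> P x = f_ideal \<oo> I P" unfolding f using valuation_at_rval[OF P, of x] by simp
    then show "P \<in> Max_ideal \<oo> I" unfolding Max_ideal_def using P x(1) by blast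
  qed
  then show "Ft I P = TReal (Inf R) (Inf R \<notin> R)"
    unfolding F_tilde_def using P f by simp
qed

text \<open>
  The comparison with untagged values absorbs both the infimum and the question whether it is attained.
\<close>

lemma F_tilde_le_iff:
  assumes I: "fracid I" and P: "P \<in> Sp"
  shows "Ft I P \<le> TReal a False \<longleftrightarrow> (\<exists>x\<in>I. x \<noteq> 0 \<and> rval P x \<le> a)"
proof -
  let ?R = "rval P ` (I - {0})"
  note R = F_tilde_eq[OF I P]
  have "Ft I P \<le> TReal a False \<longleftrightarrow> Inf ?R < a \<or> Inf ?R = a \<and> Inf ?R \<in> ?R"
    unfolding R(1) by auto
  also have "\<dots> \<longleftrightarrow> (\<exists>r\<in>?R. r \<le> a)"
  proof
    assume "Inf ?R < a \<or> Inf ?R = a \<and> Inf ?R \<in> ?R"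
    then show "\<exists>r\<in>?R. r \<le> a"
    proof
      assume "Inf ?R < a"
      then obtain r where "r \<in> ?R" "r < a" using cInf_lessD[OF R(2)] by blast
      then show ?thesis using less_imp_le by blast
    qed auto
  next
    assume "\<exists>r\<in>?R. r \<le> a"
    then obtain r where r: "r \<in> ?R" "r \<le> a" by blast
    have "Inf ?R \<le> r" by (rule cInf_lower[OF r(1) R(3)])
    then show "Inf ?R < a \<or> Inf ?R = a \<and> Inf ?R \<in> ?R" using r by (cases "Inf ?R = r") auto
  qed
  also have "\<dots> \<longleftrightarrow> (\<exists>x\<in>I. x \<noteq> 0 \<and> rval P x \<le> a)" by blast
  finally show ?thesis .
qed

lemma F_tilde_ge:
  assumes I: "fracid I" and P: "P \<in> Sp" and c: "\<And>x. x \<in> I \<Longrightarrow> x \<noteq> 0 \<Longrightarrow> c \<le> rval P x"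
  shows "TReal c False \<le> Ft I P"
proof (rule ccontr)
  assume "\<not> TReal c False \<le> Ft I P"
  then have "Ft I P < TReal c False" by simp
  then obtain b x where "b < c" "x \<in> I" "x \<noteq> 0" "rval P x \<le> b"
    unfolding treal_less_iff(1) F_tilde_le_iff[OF I P] by blast
  then show False using c[of x] by simp
qed

lemma F_tilde_mult:
  assumes I: "fracid I" and J: "fracid J"
  shows "Ft (iprod I J) = (\<lambda>P\<in>Sp. Ft I P + Ft J P)"
proof
  fix P
  show "Ft (iprod I J) P = (\<lambda>P\<in>Sp. Ft I P + Ft J P) P"
  proof (cases "P \<in> Sp")
    case P: True
    have "Ft (iprod I J) P = Ft I P + Ft J P"
    proof (rule treal_eqI)
      fix a
      have "Ft (iprod I J) P \<le> TReal a False \<longleftrightarrow>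
          (\<exists>x\<in>I. \<exists>y\<in>J. x \<noteq> 0 \<and> y \<noteq> 0 \<and> rval P x + rval P y \<le> a)"
        unfolding F_tilde_le_iff[OF ideal_prod_fracid[OF I J] P]
      proof
        assume "\<exists>z\<in>iprod I J. z \<noteq> 0 \<and> rval P z \<le> a"
        then obtain z where z: "z \<in> iprod I J" "z \<noteq> 0" "rval P z \<le> a" by blast
        then show "\<exists>x\<in>I. \<exists>y\<in>J. x \<noteq> 0 \<and> y \<noteq> 0 \<and> rval P x + rval P y \<le> a"
          using ideal_prod_rval[OF P z(1,2)] order_trans by blast
      next
        assume "\<exists>x\<in>I. \<exists>y\<in>J. x \<noteq> 0 \<and> y \<noteq> 0 \<and> rval P x + rval P y \<le> a"
        then obtain x y where xy: "x \<in> I" "y \<in> J" "x \<noteq> 0" "y \<noteq> 0" "rval P x + rval P y \<le> a" by blast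
        have "x * y \<in> iprod I J" using ideal_prod.prod[OF xy(1,2), of ambient] by simp
        then show "\<exists>z\<in>iprod I J. z \<noteq> 0 \<and> rval P z \<le> a"
          using rval_simps(1)[OF P xy(3,4)] xy by (intro bexI[of _ "x * y"]) auto
      qed
      also have "\<dots> \<longleftrightarrow> Ft I P + Ft J P \<le> TReal a False"
        unfolding treal_add_le_iff F_tilde_le_iff[OF I P] F_tilde_le_iff[OF J P]
        by (meson add_mono order_refl order_trans)
      finally show "Ft (iprod I J) P \<le> TReal a False \<longleftrightarrow>
        Ft I P + Ft J P \<le> TReal a False" .
    qed
    then show ?thesis using P by simp
  qed (simp add: F_tilde_def)
qed

lemma F_tilde_OO: "Ft \<OO> = (\<lambda>P\<in>Sp. 0)"
proof
  fix P show "Ft \<OO> P = (\<lambda>P\<in>Sp. 0) P"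
  proof (cases "P \<in> Sp")
    case P: True
    have "Ft \<OO> P \<le> TReal 0 False"
      unfolding F_tilde_le_iff[OF fracid_OO P] using OD(1) rval_simps(2)[OF P] by (intro bexI[of _ 1]) auto
    moreover have "TReal 0 False \<le> Ft \<OO> P" by (rule F_tilde_ge[OF fracid_OO P rval_OO(1)[OF P]])
    ultimately show ?thesis using P by (simp add: zero_treal_def)
  qed (simp add: F_tilde_def)
qed

text \<open>
  The ideal of all \<open>s \<in> \<OO>\<close> with \<open>s x \<in> I\<close> is contained in no maximal ideal \<open>P\<close>: for \<open>w \<in> I\<close> with value at
  most that of \<open>x\<close> one has \<open>x / w = a / b\<close> with \<open>b \<notin> P\<close>, and \<open>b\<close> belongs to that ideal. Hence it
  contains 1.
\<close>

lemma fracid_local: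
  assumes I: "fracid I" and x: "x \<noteq> 0"
    and loc: "\<And>P. P \<in> Sp \<Longrightarrow> \<exists>y\<in>I. y \<noteq> 0 \<and> rval P y \<le> rval P x"
  shows "x \<in> I"
proof (rule ccontr)
  assume xI: "x \<notin> I"
  note M = is_submoduleD[OF fracidD(1)[OF I]]
  let ?J = "{s \<in> \<OO>. s * x \<in> I}"
  have J: "is_ideal \<OO> ?J"
    unfolding is_ideal_def is_submodule_def using M OD(2,5,6) by (auto simp: distrib_right mult.assoc)
  have "?J \<inter> {1} = {}" using xI by simp
  then obtain P where P: "is_prime \<OO> P" "?J \<subseteq> P"
    using prime_avoiding[OF OO_subring J, of "{1}"] OD(1) by auto
  obtain y where y: "y \<in> I" "y \<noteq> 0" using fracidD(2)[OF I] by blast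
  obtain d where d: "d \<in> \<oo>" "d \<noteq> 0" "d * (x / y) \<in> \<OO>" using OO_denominator by blast
  have "(d * (x / y)) * y \<in> I" by (rule M(3)[OF d(3) y(1)])
  then have "d \<in> ?J" using d(1) base_subset_OO y(2) by auto
  then have "P \<noteq> {0}" using P(2) d(2) by blast
  then have max: "is_maximal \<OO> P" by (rule OO_prime_maximal[OF P(1)])
  then have PS: "P \<in> Sp" by (simp add: mSpec_iff)
  obtain w where w: "w \<in> I" "w \<noteq> 0" "rval P w \<le> rval P x" using loc[OF PS] by blast
  have "x / w \<in> localization P" using rval_nonneg_iff[OF PS, of "x / w"] rval_simps(4)[OF PS x w(2)] w x by simp
  then obtain a b where ab: "a \<in> \<OO>" "b \<in> \<OO>" "b \<notin> P" "x / w = a / b" unfolding localization_at_def by blast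
  then have "b \<noteq> 0" using is_maximalD(5)[OF max] by auto
  then have "b * x = a * w" using ab(4) w(2) by (simp add: field_simps)
  then have "b \<in> ?J" using M(3)[OF ab(1) w(1)] ab(2) by simp
  then show False using P(2) ab(3) by blast
qed

lemma fracid_mem_iff:
  assumes I: "fracid I" and x: "x \<noteq> 0"
  shows "x \<in> I \<longleftrightarrow> (\<forall>P\<in>Sp. Ft I P \<le> TReal (rval P x) False)"
  using fracid_local[OF I x] x by (auto simp: F_tilde_le_iff[OF I])

lemma F_tilde_inj:
  assumes "fracid I" "fracid J" "Ft I = Ft J"
  shows "I = J"
proof -
  have "x \<in> I \<longleftrightarrow> x \<in> J" for x
    using fracid_mem_iff[OF assms(1), of x] fracid_mem_iff[OF assms(2), of x] assms(3)
      is_submoduleD(1)[OF fracidD(1)[OF assms(1)]] is_submoduleD(1)[OF fracidD(1)[OF assms(2)]]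
    by (cases "x = 0") auto
  then show ?thesis by blast
qed

lemma OO_iff_rval:
  assumes "x \<noteq> 0"
  shows "x \<in> \<OO> \<longleftrightarrow> (\<forall>P\<in>Sp. 0 \<le> rval P x)"
proof -
  have "Ft \<OO> P \<le> TReal r False \<longleftrightarrow> 0 \<le> r" if "P \<in> Sp" for P r
    using that by (auto simp: F_tilde_OO zero_treal_def)
  then show ?thesis using fracid_mem_iff[OF fracid_OO assms] by simp
qed

section \<open>Range of the map\<close>

lemma value_group_eq: "P \<in> Sp \<Longrightarrow> value_group \<oo> P = rval P ` (- {0})"
  by (auto simp: value_group_def valuation_at_rval)

text \<open>
  If the infimum is not attained, the values of elements of \<open>I\<close> accumulate at it. Their differences are
  arbitrarily small positive elements of the value group, which is therefore dense.
\<close>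

lemma F_tilde_V:
  assumes I: "fracid I" and P: "P \<in> Sp"
  shows "Ft I P \<in> V_tilde \<oo> P"
proof -
  let ?R = "rval P ` (I - {0})" and ?G = "value_group \<oo> P"
  note R = F_tilde_eq[OF I P]
  have RG: "?R \<subseteq> ?G" using value_group_eq[OF P] by auto
  show ?thesis
  proof (cases "Inf ?R \<in> ?R")
    case True
    then have "Ft I P \<in> val \<oo> P" unfolding R(1) val_def using RG by auto
    then show ?thesis by (auto simp: V_tilde_def)
  next
    case False
    have "closure ?G = UNIV"
    proof (intro equalityI subsetI UNIV_I)
      fix a :: real
      show "a \<in> closure ?G"
        unfolding closure_approachable
      proof (intro allI impI)
        fix \<epsilon> :: real assume \<epsilon>: "0 < \<epsilon>"
        obtain r1 where r1: "r1 \<in> ?R" "r1 < Inf ?R + \<epsilon>" using cInf_lessD[OF R(2), of "Inf ?R + \<epsilon>"] \<epsilon> by auto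
        have "Inf ?R < r1" using cInf_lower[OF r1(1) R(3)] False r1(1) by (cases "Inf ?R = r1") auto
        then obtain r2 where r2: "r2 \<in> ?R" "r2 < r1" using cInf_lessD[OF R(2)] by blast
        define \<delta> where "\<delta> = r1 - r2"
        have \<delta>: "0 < \<delta>" "\<delta> < \<epsilon>" using r2 r1 cInf_lower[OF r2(1) R(3)] by (auto simp: \<delta>_def)
        obtain x1 x2 where x: "x1 \<noteq> 0" "x2 \<noteq> 0" "r1 = rval P x1" "r2 = rval P x2" using r1 r2 by blast
        \<comment> \<open>the multiples of \<open>\<delta>\<close> in the value group are closer than \<open>\<epsilon>\<close> to any real\<close>
        let ?k = "\<lfloor>a / \<delta>\<rfloor>"
        have "rval P ((x1 / x2) powi ?k) = of_int ?k * \<delta>"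
          using rval_simps(6)[OF P, of "x1 / x2"] rval_simps(4)[OF P x(1,2)] x by (simp add: \<delta>_def)
        moreover have "(x1 / x2) powi ?k \<noteq> 0" using x by simp
        ultimately have "of_int ?k * \<delta> \<in> ?G" unfolding value_group_eq[OF P] by (metis ComplI image_eqI singletonD)
        moreover have "dist (of_int ?k * \<delta>) a < \<epsilon>"
        proof -
          have "of_int ?k \<le> a / \<delta>" "a / \<delta> < of_int ?k + 1" by linarith+
          then have "of_int ?k * \<delta> \<le> a" "a < (of_int ?k + 1) * \<delta>"
            using \<delta>(1) by (simp_all only: pos_le_divide_eq pos_divide_less_eq)
          then have "of_int ?k * \<delta> \<le> a" "a < of_int ?k * \<delta> + \<delta>" by (simp_all add: distrib_right)
          then show ?thesis using \<delta>(2) by (simp add: dist_real_def)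
        qed
        ultimately show "\<exists>y\<in>?G. dist y a < \<epsilon>" by blast
      qed
    qed
    then show ?thesis unfolding R(1) V_tilde_def using False by auto
  qed
qed

text \<open>
  A non-zero element of \<open>I\<close> and a common denominator bound the function; both have value 0
  outside a compact set, and so has the function. The sublevel sets are unions, over the non-zero \<open>x \<in> I\<close>, of
  sets defined by the value of \<open>x\<close>, which are open because that value is locally constant.
\<close>

lemma F_tilde_S_b_V:
  assumes I: "fracid I"
  shows "Ft I \<in> S_b_V \<oo>"
proof -
  obtain e where e: "e \<in> \<OO>" "e \<noteq> 0" "\<And>x. x \<in> I \<Longrightarrow> e * x \<in> \<OO>"
    and low: "\<And>P x. P \<in> Sp \<Longrightarrow> x \<in> I \<Longrightarrow> x \<noteq> 0 \<Longrightarrow> - rval P e \<le> rval P x"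
    using fracid_rval_lower[OF I] by metis
  obtain x where x: "x \<in> I" "x \<noteq> 0" using fracidD(2)[OF I] by blast
  define m where "m = e * x"
  have m: "m \<in> \<OO>" "m \<noteq> 0" using e x by (auto simp: m_def)
  have rm: "rval P x = rval P m - rval P e" if "P \<in> Sp" for P
    unfolding m_def using rval_simps(1)[OF that e(2) x(2)] by simp
  have "bounded_fun T (Ft I)"
  proof -
    obtain B1 where B1: "\<And>P. P \<in> Sp \<Longrightarrow> rval P m \<le> B1" by (rule rval_bounded[OF m]) blast
    obtain B2 where B2: "\<And>P. P \<in> Sp \<Longrightarrow> rval P e \<le> B2" by (rule rval_bounded[OF e(1,2)]) blast
    have "TReal (- B2) False \<le> Ft I P" if P: "P \<in> Sp" for P
      by (rule F_tilde_ge[OF I P]) (use low[OF P] B2[OF P] in fastforce)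
    moreover have "Ft I P \<le> TReal B1 False" if P: "P \<in> Sp" for P
      unfolding F_tilde_le_iff[OF I P]
      using x rm[OF P] B1[OF P] rval_OO(1)[OF P e(1,2)] by (intro bexI[of _ x]) auto
    ultimately show ?thesis unfolding bounded_fun_def by auto
  qed
  moreover have "compactly_supported T (Ft I)"
    unfolding compactly_supported_def
  proof (intro exI conjI ballI)
    show "compactin T {P \<in> Sp. e * m \<in> P}" by (rule compactin_basic) (use OD(6) e m in auto)
    fix P assume "P \<in> topspace T - {P \<in> Sp. e * m \<in> P}"
    then have P: "P \<in> Sp" "e * m \<notin> P" by auto
    have M: "is_submodule \<OO> P" using P mSpec_iff is_maximalD(2) by blast
    have "e \<notin> P" "m \<notin> P"
      using is_submoduleD(3)[OF M e(1), of m] is_submoduleD(3)[OF M m(1), of e] P(2) by (auto simp: mult.commute)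
    then have 0: "rval P e = 0" "rval P m = 0" using rval_OO(2)[OF P(1)] e m by auto
    have "Ft I P \<le> TReal 0 False"
      unfolding F_tilde_le_iff[OF I P(1)] using x rm[OF P(1)] 0 by (intro bexI[of _ x]) auto
    moreover have "TReal 0 False \<le> Ft I P"
      by (rule F_tilde_ge[OF I P(1)]) (use low[OF P(1)] 0 in fastforce)
    ultimately show "Ft I P = 0" by (simp add: zero_treal_def)
  qed
  moreover have "upper_semicont T (Ft I)"
    unfolding upper_semicont_def
  proof
    fix a obtain \<alpha> s where a: "a = TReal \<alpha> s" by (metis treal.exhaust)
    have "{P \<in> Sp. Ft I P < a}
        = (\<Union>x\<in>I - {0}. {P \<in> Sp. if s then rval P x \<le> \<alpha> else rval P x < \<alpha>})"
    proof (cases s)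
      case True
      then have s: "s = True" by simp
      show ?thesis unfolding a s treal_less_iff(2) by (auto simp: F_tilde_le_iff[OF I])
    next
      case False
      then have s: "s = False" by simp
      have "(\<exists>b<\<alpha>. \<exists>x\<in>I. x \<noteq> 0 \<and> rval P x \<le> b) \<longleftrightarrow> (\<exists>x\<in>I. x \<noteq> 0 \<and> rval P x < \<alpha>)" for P
        using order_le_less_trans by blast
      then have "Ft I P < TReal \<alpha> False \<longleftrightarrow> (\<exists>x\<in>I. x \<noteq> 0 \<and> rval P x < \<alpha>)" if "P \<in> Sp" for P
        unfolding treal_less_iff(1) F_tilde_le_iff[OF I that] .
      then show ?thesis unfolding a s by auto
    qed
    moreover have "openin T (\<Union>x\<in>I - {0}. {P \<in> Sp. if s then rval P x \<le> \<alpha> else rval P x < \<alpha>})"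
      using openin_rval[of _ "\<lambda>r. if s then r \<le> \<alpha> else r < \<alpha>"] by (intro openin_Union) auto
    ultimately show "openin T {P \<in> topspace T. Ft I P < a}" by simp
  qed
  moreover have "Ft I \<in> extensional Sp" by (simp add: F_tilde_def)
  ultimately show ?thesis using F_tilde_V[OF I] by (simp add: S_b_V_def S_b_def)
qed

section \<open>Surjectivity\<close>

lemma rval_base_int:
  assumes P: "P \<in> Sp" and x: "x \<in> \<oo>" "x \<noteq> 0"
  shows "rval P x \<in> \<int>"
proof -
  have "x \<in> K" using frac_fieldI[OF x(1) oD(1)] by simp
  then have "valuation_at \<oo> P x \<in> range (\<lambda>n::int. ereal (of_int n))"
    using valuation_at_normalized[OF P] x(2) unfolding normalized_valuation_def by blast
  then show ?thesis using x(2) by (auto simp: valuation_at_rval[OF P])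
qed

lemma rval_base_ge_1:
  assumes P: "P \<in> Sp" and x: "x \<in> \<oo>" "x \<in> P" "x \<noteq> 0"
  shows "1 \<le> rval P x"
proof -
  obtain k :: int where k: "rval P x = of_int k" using rval_base_int[OF P x(1,3)] by (auto elim: Ints_cases)
  have "0 < rval P x" using rval_OO(3)[OF P _ x(3,2)] x(1) base_subset_OO by blast
  then show ?thesis unfolding k by simp
qed

definition ideal_of :: "('a set \<Rightarrow> treal) \<Rightarrow> 'a set" where
  "ideal_of f = {x. x = 0 \<or> (\<forall>P\<in>Sp. f P \<le> TReal (rval P x) False)}"

lemma ideal_of_submodule: "is_submodule \<OO> (ideal_of f)"
  unfolding is_submodule_def
proof (intro conjI ballI)
  show "0 \<in> ideal_of f" by (simp add: ideal_of_def)
  show "x + y \<in> ideal_of f" if x: "x \<in> ideal_of f" and y: "y \<in> ideal_of f" for x y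
  proof (cases "x = 0 \<or> y = 0 \<or> x + y = 0")
    case True
    then show ?thesis using x y by (auto simp: ideal_of_def)
  next
    case False
    have "f P \<le> TReal (rval P (x + y)) False" if P: "P \<in> Sp" for P
    proof -
      have "rval P x \<le> rval P (x + y) \<or> rval P y \<le> rval P (x + y)"
        using rval_add[OF P, of x y] False by (auto simp: min_def split: if_splits)
      then show ?thesis using x y P False treal_le_trans by (auto simp: ideal_of_def)
    qed
    then show ?thesis by (simp add: ideal_of_def)
  qed
  show "r * x \<in> ideal_of f" if r: "r \<in> \<OO>" and x: "x \<in> ideal_of f" for r x
  proof (cases "r = 0 \<or> x = 0")
    case False
    have "f P \<le> TReal (rval P (r * x)) False" if P: "P \<in> Sp" for P
    proof (rule treal_le_trans)
      show "f P \<le> TReal (rval P x) False" using x P False by (auto simp: ideal_of_def)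
      show "rval P x \<le> rval P (r * x)" using rval_simps(1)[OF P, of r x] rval_OO(1)[OF P r] False by simp
    qed
    then show ?thesis by (simp add: ideal_of_def)
  qed (auto simp: ideal_of_def)
qed

text \<open>
  The witness \<open>N\<close> is an element of the ideal and at the same time a common denominator for it. It is
  kept in the conclusion because it also dominates \<open>f\<close> away from a given point in the proof of
  surjectivity.
\<close>

lemma ideal_of_fracid:
  assumes f: "f \<in> S_b_V \<oo>"
  obtains N where "N \<in> \<OO>" "N \<noteq> 0" "N \<in> ideal_of f" "fracid (ideal_of f)"
proof -
  obtain lo hi where bd: "\<And>P. P \<in> Sp \<Longrightarrow> lo \<le> f P \<and> f P \<le> hi"
    using f unfolding S_b_V_def S_b_def bounded_fun_def by auto
  obtain Y where Y: "compactin T Y" "\<And>P. P \<in> Sp \<Longrightarrow> P \<notin> Y \<Longrightarrow> f P = 0"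
    using f unfolding S_b_V_def S_b_def compactly_supported_def by auto
  obtain n where n: "n \<in> \<oo>" "n \<noteq> 0" "\<And>P. P \<in> Y \<Longrightarrow> n \<in> P" using compact_common_element[OF Y(1)] by metis
  obtain \<alpha> s \<beta> t where lh: "lo = TReal \<alpha> s" "hi = TReal \<beta> t" by (metis treal.exhaust)
  \<comment> \<open>the values of \<open>n\<close> on the support are at least 1,
    so \<open>n ^ B\<close> exceeds the upper bound of \<open>f\<close> and cancels the lower one\<close>
  obtain B :: nat where B: "max \<beta> (- \<alpha>) < real B" using reals_Archimedean2 by blast
  define N where "N = n ^ B"
  have nO: "n \<in> \<OO>" using n(1) base_subset_OO by blast
  have N: "N \<in> \<OO>" "N \<noteq> 0" using is_subring_power[OF OO_subring nO] n(2) by (auto simp: N_def)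
  have big: "real B \<le> rval P N" if "P \<in> Sp" "P \<in> Y" for P
    using rval_base_ge_1[OF that(1) n(1) n(3)[OF that(2)] n(2)] rval_simps(5)[OF that(1) n(2), of B]
      mult_left_mono[of 1 "rval P n" "real B"] by (simp add: N_def)
  have NI: "N \<in> ideal_of f"
    unfolding ideal_of_def
  proof (intro CollectI disjI2 ballI)
    fix P assume P: "P \<in> Sp"
    show "f P \<le> TReal (rval P N) False"
    proof (cases "P \<in> Y")
      case True
      have "f P \<le> TReal \<beta> t" using bd[OF P] lh by simp
      moreover have "\<beta> < rval P N" using B big[OF P True] by simp
      ultimately show ?thesis by (cases "f P") auto
    next
      case False
      then show ?thesis using Y(2)[OF P] rval_OO(1)[OF P N] by (auto simp: zero_treal_def)
    qed
  qed
  moreover have "N * x \<in> \<OO>" if x: "x \<in> ideal_of f" for x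
  proof (cases "x = 0")
    case False
    have "0 \<le> rval P (N * x)" if P: "P \<in> Sp" for P
    proof -
      have fx: "f P \<le> TReal (rval P x) False" using x False P by (auto simp: ideal_of_def)
      have eq: "rval P (N * x) = rval P N + rval P x" by (rule rval_simps(1)[OF P N(2) False])
      show ?thesis
      proof (cases "P \<in> Y")
        case True
        have "TReal \<alpha> s \<le> TReal (rval P x) False" using bd[OF P] lh fx order_trans by blast
        then have "\<alpha> \<le> rval P x" by auto
        then show ?thesis using eq big[OF P True] B by simp
      next
        case False
        then have "0 \<le> rval P x" using Y(2)[OF P] fx by (auto simp: zero_treal_def)
        then show ?thesis using eq rval_OO(1)[OF P N] by simp
      qed
    qed
    then show ?thesis using OO_iff_rval[of "N * x"] N(2) False by simp
  qed (simp add: OD(2))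
  ultimately have "fracid (ideal_of f)"
    unfolding fracid_iff using ideal_of_submodule N(2) by blast
  then show thesis using that N NI by blast
qed

text \<open>
  A tagged value only occurs if the value group is dense, and then the group meets the interval between
  \<open>\<alpha>\<close> and \<open>a\<close>.
\<close>

lemma V_tilde_value:
  assumes v: "TReal \<alpha> s \<in> V_tilde \<oo> P" and le: "TReal \<alpha> s \<le> TReal a False"
  obtains g where "g \<in> value_group \<oo> P" "TReal \<alpha> s \<le> TReal g False" "g \<le> a"
proof (cases s)
  case False
  then have "\<alpha> \<in> value_group \<oo> P" using v by (auto simp: V_tilde_def val_def split: if_splits)
  then show thesis using that[of \<alpha>] le False by auto
next
  case True
  then have cl: "closure (value_group \<oo> P) = UNIV" using v by (auto simp: V_tilde_def val_def split: if_splits)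
  have "\<alpha> < a" using le True by auto
  then have "(\<alpha> + a) / 2 \<in> closure (value_group \<oo> P)" "0 < (a - \<alpha>) / 2" using cl by auto
  then obtain g where g: "g \<in> value_group \<oo> P" "dist g ((\<alpha> + a) / 2) < (a - \<alpha>) / 2"
    unfolding closure_approachable by blast
  then have "\<alpha> < g" "g < a" by (auto simp: dist_real_def abs_less_iff field_simps)
  then show thesis using that[OF g(1)] by auto
qed

text \<open>
  Let \<open>g\<close> be the value at \<open>P0\<close> of some \<open>y\<close>, with \<open>f P0 \<le> TReal g False\<close>. By semicontinuity \<open>y\<close> dominates
  \<open>f\<close> near \<open>P0\<close>. Multiplied by an element that is a unit at \<open>P0\<close> and has large values elsewhere, it
  dominates \<open>f\<close> everywhere, without a change of its value at \<open>P0\<close>.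
\<close>

lemma F_tilde_surj:
  assumes f: "f \<in> S_b_V \<oo>"
  shows "fracid (ideal_of f)" "Ft (ideal_of f) = f"
proof -
  let ?I = "ideal_of f"
  obtain N where N: "N \<in> \<OO>" "N \<noteq> 0" "N \<in> ?I" and I: "fracid ?I" by (rule ideal_of_fracid[OF f])
  show "fracid ?I" by (rule I)
  have usc: "openin T {P \<in> Sp. f P \<le> TReal a False}" for a
    using f unfolding S_b_V_def S_b_def upper_semicont_def by (auto simp flip: treal_less_iff(2))
  have "Ft ?I P0 = f P0" if P0: "P0 \<in> Sp" for P0
  proof (rule treal_eqI)
    fix a
    show "Ft ?I P0 \<le> TReal a False \<longleftrightarrow> f P0 \<le> TReal a False"
      unfolding F_tilde_le_iff[OF I P0]
    proof
      assume "\<exists>x\<in>?I. x \<noteq> 0 \<and> rval P0 x \<le> a"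
      then obtain x where x: "x \<in> ?I" "x \<noteq> 0" "rval P0 x \<le> a" by blast
      then have "f P0 \<le> TReal (rval P0 x) False" using P0 by (auto simp: ideal_of_def)
      then show "f P0 \<le> TReal a False" using x(3) treal_le_trans by blast
    next
      assume le: "f P0 \<le> TReal a False"
      obtain \<alpha> s where fP0: "f P0 = TReal \<alpha> s" by (metis treal.exhaust)
      have "f P0 \<in> V_tilde \<oo> P0" using f P0 by (simp add: S_b_V_def)
      then obtain g where g: "g \<in> value_group \<oo> P0" "f P0 \<le> TReal g False" "g \<le> a"
        using V_tilde_value le unfolding fP0 by metis
      then obtain y where y: "y \<noteq> 0" "g = rval P0 y" unfolding value_group_eq[OF P0] by blast
      \<comment> \<open>where \<open>y\<close> already dominates \<open>f\<close>; elsewhere \<open>N\<close> dominates \<open>f\<close>,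
        and \<open>z\<close> is to supply \<open>N\<close> and the denominator \<open>e\<close> of \<open>y\<close>\<close>
      define W where "W = {P \<in> Sp. f P \<le> TReal g False} \<inter> {P \<in> Sp. rval P y = g}"
      have W: "openin T W" "P0 \<in> W"
        unfolding W_def using usc openin_rval[OF y(1), of "\<lambda>r. r = g"] P0 g(2) y(2) by auto
      obtain e where e: "e \<in> \<oo>" "e \<noteq> 0" "e * y \<in> \<OO>" using OO_denominator by blast
      have d: "N * e \<in> \<OO>" "N * e \<noteq> 0" using OD(6)[of N e] N e base_subset_OO by auto
      obtain z where z: "z \<in> \<OO>" "z \<notin> P0" "\<And>P. P \<in> Sp \<Longrightarrow> P \<notin> W \<Longrightarrow> rval P (N * e) \<le> rval P z"
        by (rule separating_element[OF P0 W d]) blast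
      have z0: "z \<noteq> 0" using z(2) P0 mSpec_iff is_maximalD(5) by blast
      have zy: "rval P (z * y) = rval P z + rval P y" if "P \<in> Sp" for P by (rule rval_simps(1)[OF that z0 y(1)])
      have "z * y \<in> ?I"
        unfolding ideal_of_def
      proof (intro CollectI disjI2 ballI)
        fix P assume P: "P \<in> Sp"
        show "f P \<le> TReal (rval P (z * y)) False"
        proof (cases "P \<in> W")
          case True
          then have "f P \<le> TReal g False" "rval P y = g" by (auto simp: W_def)
          then show ?thesis using treal_le_trans[of "f P" g] zy[OF P] rval_OO(1)[OF P z(1) z0] by simp
        next
          case False
          have "f P \<le> TReal (rval P N) False" using N P by (auto simp: ideal_of_def)
          moreover have "rval P N \<le> rval P (z * y)"
            using z(3)[OF P False] zy[OF P] rval_simps(1)[OF P N(2) e(2)] rval_simps(1)[OF P e(2) y(1)]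
              rval_OO(1)[OF P e(3)] e(2) y(1) by simp
          ultimately show ?thesis by (rule treal_le_trans)
        qed
      qed
      moreover have "rval P0 (z * y) = g" using zy[OF P0] rval_OO(2)[OF P0 z(1) z0 z(2)] y(2) by simp
      ultimately show "\<exists>x\<in>?I. x \<noteq> 0 \<and> rval P0 x \<le> a" using z0 y(1) g(3) by (intro bexI[of _ "z * y"]) auto
    qed
  qed
  moreover have "f \<in> extensional Sp" using f by (simp add: S_b_V_def S_b_def)
  ultimately show "Ft ?I = f"
    by (intro extensionalityI[of _ Sp]) (auto simp: F_tilde_def)
qed

section \<open>The isomorphism of monoids\<close>

abbreviation fsum :: "('a set \<Rightarrow> treal) \<Rightarrow> ('a set \<Rightarrow> treal) \<Rightarrow> 'a set \<Rightarrow> treal" where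
  "fsum f g \<equiv> \<lambda>P\<in>Sp. f P + g P"

lemma S_b_V_image: "S_b_V \<oo> = Ft ` Collect fracid"
proof (intro equalityI subsetI)
  fix f assume "f \<in> S_b_V \<oo>"
  then show "f \<in> Ft ` Collect fracid" using F_tilde_surj[of f] by (metis imageI mem_Collect_eq)
qed (use F_tilde_S_b_V in blast)

lemma S_b_V_obtain:
  assumes "f \<in> S_b_V \<oo>"
  obtains I where "fracid I" "Ft I = f"
  using F_tilde_surj[OF assms] by blast

text \<open>
  The sum is the function of the product of two ideals, from which it inherits semicontinuity.
\<close>

lemma S_b_V_fsum:
  assumes "f \<in> S_b_V \<oo>" "g \<in> S_b_V \<oo>"
  shows "fsum f g \<in> S_b_V \<oo>"
proof -
  obtain I J where IJ: "fracid I" "Ft I = f" "fracid J" "Ft J = g"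
    using assms S_b_V_obtain by metis
  then show ?thesis using F_tilde_mult[OF IJ(1,3)] F_tilde_S_b_V[OF ideal_prod_fracid[OF IJ(1,3)]] by simp
qed

lemma S_b_V_extensional: "f \<in> S_b_V \<oo> \<Longrightarrow> f \<in> extensional Sp"
  by (simp add: S_b_V_def S_b_def)

lemma fsum_assoc: "fsum (fsum f g) h = fsum f (fsum g h)"
  by (rule ext) (simp add: restrict_def add.assoc)

lemma fsum_commute: "fsum f g = fsum g f"
  by (rule ext) (simp add: restrict_def add.commute)

lemma fsum_zero: "f \<in> extensional Sp \<Longrightarrow> fsum (\<lambda>P\<in>Sp. 0) f = f"
  by (rule ext) (auto simp: restrict_def extensional_def)

lemma comm_monoid_functions: "comm_monoid SM"
proof (rule comm_monoidI)
  show "\<one>\<^bsub>SM\<^esub> \<in> carrier SM"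
    using F_tilde_S_b_V[OF fracid_OO] by (simp add: S_b_V_monoid_def pointwise_monoid_def F_tilde_OO)
  show "\<one>\<^bsub>SM\<^esub> \<otimes>\<^bsub>SM\<^esub> f = f" if "f \<in> carrier SM" for f
    using fsum_zero[OF S_b_V_extensional] that by (simp add: S_b_V_monoid_def pointwise_monoid_def)
  show "f \<otimes>\<^bsub>SM\<^esub> g = g \<otimes>\<^bsub>SM\<^esub> f" for f g
    using fsum_commute[of f g] by (simp add: S_b_V_monoid_def pointwise_monoid_def)
  show "f \<otimes>\<^bsub>SM\<^esub> g \<otimes>\<^bsub>SM\<^esub> h
      = f \<otimes>\<^bsub>SM\<^esub> (g \<otimes>\<^bsub>SM\<^esub> h)" for f g h
    using fsum_assoc[of f g h] by (simp add: S_b_V_monoid_def pointwise_monoid_def)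
qed (simp_all add: S_b_V_monoid_def pointwise_monoid_def S_b_V_fsum)

text \<open>
  The laws are pulled back along the injective map \<open>F_tilde\<close>.
\<close>

lemma comm_monoid_ideals: "comm_monoid FM"
proof (rule comm_monoidI)
  note prod = ideal_prod_fracid F_tilde_mult
  fix I J H assume "I \<in> carrier FM" "J \<in> carrier FM"
    "H \<in> carrier FM"
  then have I: "fracid I" "fracid J" "fracid H" by (auto simp: frac_ideal_monoid_def)
  have "iprod (iprod I J) H = iprod I (iprod J H)"
    by (rule F_tilde_inj) (simp_all only: prod I fsum_assoc)
  then show "I \<otimes>\<^bsub>FM\<^esub> J \<otimes>\<^bsub>FM\<^esub> H
      = I \<otimes>\<^bsub>FM\<^esub> (J \<otimes>\<^bsub>FM\<^esub> H)"
    by (simp add: frac_ideal_monoid_def)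
next
  fix I J assume "I \<in> carrier FM" "J \<in> carrier FM"
  then have I: "fracid I" "fracid J" by (auto simp: frac_ideal_monoid_def)
  show "I \<otimes>\<^bsub>FM\<^esub> J \<in> carrier FM"
    using ideal_prod_fracid[OF I] by (simp add: frac_ideal_monoid_def)
  have "iprod I J = iprod J I"
    by (rule F_tilde_inj[OF ideal_prod_fracid[OF I] ideal_prod_fracid[OF I(2,1)]])
      (unfold F_tilde_mult[OF I] F_tilde_mult[OF I(2,1)], rule fsum_commute)
  then show "I \<otimes>\<^bsub>FM\<^esub> J = J \<otimes>\<^bsub>FM\<^esub> I"
    by (simp add: frac_ideal_monoid_def)
next
  show "\<one>\<^bsub>FM\<^esub> \<in> carrier FM"
    using fracid_OO by (simp add: frac_ideal_monoid_def)
  fix I assume "I \<in> carrier FM"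
  then have I: "fracid I" by (auto simp: frac_ideal_monoid_def)
  have "iprod \<OO> I = I"
  proof (rule F_tilde_inj[OF ideal_prod_fracid[OF fracid_OO I] I])
    show "Ft (iprod \<OO> I) = Ft I"
      unfolding F_tilde_mult[OF fracid_OO I] F_tilde_OO
      by (rule fsum_zero[OF S_b_V_extensional[OF F_tilde_S_b_V[OF I]]])
  qed
  then show "\<one>\<^bsub>FM\<^esub> \<otimes>\<^bsub>FM\<^esub> I = I"
    by (simp add: frac_ideal_monoid_def)
qed

lemma F_tilde_iso: "Ft \<in> iso FM SM"
proof -
  have "Ft \<in> hom FM SM"
    by (rule homI) (simp_all add: frac_ideal_monoid_def S_b_V_monoid_def pointwise_monoid_def
        F_tilde_S_b_V F_tilde_mult)
  moreover have "bij_betw Ft (Collect fracid) (S_b_V \<oo>)"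
    unfolding bij_betw_def S_b_V_image using F_tilde_inj by (auto intro!: inj_onI)
  ultimately show ?thesis
    by (simp add: iso_def frac_ideal_monoid_def S_b_V_monoid_def pointwise_monoid_def)
qed

abbreviation reflect :: "('a set \<Rightarrow> treal) \<Rightarrow> 'a set \<Rightarrow> treal" where
  "reflect f \<equiv> restrict (iota \<circ> f) Sp"

text \<open>
  The value group is closed under negation, so reflection preserves \<open>V_tilde\<close>.
\<close>

lemma S_ref_V_iff: "f \<in> S_ref_V \<oo> \<longleftrightarrow> f \<in> S_b_V \<oo> \<and> reflect f \<in> S_b_V \<oo>"
proof -
  have iota: "iota a \<in> V_tilde \<oo> P" if P: "P \<in> Sp" and a: "a \<in> V_tilde \<oo> P" for P a
  proof -
    have "- g \<in> value_group \<oo> P" if g: "g \<in> value_group \<oo> P" for g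
    proof -
      obtain x where "x \<noteq> 0" "g = rval P x" using g unfolding value_group_eq[OF P] by blast
      then have "- g = rval P (inverse x)" "inverse x \<noteq> 0" using rval_simps(3)[OF P] by auto
      then show ?thesis unfolding value_group_eq[OF P] by blast
    qed
    then show ?thesis using a by (auto simp: V_tilde_def val_def split: if_splits)
  qed
  then show ?thesis by (auto simp: S_ref_V_def S_ref_def S_b_V_def)
qed

lemma S_ref_val_iff: "f \<in> S_ref_val \<oo> \<longleftrightarrow> f \<in> S_ref_V \<oo> \<and> (\<forall>P\<in>Sp. \<exists>a. f P = TReal a False)"
proof -
  have "b \<in> val \<oo> P \<longleftrightarrow> b \<in> V_tilde \<oo> P \<and> (\<exists>a. b = TReal a False)" for b P
    by (auto simp: V_tilde_def val_def)
  then show ?thesis unfolding S_ref_val_def S_ref_V_def mem_Collect_eq by blast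
qed

lemma vn_regular_iff:
  "I \<in> vn_regular FM \<longleftrightarrow>
    fracid I \<and> (\<exists>J. fracid J \<and> I = iprod (iprod I J) I)"
proof -
  have "carrier FM = Collect fracid"
    "mult FM = iprod" by (simp_all add: frac_ideal_monoid_def)
  then show ?thesis unfolding vn_regular_def by (simp only: mem_Collect_eq Bex_def)
qed

text \<open>
  If \<open>f = f + g + f\<close>, then \<open>f + g + g\<close> is the reflection of \<open>f\<close>, which is thus the function of an ideal.
  Conversely the reflection of \<open>f\<close> is a pseudo-inverse.
\<close>

lemma F_tilde_image_regular:
  "Ft ` vn_regular FM = S_ref_V \<oo>"
proof (intro equalityI subsetI)
  fix f assume "f \<in> Ft ` vn_regular FM"
  then obtain I where fI: "f = Ft I" and "I \<in> vn_regular FM" by (rule imageE)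
  note reg = vn_regular_iff[THEN iffD1, OF this(2)]
  have I: "fracid I" "f = Ft I" by (rule conjunct1[OF reg], rule fI)
  obtain J where JI: "fracid J \<and> I = iprod (iprod I J) I"
    using conjunct2[OF reg] by (rule exE)
  note J = conjunct1[OF JI] and IJI = conjunct2[OF JI]
  note IJ = ideal_prod_fracid[OF I(1) J]
  have mult: "Ft (iprod (iprod I J) I) = fsum (fsum f (Ft J)) f"
    by (simp only: F_tilde_mult[OF IJ I(1)] F_tilde_mult[OF I(1) J] fI)
  have "Ft I = Ft (iprod (iprod I J) I)"
    by (rule arg_cong[where f = "Ft", OF IJI])
  then have feq: "f = fsum (fsum f (Ft J)) f" unfolding mult fI[symmetric] .
  have reg_pt: "f P = f P + Ft J P + f P" if "P \<in> Sp" for P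
    using fun_cong[OF feq, of P] that by simp
  have "reflect f = fsum (fsum f (Ft J)) (Ft J)"
    by (rule ext) (use treal_regular_inverse[OF reg_pt] in \<open>simp add: restrict_def\<close>)
  also have "\<dots> = Ft (iprod (iprod I J) J)"
    unfolding F_tilde_mult[OF IJ J] F_tilde_mult[OF I(1) J] I(2) by simp
  finally have "reflect f \<in> S_b_V \<oo>" using F_tilde_S_b_V[OF ideal_prod_fracid[OF IJ J]] by simp
  then show "f \<in> S_ref_V \<oo>" using S_ref_V_iff F_tilde_S_b_V[OF I(1)] I(2) by simp
next
  fix f assume "f \<in> S_ref_V \<oo>"
  then have f: "f \<in> S_b_V \<oo>" "reflect f \<in> S_b_V \<oo>" using S_ref_V_iff by auto
  obtain I where I: "fracid I" "Ft I = f" by (rule S_b_V_obtain[OF f(1)])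
  obtain J where J: "fracid J" "Ft J = reflect f" by (rule S_b_V_obtain[OF f(2)])
  note IJ = ideal_prod_fracid[OF I(1) J(1)]
  have "fsum (fsum f (reflect f)) f = f"
  proof
    fix P show "fsum (fsum f (reflect f)) f P = f P"
      using treal_iota_regular[of "f P"] S_b_V_extensional[OF f(1)] by (auto simp: restrict_def extensional_def)
  qed
  then have "I = iprod (iprod I J) I"
    by (intro F_tilde_inj[OF I(1) ideal_prod_fracid[OF IJ I(1)]])
      (simp only: F_tilde_mult[OF IJ I(1)] F_tilde_mult[OF I(1) J(1)] I(2) J(2))
  then have "I \<in> vn_regular FM"
    unfolding vn_regular_iff using I(1) J(1) by blast
  then show "f \<in> Ft ` vn_regular FM" using I(2) by blast
qed

text \<open>
  A sum of tagged reals is zero iff both tags vanish and the summands are negatives of each other.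
\<close>

lemma F_tilde_image_invertible: "Ft ` invertible_ideals \<OO> = S_ref_val \<oo>"
proof (intro equalityI subsetI)
  fix f assume "f \<in> Ft ` invertible_ideals \<OO>"
  then obtain I J where I: "fracid I" "f = Ft I" and J: "fracid J"
    and IJ: "iprod I J = \<OO>" by (auto simp: invertible_ideals_def)
  have eq: "fsum f (Ft J) = (\<lambda>P\<in>Sp. 0)"
    unfolding I(2) F_tilde_mult[OF I(1) J, symmetric] IJ by (rule F_tilde_OO)
  have zero: "f P + Ft J P = 0" if "P \<in> Sp" for P using fun_cong[OF eq, of P] that by simp
  have tag: "\<exists>a. f P = TReal a False" "Ft J P = iota (f P)" if "P \<in> Sp" for P
    using treal_sum_zero[OF zero[OF that]] by blast+
  have "reflect f = Ft J"
    by (rule extensionalityI[of _ Sp]) (use tag(2) S_b_V_extensional[OF F_tilde_S_b_V[OF J]] in auto)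
  then have "reflect f \<in> S_b_V \<oo>" using F_tilde_S_b_V[OF J] by simp
  then show "f \<in> S_ref_val \<oo>"
    using S_ref_val_iff S_ref_V_iff F_tilde_S_b_V[OF I(1)] I(2) tag(1) by simp
next
  fix f assume "f \<in> S_ref_val \<oo>"
  then have f: "f \<in> S_b_V \<oo>" "reflect f \<in> S_b_V \<oo>" and tag: "\<And>P. P \<in> Sp \<Longrightarrow> \<exists>a. f P = TReal a False"
    using S_ref_val_iff S_ref_V_iff by auto
  obtain I where I: "fracid I" "Ft I = f" by (rule S_b_V_obtain[OF f(1)])
  obtain J where J: "fracid J" "Ft J = reflect f" by (rule S_b_V_obtain[OF f(2)])
  have "f P + iota (f P) = 0" if "P \<in> Sp" for P using tag[OF that] by (auto simp: zero_treal_def)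
  then have "fsum f (reflect f) = (\<lambda>P\<in>Sp. 0)" by (intro restrict_ext) simp
  then have "iprod I J = \<OO>"
    by (intro F_tilde_inj[OF ideal_prod_fracid[OF I(1) J(1)] fracid_OO])
      (simp only: F_tilde_mult[OF I(1) J(1)] I(2) J(2) F_tilde_OO)
  then show "f \<in> Ft ` invertible_ideals \<OO>" using I J(1) by (auto simp: invertible_ideals_def)
qed

end

theorem theorem2p1:
  fixes \<oo> :: "'a::field set"
  assumes "dedekind_domain \<oo>"
    and "\<not> Ring.field (ring_on \<oo>)"
    and "algebraic_extension (frac_field \<oo>)"
  shows "((\<forall>I. fractional_ideal (integral_closure \<oo>) I \<longrightarrow> F_tilde \<oo> I \<in> S_b_V \<oo>) \<and>
          comm_monoid (frac_ideal_monoid (integral_closure \<oo>)) \<and>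
          comm_monoid (S_b_V_monoid \<oo>) \<and>
          F_tilde \<oo> \<in> iso (frac_ideal_monoid (integral_closure \<oo>)) (S_b_V_monoid \<oo>)) \<and>
         F_tilde \<oo> ` vn_regular (frac_ideal_monoid (integral_closure \<oo>)) = S_ref_V \<oo> \<and>
         F_tilde \<oo> ` invertible_ideals (integral_closure \<oo>) = S_ref_val \<oo>"
proof -
  interpret dedekind_extension \<oo> by unfold_locales (fact assms)+
  show ?thesis
    using F_tilde_S_b_V comm_monoid_ideals comm_monoid_functions F_tilde_iso
      F_tilde_image_regular F_tilde_image_invertible by blast
qed

end
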